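(* Let $d=1$ and assume A1 at $\theta_0\in\Theta$. Let $u_\epsilon>0$, $u_\epsilon\to0$, $\epsilon^{-1}u_\epsilon\to\infty$ as $\epsilon\to0$, and consider testing $H_0:\theta=\theta_0$ versus $H_\epsilon:\theta=\theta_\epsilon:=\theta_0+u_\epsilon$. Let $c<1$ be a constant. Then, for any family of tests $K_\epsilon$ with $\alpha(K_\epsilon)<c<1$ and $\beta(K_\epsilon)<c<1$, $$\limsup_{\epsilon\to0}\left(\epsilon^{-1}u_\epsilon I^{1/2}(\theta_0)\right)^{-1}\left(|2\ln\alpha(K_\epsilon)|^{1/2}+|2\ln\beta(K_\epsilon)|^{1/2}\right)\le1.$$ Moreover, this bound is attained (equality holds) on a family of tests generated by the test statistic $$T=I^{-1/2}(\theta_0)\int_0^1S_\theta(t,\theta_0)\,dY_\epsilon(t).$$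
   Context: Model: for $\epsilon>0$ one observes $Y_\epsilon(t)$, $t\in(0,1)$, with $dY_\epsilon(t)=S(t,\theta)\,dt+\epsilon\,dw(t)$, where $w$ is a standard Wiener process, $S(\cdot,\theta)\in L_2(0,1)$ is a signal, and the unknown parameter $\theta$ belongs to an open set $\Theta\subset\mathbb R^d$ (here $d=1$). $\mathbf P_\theta,\mathbf E_\theta$ denote probability and expectation when the parameter value is $\theta$. A1 (at $\theta_0$): there is a function $S_\theta(\cdot,\theta_0)$ in $L_2(0,1)$ with $\int_0^1\big(S(t,\theta)-S(t,\theta_0)-(\theta-\theta_0)S_\theta(t,\theta_0)\big)^2dt=o(|\theta-\theta_0|^2)$ as $\theta\to\theta_0$, and the Fisher information $I(\theta_0)=\int_0^1S_\theta(t,\theta_0)^2\,dt$ is positive. A test $K_\epsilon$ is a $[0,1]$-valued measurable function of the observation (the probability of rejecting $H_0$); $\alpha(K_\epsilon)=\mathbf E_{\theta_0}[K_\epsilon]$ and $\beta(K_\epsilon)=\mathbf E_{\theta_\epsilon}[1-K_\epsilon]$ are its type I and type II error probabilities. Tests generated by a statistic $T$ are tests that reject $H_0$ when $T$ exceeds a threshold (depending on $\epsilon$). *)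

theory Defs
  imports "HOL-Probability.Probability" "HOL-Library.Landau_Symbols"
begin

definition wiener_process :: "'a measure \<Rightarrow> (real \<Rightarrow> 'a \<Rightarrow> real) \<Rightarrow> bool" where
  "wiener_process M w \<longleftrightarrow>
     prob_space M \<and>
     (\<forall>t\<ge>0. w t \<in> borel_measurable M) \<and>
     (AE \<omega> in M. w 0 \<omega> = 0) \<and>
     (\<forall>s t. 0 \<le> s \<and> s < t \<longrightarrow>
        distributed M lborel (\<lambda>\<omega>. w t \<omega> - w s \<omega>) (normal_density 0 (sqrt (t - s)))) \<and>
     (\<forall>(n::nat) (t::nat \<Rightarrow> real). 0 \<le> t 0 \<and> (\<forall>i<n. t i < t (Suc i)) \<longrightarrow>
        prob_space.indep_vars M (\<lambda>_. borel) (\<lambda>i \<omega>. w (t (Suc i)) \<omega> - w (t i) \<omega>) {..<n}) \<and>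
     (AE \<omega> in M. continuous_on {0..} (\<lambda>t. w t \<omega>))"

definition L2_unit :: "(real \<Rightarrow> real) \<Rightarrow> bool" where
  "L2_unit f \<longleftrightarrow>
     f \<in> borel_measurable (lebesgue_on {0<..<1}) \<and>
     integrable (lebesgue_on {0<..<1}) (\<lambda>t. (f t)\<^sup>2)"

definition fisher_info :: "(real \<Rightarrow> real) \<Rightarrow> real" where
  "fisher_info S' = (LINT t|lebesgue_on {0<..<1}. (S' t)\<^sup>2)"

text \<open>The signal is written \<open>S t \<theta>\<close>; \<open>S'\<close> is its derivative in quadratic mean at \<open>\<theta>0\<close>.\<close>

definition cond_A1 :: "(real \<Rightarrow> real \<Rightarrow> real) \<Rightarrow> real \<Rightarrow> (real \<Rightarrow> real) \<Rightarrow> bool" where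
  "cond_A1 S \<theta>0 S' \<longleftrightarrow>
     L2_unit S' \<and>
     (\<lambda>\<theta>. LINT t|lebesgue_on {0<..<1}. (S t \<theta> - S t \<theta>0 - (\<theta> - \<theta>0) * S' t)\<^sup>2)
        \<in> o[at \<theta>0](\<lambda>\<theta>. \<bar>\<theta> - \<theta>0\<bar>\<^sup>2) \<and>
     fisher_info S' > 0"

text \<open>
  The observation is the path of \<open>Y\<close> on the time set \<open>(0,1)\<close>, with the product (cylinder)
  sigma-algebra, i.e. the one generated by the observed values \<open>Y t\<close>.  Statistics and tests
  are functions on this space, so they depend on the observed path only.
\<close>

definition path_space :: "(real \<Rightarrow> real) measure" where
  "path_space = (\<Pi>\<^sub>M t\<in>{0<..<1}. borel)"

definition observation ::
  "(real \<Rightarrow> 'a \<Rightarrow> real) \<Rightarrow> (real \<Rightarrow> real \<Rightarrow> real) \<Rightarrow> real \<Rightarrow> real \<Rightarrow> real \<Rightarrow> 'a \<Rightarrow> real" where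
  "observation w S \<epsilon> \<theta> t \<omega> = (LINT s|lebesgue_on {0<..<t}. S s \<theta>) + \<epsilon> * w t \<omega>"

definition obs_law ::
  "'a measure \<Rightarrow> (real \<Rightarrow> 'a \<Rightarrow> real) \<Rightarrow> (real \<Rightarrow> real \<Rightarrow> real) \<Rightarrow> real \<Rightarrow> real
     \<Rightarrow> (real \<Rightarrow> real) measure" where
  "obs_law M w S \<epsilon> \<theta> =
     distr M path_space (\<lambda>\<omega>. \<lambda>t\<in>{0<..<1}. observation w S \<epsilon> \<theta> t \<omega>)"

definition is_test :: "((real \<Rightarrow> real) \<Rightarrow> real) \<Rightarrow> bool" where
  "is_test K \<longleftrightarrow>
     K \<in> borel_measurable path_space \<and> (\<forall>y\<in>space path_space. 0 \<le> K y \<and> K y \<le> 1)"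

definition type1_error :: "(real \<Rightarrow> real) measure \<Rightarrow> ((real \<Rightarrow> real) \<Rightarrow> real) \<Rightarrow> real" where
  "type1_error P0 K = (LINT y|P0. K y)"

definition type2_error :: "(real \<Rightarrow> real) measure \<Rightarrow> ((real \<Rightarrow> real) \<Rightarrow> real) \<Rightarrow> real" where
  "type2_error P1 K = (LINT y|P1. 1 - K y)"

text \<open>A list of triples \<open>(a, l, r)\<close> codes the step function
  \<open>\<Sum> a * indicator {l<..r}\<close>; its integral against a path \<open>y\<close> is \<open>\<Sum> a * (y r - y l)\<close>.\<close>

definition step_valid :: "(real \<times> real \<times> real) list \<Rightarrow> bool" where
  "step_valid xs \<longleftrightarrow> (\<forall>(a, l, r)\<in>set xs. 0 < l \<and> l \<le> r \<and> r < 1)"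

definition step_fun :: "(real \<times> real \<times> real) list \<Rightarrow> real \<Rightarrow> real" where
  "step_fun xs s = (\<Sum>(a, l, r)\<leftarrow>xs. a * indicator {l<..r} s)"

definition step_integral :: "(real \<times> real \<times> real) list \<Rightarrow> (real \<Rightarrow> real) \<Rightarrow> real" where
  "step_integral xs y = (\<Sum>(a, l, r)\<leftarrow>xs. a * (y r - y l))"

text \<open>
  \<open>J\<close> is a version, under the law \<open>P\<close> of the observed path, of the stochastic integral of
  \<open>f\<close> in \<open>L\<^sub>2(0,1)\<close> against the path: the mean-square limit of the integrals of step
  functions converging to \<open>f\<close> in \<open>L\<^sub>2(0,1)\<close>.  The mean square is a nonnegative integral, so
  that it is infinite rather than 0 when the square is not integrable.
\<close>

definition is_stoch_integral ::
  "(real \<Rightarrow> real) measure \<Rightarrow> (real \<Rightarrow> real) \<Rightarrow> ((real \<Rightarrow> real) \<Rightarrow> real) \<Rightarrow> bool" where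
  "is_stoch_integral P f J \<longleftrightarrow>
     J \<in> borel_measurable path_space \<and>
     (\<exists>xs :: nat \<Rightarrow> (real \<times> real \<times> real) list.
        (\<forall>n. step_valid (xs n)) \<and>
        (\<lambda>n. LINT s|lebesgue_on {0<..<1}. (step_fun (xs n) s - f s)\<^sup>2) \<longlonglongrightarrow> 0 \<and>
        (\<lambda>n. \<integral>\<^sup>+ y. ennreal ((step_integral (xs n) y - J y)\<^sup>2) \<partial>P) \<longlonglongrightarrow> 0)"

text \<open>\<open>|2 ln p|\<^sup>1\<^sup>/\<^sup>2\<close> for a probability \<open>p\<close>, with the value \<open>\<infinity>\<close> at \<open>p = 0\<close>
  (in HOL, \<open>ln 0 = 0\<close>).\<close>

definition log_error :: "real \<Rightarrow> ereal" where
  "log_error p = (if p = 0 then \<infinity> else ereal (sqrt \<bar>2 * ln p\<bar>))"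

text \<open>A family of tests of \<open>\<theta>0\<close> against \<open>\<theta>0 + u \<epsilon>\<close> whose error probabilities
  are below \<open>c\<close> for all small \<open>\<epsilon>\<close>.\<close>

definition admissible_tests ::
  "'a measure \<Rightarrow> (real \<Rightarrow> 'a \<Rightarrow> real) \<Rightarrow> (real \<Rightarrow> real \<Rightarrow> real) \<Rightarrow> real \<Rightarrow> (real \<Rightarrow> real) \<Rightarrow> real
     \<Rightarrow> (real \<Rightarrow> (real \<Rightarrow> real) \<Rightarrow> real) \<Rightarrow> bool" where
  "admissible_tests M w S \<theta>0 u c K \<longleftrightarrow>
     (\<forall>\<epsilon>>0. is_test (K \<epsilon>)) \<and>
     (\<forall>\<^sub>F \<epsilon> in at_right 0. type1_error (obs_law M w S \<epsilon> \<theta>0) (K \<epsilon>) < c) \<and>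
     (\<forall>\<^sub>F \<epsilon> in at_right 0. type2_error (obs_law M w S \<epsilon> (\<theta>0 + u \<epsilon>)) (K \<epsilon>) < c)"

definition normalized_log_error ::
  "'a measure \<Rightarrow> (real \<Rightarrow> 'a \<Rightarrow> real) \<Rightarrow> (real \<Rightarrow> real \<Rightarrow> real) \<Rightarrow> real \<Rightarrow> (real \<Rightarrow> real)
     \<Rightarrow> (real \<Rightarrow> real) \<Rightarrow> (real \<Rightarrow> (real \<Rightarrow> real) \<Rightarrow> real) \<Rightarrow> real \<Rightarrow> ereal" where
  "normalized_log_error M w S \<theta>0 S' u K \<epsilon> =
     ereal (inverse (inverse \<epsilon> * u \<epsilon> * sqrt (fisher_info S'))) *
       (log_error (type1_error (obs_law M w S \<epsilon> \<theta>0) (K \<epsilon>)) +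
        log_error (type2_error (obs_law M w S \<epsilon> (\<theta>0 + u \<epsilon>)) (K \<epsilon>)))"

definition threshold_test ::
  "((real \<Rightarrow> real) \<Rightarrow> real) \<Rightarrow> (real \<Rightarrow> real) \<Rightarrow> real \<Rightarrow> (real \<Rightarrow> real) \<Rightarrow> real" where
  "threshold_test T h \<epsilon> y = (if T y > h \<epsilon> then 1 else 0)"

end

theory Submission
  imports Defs
begin

text \<open>
  Shifting the signal by \<open>g\<close> changes the law of the path by a likelihood ratio that is log-normal with
  variance \<open>v\<^sup>2\<close>, \<open>v = \<parallel>g\<parallel> / \<epsilon>\<close>. A Chernoff bound for it, proved for finitely many increments and carried to
  the cylinder sigma-algebra by approximation, gives \<open>P\<^sub>1 A \<le> exp (v\<^sup>2/2 + r v) P\<^sub>0 A + exp (- r\<^sup>2/2)\<close>.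
  Hence a test whose power is bounded away from 0 under \<open>P\<^sub>1\<close> has \<open>\<bar>2 ln \<alpha>\<bar>\<^sup>1\<^sup>/\<^sup>2 \<le> v + O(1)\<close>. Applied
  at a point of the segment between the two signals where the power changes from small to large, this bounds
  \<open>\<bar>2 ln \<alpha>\<bar>\<^sup>1\<^sup>/\<^sup>2\<close> and \<open>\<bar>2 ln \<beta>\<bar>\<^sup>1\<^sup>/\<^sup>2\<close> by the two pieces of the segment, whose lengths add up to \<open>v\<close>.
  The bound is attained by thresholding at the midpoint, by Gaussian tail bounds for the stochastic integral.
\<close>

section \<open>Square-integrable functions on the unit interval\<close>

text \<open>The two error probabilities may decay at quite different rates, so in general no
  intermediate signal fixed in advance works: the test selects it through its own power.
  Intermediate signals need not belong to the family \<open>S\<close>; for this reason laws of the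
  path are studied for every square-integrable signal, and A1 enters only at the end, where it gives
  the distance \<open>u \<epsilon> * sqrt (fisher_info S')\<close> up to a relative error tending to
  0. The change of signal is expressed by an inequality between probabilities, not by a density.
  Such an inequality is stable under approximation of the event in measure, so it passes from
  cylinders to all events and no density on the infinite product is constructed. In it
  \<open>r\<close> is fixed by the power at hand alone; the resulting bounded terms disappear on
  division by \<open>v\<close>, because \<open>u \<epsilon> / \<epsilon>\<close> tends to infinity.
  The converse needs only upper bounds for the tails of the stochastic integral, hence only moment
  generating functions of step integrals and not the exact law of their limit.\<close>

definition l2inner :: "(real \<Rightarrow> real) \<Rightarrow> (real \<Rightarrow> real) \<Rightarrow> real" where
  "l2inner f g = (LINT s|lebesgue_on {0<..<1}. f s * g s)"

definition l2norm :: "(real \<Rightarrow> real) \<Rightarrow> real" where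
  "l2norm f = sqrt (LINT s|lebesgue_on {0<..<1}. (f s)\<^sup>2)"

lemma l2norm_nonneg [simp]: "0 \<le> l2norm f"
  by (simp add: l2norm_def)

lemma l2norm_sq: "(l2norm f)\<^sup>2 = (LINT s|lebesgue_on {0<..<1}. (f s)\<^sup>2)"
  by (simp add: l2norm_def)

lemma L2_unit_measurable: "L2_unit f \<Longrightarrow> f \<in> borel_measurable (lebesgue_on {0<..<1})"
  by (simp add: L2_unit_def)

lemma L2_unit_bound:
  assumes "L2_unit h" "f \<in> borel_measurable (lebesgue_on {0<..<1})" "\<And>s. \<bar>f s\<bar> \<le> \<bar>h s\<bar>"
  shows "L2_unit f"
  unfolding L2_unit_def
proof
  show "integrable (lebesgue_on {0<..<1}) (\<lambda>t. (f t)\<^sup>2)"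
  proof (rule Bochner_Integration.integrable_bound)
    show "integrable (lebesgue_on {0<..<1}) (\<lambda>t. (h t)\<^sup>2)"
      using assms(1) by (simp add: L2_unit_def)
    show "(\<lambda>t. (f t)\<^sup>2) \<in> borel_measurable (lebesgue_on {0<..<1})"
      using assms(2) by simp
  qed (use assms(3) in \<open>auto simp: abs_le_square_iff\<close>)
qed fact

lemma L2_unit_cmult: "L2_unit f \<Longrightarrow> L2_unit (\<lambda>s. a * f s)"
  by (auto simp: L2_unit_def power_mult_distrib)

lemma L2_unit_mult_integrable:
  assumes "L2_unit f" "L2_unit g"
  shows "integrable (lebesgue_on {0<..<1}) (\<lambda>s. f s * g s)"
proof (rule Bochner_Integration.integrable_bound)
  show "integrable (lebesgue_on {0<..<1}) (\<lambda>s. (f s)\<^sup>2 + (g s)\<^sup>2)"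
    using assms by (auto simp: L2_unit_def)
  show "(\<lambda>s. f s * g s) \<in> borel_measurable (lebesgue_on {0<..<1})"
    using assms by (auto simp: L2_unit_def)
  have "\<bar>x * y\<bar> \<le> x\<^sup>2 + y\<^sup>2" for x y :: real
    using sum_squares_bound[of "\<bar>x\<bar>" "\<bar>y\<bar>"] abs_ge_zero[of "x * y"] unfolding abs_mult power2_abs by linarith
  then show "AE s in lebesgue_on {0<..<1}. norm (f s * g s) \<le> norm ((f s)\<^sup>2 + (g s)\<^sup>2)"
    by (intro AE_I2) (simp add: order_trans[OF _ abs_ge_self])
qed

lemma L2_unit_add:
  assumes "L2_unit f" "L2_unit g"
  shows "L2_unit (\<lambda>s. f s + g s)"
  using L2_unit_mult_integrable[OF assms] assms
  by (auto simp: L2_unit_def power2_sum mult.assoc)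

lemma L2_unit_diff:
  assumes "L2_unit f" "L2_unit g"
  shows "L2_unit (\<lambda>s. f s - g s)"
  using L2_unit_add[OF assms(1) L2_unit_cmult[OF assms(2), of "-1"]] by simp

lemma finite_measure_unit: "finite_measure (lebesgue_on {0<..<1::real})"
  by (intro finite_measureI) (simp add: emeasure_restrict_space space_restrict_space)

lemma L2_unit_const: "L2_unit (\<lambda>_. a)"
  by (simp add: L2_unit_def finite_measure.integrable_const[OF finite_measure_unit])

lemma L2_unit_integrable: "L2_unit f \<Longrightarrow> integrable (lebesgue_on {0<..<1}) f"
  using L2_unit_mult_integrable[OF _ L2_unit_const, of f 1] by simp

lemma l2norm_add_sq:
  assumes "L2_unit f" "L2_unit g"
  shows "(l2norm (\<lambda>s. f s + g s))\<^sup>2 = (l2norm f)\<^sup>2 + 2 * l2inner f g + (l2norm g)\<^sup>2"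
proof -
  have "(l2norm (\<lambda>s. f s + g s))\<^sup>2
      = (LINT s|lebesgue_on {0<..<1}. (f s)\<^sup>2 + (g s)\<^sup>2 + 2 * (f s * g s))"
    by (simp add: l2norm_sq power2_sum mult.assoc)
  then show ?thesis
    using L2_unit_mult_integrable[OF assms] assms
    by (simp add: l2norm_sq l2inner_def L2_unit_def)
qed

lemma l2norm_cmult: "l2norm (\<lambda>s. a * f s) = \<bar>a\<bar> * l2norm f"
  by (simp add: l2norm_def power_mult_distrib real_sqrt_mult)

lemma l2norm_minus_commute: "l2norm (\<lambda>s. f s - g s) = l2norm (\<lambda>s. g s - f s)"
  by (simp add: l2norm_def power2_commute)

lemma l2inner_commute: "l2inner f g = l2inner g f"
  by (simp add: l2inner_def mult.commute)

lemma l2inner_add: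
  "L2_unit f \<Longrightarrow> L2_unit g \<Longrightarrow> L2_unit h \<Longrightarrow> l2inner (\<lambda>s. f s + g s) h = l2inner f h + l2inner g h"
  by (simp add: l2inner_def distrib_right L2_unit_mult_integrable)

lemma l2inner_cmult: "l2inner (\<lambda>s. a * f s) h = a * l2inner f h"
  by (simp add: l2inner_def mult.assoc)

lemma l2inner_diff:
  "L2_unit f \<Longrightarrow> L2_unit g \<Longrightarrow> L2_unit h \<Longrightarrow> l2inner (\<lambda>s. f s - g s) h = l2inner f h - l2inner g h"
  by (simp add: l2inner_def left_diff_distrib L2_unit_mult_integrable)

lemma l2inner_self: "l2inner f f = (l2norm f)\<^sup>2"
  unfolding l2norm_sq by (simp add: l2inner_def power2_eq_square)

lemma l2_Cauchy_Schwarz: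
  assumes "L2_unit f" "L2_unit g"
  shows "\<bar>l2inner f g\<bar> \<le> l2norm f * l2norm g"
proof -
  define A where "A = (l2norm f)\<^sup>2"
  define B where "B = l2inner f g"
  define C where "C = (l2norm g)\<^sup>2"
  have pos: "0 \<le> A + 2 * t * B + t\<^sup>2 * C" for t
  proof -
    have "0 \<le> (l2norm (\<lambda>s. f s + t * g s))\<^sup>2"
      by simp
    also have "\<dots> = A + 2 * t * B + t\<^sup>2 * C"
      using l2norm_add_sq[OF assms(1) L2_unit_cmult[OF assms(2)], of t]
        l2inner_cmult[of t g f] l2inner_commute[of f]
      by (simp add: A_def B_def C_def l2norm_cmult power_mult_distrib)
    finally show ?thesis .
  qed
  have "B\<^sup>2 \<le> A * C"
  proof (cases "C = 0")
    case True
    \<comment> \<open>For \<open>C = 0\<close> the quadratic is affine in \<open>t\<close>, and at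
      this \<open>t\<close> it would take the value -1 unless \<open>B = 0\<close>.\<close>
    have "2 * (- (A + 1) / (2 * B)) * B = - (A + 1)" if "B \<noteq> 0"
      using that by simp
    with True have "B = 0"
      using pos[of "- (A + 1) / (2 * B)"] by fastforce
    then show ?thesis
      by (simp add: True)
  next
    case False
    then have "C > 0"
      by (simp add: C_def)
    \<comment> \<open>\<open>- B / C\<close> is the minimiser of the quadratic.\<close>
    have "A + 2 * (- B / C) * B + (- B / C)\<^sup>2 * C = A - B\<^sup>2 / C"
      using False by (simp add: power2_eq_square)
    then have "B\<^sup>2 / C \<le> A"
      using pos[of "- B / C"] by linarith
    then show ?thesis
      using \<open>C > 0\<close> by (simp add: pos_divide_le_eq)
  qed
  then have "\<bar>B\<bar>\<^sup>2 \<le> (l2norm f * l2norm g)\<^sup>2"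
    by (simp add: A_def C_def power_mult_distrib)
  then show ?thesis
    unfolding B_def by (rule power2_le_imp_le) simp
qed

lemma l2norm_triangle:
  assumes "L2_unit f" "L2_unit g"
  shows "l2norm (\<lambda>s. f s + g s) \<le> l2norm f + l2norm g"
proof (rule power2_le_imp_le)
  show "(l2norm (\<lambda>s. f s + g s))\<^sup>2 \<le> (l2norm f + l2norm g)\<^sup>2"
    using l2_Cauchy_Schwarz[OF assms] by (simp add: l2norm_add_sq[OF assms] power2_sum)
qed simp

lemma l2norm_triangle_sub:
  assumes "L2_unit f" "L2_unit g"
  shows "l2norm f \<le> l2norm g + l2norm (\<lambda>s. f s - g s)"
  using l2norm_triangle[OF assms(2) L2_unit_diff[OF assms]] by simp

lemma l2norm_dominated:
  assumes "\<And>n. g n \<in> borel_measurable (lebesgue_on {0<..<1})" "L2_unit f" "L2_unit h"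
    and "AE s in lebesgue_on {0<..<1}. (\<lambda>n. g n s) \<longlonglongrightarrow> f s"
    and "\<And>n s. \<bar>g n s\<bar> \<le> \<bar>h s\<bar>"
  shows "(\<lambda>n. l2norm (\<lambda>s. g n s - f s)) \<longlonglongrightarrow> 0"
proof -
  let ?U = "lebesgue_on {0<..<1::real}"
  note [measurable] = assms(1) L2_unit_measurable[OF assms(2)] L2_unit_measurable[OF assms(3)]
  have "(\<lambda>n. LINT s|?U. (g n s - f s)\<^sup>2) \<longlonglongrightarrow> (LINT s|?U. 0)"
  proof (rule integral_dominated_convergence[where w = "\<lambda>s. 2 * (h s)\<^sup>2 + 2 * (f s)\<^sup>2"])
    show "integrable ?U (\<lambda>s. 2 * (h s)\<^sup>2 + 2 * (f s)\<^sup>2)"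
      using assms(2,3) by (simp add: L2_unit_def)
    show "AE s in ?U. (\<lambda>n. (g n s - f s)\<^sup>2) \<longlonglongrightarrow> 0"
      using assms(4) by eventually_elim (auto intro!: tendsto_eq_intros)
    show "AE s in ?U. norm ((g n s - f s)\<^sup>2) \<le> 2 * (h s)\<^sup>2 + 2 * (f s)\<^sup>2" for n
    proof (intro AE_I2)
      fix s
      have "(g n s)\<^sup>2 \<le> (h s)\<^sup>2"
        using assms(5) by (simp add: abs_le_square_iff)
      moreover have "(g n s - f s)\<^sup>2 \<le> 2 * (g n s)\<^sup>2 + 2 * (f s)\<^sup>2"
        using zero_le_power2[of "g n s + f s"] by (simp add: power2_eq_square algebra_simps)
      ultimately show "norm ((g n s - f s)\<^sup>2) \<le> 2 * (h s)\<^sup>2 + 2 * (f s)\<^sup>2"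
        by simp
    qed
  qed auto
  then show ?thesis
    unfolding l2norm_def by (auto dest: tendsto_real_sqrt)
qed

section \<open>Density of the step functions in L2(0,1)\<close>

lemma step_fun_Nil [simp]: "step_fun [] = (\<lambda>s. 0)"
  by (auto simp: step_fun_def)

lemma step_fun_Cons [simp]:
  "step_fun ((a, l, r) # xs) = (\<lambda>s. a * indicator {l<..r} s + step_fun xs s)"
  by (auto simp: step_fun_def)

lemma step_valid_Nil [simp]: "step_valid []"
  by (simp add: step_valid_def)

lemma step_valid_Cons [simp]:
  "step_valid ((a, l, r) # xs) \<longleftrightarrow> 0 < l \<and> l \<le> r \<and> r < 1 \<and> step_valid xs"
  by (auto simp: step_valid_def)

lemma L2_unit_indicator: "L2_unit (\<lambda>s. indicator {l<..r} s)"
proof (rule L2_unit_bound[OF L2_unit_const[of 1]])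
  show "(\<lambda>s. indicator {l<..r} s :: real) \<in> borel_measurable (lebesgue_on {0<..<1})"
    by (intro measurable_restrict_space1 measurable_completion) measurable
qed (auto simp: indicator_def)

lemma L2_unit_step_fun: "L2_unit (step_fun xs)"
proof (induction xs)
  case Nil
  then show ?case by (simp add: L2_unit_const)
next
  case (Cons x xs)
  then show ?case
    by (cases x) (simp add: L2_unit_add L2_unit_cmult L2_unit_indicator)
qed

text \<open>Membership in the L2 closure of the admissible step functions. Stated for a single
  function, the property passes to L2 limits, and so climbs from continuous functions to all of
  L2.\<close>

definition step_approximable :: "(real \<Rightarrow> real) \<Rightarrow> bool" where
  "step_approximable f \<longleftrightarrow> (\<forall>e>0. \<exists>xs. step_valid xs \<and> l2norm (\<lambda>s. step_fun xs s - f s) < e)"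

lemma step_approximable_limit:
  assumes "\<And>n. step_approximable (g n)" "\<And>n. L2_unit (g n)" "L2_unit f"
    and "(\<lambda>n. l2norm (\<lambda>s. g n s - f s)) \<longlonglongrightarrow> 0"
  shows "step_approximable f"
  unfolding step_approximable_def
proof (intro allI impI)
  fix e :: real assume "e > 0"
  then have "eventually (\<lambda>n. l2norm (\<lambda>s. g n s - f s) < e / 2) sequentially"
    using assms(4) by (intro order_tendstoD) auto
  then obtain n where n: "l2norm (\<lambda>s. g n s - f s) < e / 2"
    by (auto simp: eventually_sequentially)
  obtain xs where xs: "step_valid xs" "l2norm (\<lambda>s. step_fun xs s - g n s) < e / 2"
    using assms(1)[of n] \<open>e > 0\<close> half_gt_zero unfolding step_approximable_def by blast
  have "l2norm (\<lambda>s. step_fun xs s - f s)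
      \<le> l2norm (\<lambda>s. step_fun xs s - g n s) + l2norm (\<lambda>s. g n s - f s)"
    using l2norm_triangle[OF L2_unit_diff[OF L2_unit_step_fun[of xs] assms(2)[of n]]
        L2_unit_diff[OF assms(2)[of n] assms(3)]]
    by simp
  with n xs show "\<exists>xs. step_valid xs \<and> l2norm (\<lambda>s. step_fun xs s - f s) < e"
    by (intro exI[of _ xs]) auto
qed

text \<open>Left-endpoint sampling on the grid of mesh \<open>1 / N\<close>. The first and the last
  cell are left out because \<open>step_valid\<close> keeps both endpoints strictly inside
  (0,1).\<close>

definition sampled_step :: "(real \<Rightarrow> real) \<Rightarrow> nat \<Rightarrow> (real \<times> real \<times> real) list" where
  "sampled_step g N = map (\<lambda>j. (g (j / N), j / N, (j + 1) / N)) [1..<N-1]"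

lemma sampled_step_valid: "step_valid (sampled_step g N)"
  by (auto simp: sampled_step_def step_valid_def divide_simps)

text \<open>Cells are open on the left, so \<open>s\<close> lies in the cell of index
  \<open>\<lceil>N * s\<rceil> - 1\<close>; positivity of \<open>s\<close> keeps \<open>nat\<close>
  from truncating this index.\<close>

lemma sampled_step_fun:
  assumes "N > 0" "s > 0"
  defines "j \<equiv> nat (\<lceil>N * s\<rceil> - 1)"
  shows "step_fun (sampled_step g N) s = (if j \<in> {1..<N-1} then g (j / N) else 0)"
proof -
  have ceil: "\<lceil>N * s\<rceil> \<ge> 1"
    using assms(1,2) by (simp add: one_le_ceiling)
  have ind: "indicator {real i / N<..(real i + 1) / N} s = (of_bool (i = j) :: real)" for i :: nat
  proof -
    have "s \<in> {real i / N<..(real i + 1) / N} \<longleftrightarrow> \<lceil>N * s\<rceil> = int i + 1"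
      using assms(1) by (auto simp: ceiling_eq_iff field_simps)
    also have "\<dots> \<longleftrightarrow> i = j"
      using ceil by (auto simp: j_def)
    finally show ?thesis
      by (simp add: indicator_def)
  qed
  have "step_fun (sampled_step g N) s
      = (\<Sum>i\<in>{1..<N-1}. g (i / N) * indicator {real i / N<..(real i + 1) / N} s)"
    unfolding step_fun_def sampled_step_def
    by (simp add: o_def interv_sum_list_conv_sum_set_nat add.commute)
  also have "\<dots> = (\<Sum>i\<in>{1..<N-1}. if i = j then g (i / N) else 0)"
    unfolding ind by (intro sum.cong) auto
  finally show ?thesis
    by simp
qed

lemma sampled_step_tendsto:
  assumes "isCont g s" "0 < s" "s < 1"
  shows "(\<lambda>N. step_fun (sampled_step g N) s) \<longlonglongrightarrow> g s"
proof -
  define j where "j N = nat (\<lceil>real N * s\<rceil> - 1)" for N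
  have j: "N * s - 1 \<le> j N" "j N < N * s" if "N > 0" for N
  proof -
    have "\<lceil>N * s\<rceil> \<ge> 1"
      using that assms(2) by (simp add: one_le_ceiling)
    then have "real (j N) = of_int \<lceil>N * s\<rceil> - 1"
      by (simp add: j_def)
    then show "N * s - 1 \<le> j N" "j N < N * s"
      by linarith+
  qed
  have lim: "(\<lambda>N. j N / N) \<longlonglongrightarrow> s"
  proof (rule tendsto_sandwich)
    show "\<forall>\<^sub>F N in sequentially. s - 1 / N \<le> j N / N"
      using eventually_gt_at_top[of 0]
    proof eventually_elim
      case (elim N)
      have "s - 1 / N = (N * s - 1) / N"
        using elim by (simp add: field_simps)
      also have "\<dots> \<le> j N / N"
        by (intro divide_right_mono j(1) elim) simp
      finally show ?case .
    qed
    show "\<forall>\<^sub>F N in sequentially. j N / N \<le> s"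
      using eventually_gt_at_top[of 0]
    proof eventually_elim
      case (elim N)
      then show ?case
        using j(2)[OF elim] by (simp add: pos_divide_le_eq mult.commute)
    qed
    show "(\<lambda>N. s - 1 / real N) \<longlonglongrightarrow> s"
      using tendsto_diff[OF tendsto_const lim_1_over_n, of s] by simp
  qed simp
  have ev: "\<forall>\<^sub>F N in sequentially. j N \<in> {1..<N-1} \<and> N > 0"
  proof -
    have "filterlim (\<lambda>N. s * real N) at_top sequentially" "filterlim (\<lambda>N. (1 - s) * real N) at_top sequentially"
      using assms(2,3) by (intro filterlim_tendsto_pos_mult_at_top[OF tendsto_const] filterlim_real_sequentially; simp)+
    \<comment> \<open>The constant 2 moves \<open>s\<close> past the omitted cells:
      \<open>j N \<ge> N * s - 1 \<ge> 1\<close> and \<open>j N < N * s \<le> N - 2\<close>.\<close>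
    then have "\<forall>\<^sub>F N in sequentially. s * real N \<ge> 2" "\<forall>\<^sub>F N in sequentially. (1 - s) * real N \<ge> 2"
      by (auto simp: filterlim_at_top)
    then show ?thesis
      using eventually_gt_at_top[of 0]
    proof eventually_elim
      case (elim N)
      have "real (j N) \<ge> 1"
        using j(1)[of N] elim by (simp add: algebra_simps)
      moreover have "real (j N) < real N - 1"
        using j(2)[of N] elim by (simp add: algebra_simps)
      ultimately show ?case
        using elim(3) by (auto simp: of_nat_diff)
    qed
  qed
  have "(\<lambda>N. g (j N / N)) \<longlonglongrightarrow> g s"
    using isCont_tendsto_compose[OF assms(1) lim] .
  moreover have "\<forall>\<^sub>F N in sequentially. g (j N / N) = step_fun (sampled_step g N) s"
    using ev by eventually_elim (use sampled_step_fun[OF _ assms(2)] in \<open>simp add: j_def\<close>)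
  ultimately show ?thesis
    by (rule Lim_transform_eventually)
qed

lemma step_approximable_continuous:
  assumes "continuous_on UNIV g" "\<And>s. \<bar>g s\<bar> \<le> B"
  shows "step_approximable g" "L2_unit g"
proof -
  have B: "0 \<le> B"
    using assms(2)[of 0] by linarith
  have gm: "g \<in> borel_measurable (lebesgue_on {0<..<1})"
    using borel_measurable_continuous_onI[OF assms(1)]
    by (simp add: measurable_restrict_space1 measurable_completion)
  show g: "L2_unit g"
    using assms(2) B by (intro L2_unit_bound[OF L2_unit_const[of B]] gm) auto
  \<comment> \<open>The formula for the sampled function is for \<open>s > 0\<close>, whereas
    \<open>l2norm_dominated\<close> asks for a bound at every real \<open>s\<close>; the cut to 0
    elsewhere does not affect norms over (0,1).\<close>
  have bnd: "\<bar>if 0 < s then step_fun (sampled_step g n) s else 0\<bar> \<le> \<bar>B\<bar>" for n s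
  proof (cases "n = 0")
    case True
    then show ?thesis using B by (simp add: sampled_step_def)
  next
    case False
    then show ?thesis using B assms(2) by (auto simp: sampled_step_fun)
  qed
  have "(\<lambda>n. l2norm (\<lambda>s. (if 0 < s then step_fun (sampled_step g n) s else 0) - g s)) \<longlonglongrightarrow> 0"
  proof (rule l2norm_dominated[OF _ g L2_unit_const[of B] _ bnd])
    show "AE s in lebesgue_on {0<..<1}.
        (\<lambda>n. if 0 < s then step_fun (sampled_step g n) s else 0) \<longlonglongrightarrow> g s"
      using sampled_step_tendsto assms(1)
      by (intro AE_I2) (auto simp: space_restrict_space continuous_on_eq_continuous_at)
    fix n
    have "step_fun (sampled_step g n) \<in> borel_measurable (lebesgue_on {0<..<1})"
      by (rule L2_unit_measurable[OF L2_unit_step_fun])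
    then show "(\<lambda>s. if 0 < s then step_fun (sampled_step g n) s else 0) \<in> borel_measurable (lebesgue_on {0<..<1})"
      by (subst measurable_cong[of _ _ "step_fun (sampled_step g n)"]) (auto simp: space_restrict_space)
  qed
  moreover have "l2norm (\<lambda>s. (if 0 < s then step_fun (sampled_step g n) s else 0) - g s)
      = l2norm (\<lambda>s. step_fun (sampled_step g n) s - g s)" for n
    unfolding l2norm_def
    by (intro arg_cong[of _ _ sqrt] Bochner_Integration.integral_cong) (auto simp: space_restrict_space)
  ultimately have lim: "(\<lambda>n. l2norm (\<lambda>s. step_fun (sampled_step g n) s - g s)) \<longlonglongrightarrow> 0"
    by simp
  show "step_approximable g"
    unfolding step_approximable_def
  proof (intro allI impI)
    fix e :: real assume "e > 0"
    then have "eventually (\<lambda>n. l2norm (\<lambda>s. step_fun (sampled_step g n) s - g s) < e) sequentially"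
      using lim by (intro order_tendstoD) auto
    then show "\<exists>xs. step_valid xs \<and> l2norm (\<lambda>s. step_fun xs s - g s) < e"
      using sampled_step_valid by (auto simp: eventually_sequentially)
  qed
qed

text \<open>A measurable function is an almost everywhere limit of continuous functions, but without
  a common majorant. Truncation at level \<open>k\<close> supplies one: \<open>clip k (g n)\<close>
  tends to \<open>clip k f\<close> under the bound \<open>k\<close>, and then
  \<open>clip k f\<close> tends to \<open>f\<close> under the bound
  \<open>\<bar>f\<bar>\<close>.\<close>

lemma step_approximable_L2:
  assumes "L2_unit f"
  shows "step_approximable f"
proof -
  let ?U = "lebesgue_on {0<..<1::real}"
  define clip where "clip k x = max (- real k) (min (real k) x)" for k x
  have clip_bound: "\<bar>clip k x\<bar> \<le> \<bar>real k\<bar>" "\<bar>clip k x\<bar> \<le> \<bar>x\<bar>" for k x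
    by (auto simp: clip_def)
  have clip_cont: "continuous_on UNIV (clip k)" for k
    unfolding clip_def by (intro continuous_intros)
  note [measurable] = L2_unit_measurable[OF assms]
  have clip_meas: "(\<lambda>s. clip k (f s)) \<in> borel_measurable ?U" for k
    unfolding clip_def by measurable
  have clip_L2: "L2_unit (\<lambda>s. clip k (f s))" for k
    by (rule L2_unit_bound[OF assms clip_meas clip_bound(2)])
  have "f measurable_on {0<..<1}"
    using L2_unit_measurable[OF assms] by (simp add: measurable_on_iff_borel_measurable)
  then obtain N g where N: "negligible N" and g: "\<And>n. continuous_on UNIV (g n)"
    and lim: "\<And>x. x \<notin> N \<Longrightarrow> (\<lambda>n. g n x) \<longlonglongrightarrow> (if x \<in> {0<..<1} then f x else 0)"
    unfolding measurable_on_def by blast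
  have "step_approximable (\<lambda>s. clip k (f s))" for k
  proof (rule step_approximable_limit[where g = "\<lambda>n s. clip k (g n s)"])
    have c: "continuous_on UNIV (\<lambda>s. clip k (g n s))" for n
      using continuous_on_compose2[OF clip_cont g] by auto
    show "step_approximable (\<lambda>s. clip k (g n s))" "L2_unit (\<lambda>s. clip k (g n s))" for n
      using step_approximable_continuous[OF c clip_bound(1)] by auto
    then have m: "(\<lambda>s. clip k (g n s)) \<in> borel_measurable ?U" for n
      by (simp add: L2_unit_measurable)
    show "(\<lambda>n. l2norm (\<lambda>s. clip k (g n s) - clip k (f s))) \<longlonglongrightarrow> 0"
    proof (rule l2norm_dominated[OF m clip_L2 L2_unit_const[of "real k"] _ clip_bound(1)])
      have "AE s in lebesgue. s \<notin> N"
        using N by (intro AE_not_in) (simp add: negligible_iff_null_sets)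
      then have "AE s in ?U. s \<notin> N"
        by (auto simp: AE_restrict_space_iff elim: AE_mp)
      moreover have "AE s in ?U. s \<in> {0<..<1}"
        by (intro AE_I2) (simp add: space_restrict_space)
      ultimately show "AE s in ?U. (\<lambda>n. clip k (g n s)) \<longlonglongrightarrow> clip k (f s)"
      proof eventually_elim
        case (elim s)
        then have "(\<lambda>n. g n s) \<longlonglongrightarrow> f s"
          using lim[of s] by simp
        then show ?case
          using clip_cont[of k] by (auto simp: continuous_on_eq_continuous_at intro: isCont_tendsto_compose)
      qed
    qed
  qed (rule clip_L2)
  then show ?thesis
  proof (rule step_approximable_limit[OF _ clip_L2 assms])
    show "(\<lambda>n. l2norm (\<lambda>s. clip n (f s) - f s)) \<longlonglongrightarrow> 0"
    proof (rule l2norm_dominated[OF clip_meas assms assms _ clip_bound(2)], intro AE_I2)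
      fix s
      have "\<forall>\<^sub>F n in sequentially. \<bar>f s\<bar> \<le> real n"
        using filterlim_real_sequentially by (simp add: filterlim_at_top)
      then have "\<forall>\<^sub>F n in sequentially. f s = clip n (f s)"
        by eventually_elim (auto simp: clip_def)
      then show "(\<lambda>n. clip n (f s)) \<longlonglongrightarrow> f s"
        by (rule Lim_transform_eventually[OF tendsto_const])
    qed
  qed
qed

section \<open>Shifts of Gaussian product measures\<close>

abbreviation centred_normal :: "real \<Rightarrow> real measure" where
  "centred_normal \<sigma> \<equiv> density lborel (\<lambda>x. ennreal (normal_density 0 \<sigma> x))"

text \<open>Completing the square: an exponential tilt moves the mean by
  \<open>a * \<sigma>\<^sup>2\<close> and keeps the variance. Integrated, this gives the moment
  generating function; read as a density, it gives the shifted law.\<close>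

lemma normal_density_tilt:
  assumes "\<sigma> > 0"
  shows "exp (a * x) * normal_density 0 \<sigma> x = exp (a\<^sup>2 * \<sigma>\<^sup>2 / 2) * normal_density (a * \<sigma>\<^sup>2) \<sigma> x"
proof -
  have "a * x - x\<^sup>2 / (2 * \<sigma>\<^sup>2) = a\<^sup>2 * \<sigma>\<^sup>2 / 2 - (x - a * \<sigma>\<^sup>2)\<^sup>2 / (2 * \<sigma>\<^sup>2)"
    using assms by (simp add: field_simps power2_eq_square)
  then have "exp (a * x) * exp (- (x\<^sup>2) / (2 * \<sigma>\<^sup>2))
      = exp (a\<^sup>2 * \<sigma>\<^sup>2 / 2) * exp (- ((x - a * \<sigma>\<^sup>2)\<^sup>2) / (2 * \<sigma>\<^sup>2))"
    by (simp add: exp_add[symmetric])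
  then show ?thesis
    by (simp add: normal_density_def field_simps)
qed

lemma nn_integral_exp_normal:
  assumes "\<sigma> > 0"
  shows "(\<integral>\<^sup>+x. ennreal (exp (a * x)) \<partial>centred_normal \<sigma>) = ennreal (exp (a\<^sup>2 * \<sigma>\<^sup>2 / 2))"
proof -
  interpret prob_space "density lborel (\<lambda>x. ennreal (normal_density (a * \<sigma>\<^sup>2) \<sigma> x))"
    by (rule prob_space_normal_density[OF assms])
  have "(\<integral>\<^sup>+x. ennreal (exp (a * x)) \<partial>centred_normal \<sigma>)
      = (\<integral>\<^sup>+x. ennreal (exp (a * x) * normal_density 0 \<sigma> x) \<partial>lborel)"
    by (simp add: nn_integral_density ennreal_mult' mult.commute)
  also have "\<dots> = ennreal (exp (a\<^sup>2 * \<sigma>\<^sup>2 / 2)) * (\<integral>\<^sup>+x. ennreal (normal_density (a * \<sigma>\<^sup>2) \<sigma> x) \<partial>lborel)"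
    by (simp add: normal_density_tilt[OF assms] ennreal_mult' nn_integral_cmult)
  also have "(\<integral>\<^sup>+x. ennreal (normal_density (a * \<sigma>\<^sup>2) \<sigma> x) \<partial>lborel) = 1"
    using emeasure_space_1 by (simp add: emeasure_density)
  finally show ?thesis
    by simp
qed

lemma centred_normal_shift:
  assumes "\<sigma> > 0"
  shows "distr (centred_normal \<sigma>) borel (\<lambda>x. x + m) = density lborel (\<lambda>x. ennreal (normal_density m \<sigma> x))"
proof -
  interpret prob_space "centred_normal \<sigma>"
    by (rule prob_space_normal_density[OF assms])
  have "distributed (centred_normal \<sigma>) lborel (\<lambda>x. x) (normal_density 0 \<sigma>)"
    by (auto simp: distributed_def intro!: distr_id2)
  from normal_density_affine[OF this assms, of 1 m] show ?thesis
    by (simp add: distributed_def add.commute cong: distr_cong)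
qed

text \<open>\<open>m / \<sigma>\<^sup>2\<close> is the tilt that moves the mean to \<open>m\<close>;
  the exponential is the likelihood ratio of a single increment.\<close>

lemma normal_density_eq_tilted:
  assumes "\<sigma> > 0"
  shows "density lborel (\<lambda>x. ennreal (normal_density m \<sigma> x))
       = density (centred_normal \<sigma>) (\<lambda>x. ennreal (exp (m / \<sigma>\<^sup>2 * x - m\<^sup>2 / (2 * \<sigma>\<^sup>2))))"
proof -
  have "normal_density m \<sigma> x = normal_density 0 \<sigma> x * exp (m / \<sigma>\<^sup>2 * x - m\<^sup>2 / (2 * \<sigma>\<^sup>2))" for x
  proof -
    have "(m / \<sigma>\<^sup>2)\<^sup>2 * \<sigma>\<^sup>2 / 2 = m\<^sup>2 / (2 * \<sigma>\<^sup>2)" "m / \<sigma>\<^sup>2 * \<sigma>\<^sup>2 = m"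
      using assms by (simp_all add: power2_eq_square)
    then show ?thesis
      using normal_density_tilt[OF assms, of "m / \<sigma>\<^sup>2" x] by (simp add: exp_diff mult.commute)
  qed
  then show ?thesis
    by (simp add: density_density_eq ennreal_mult')
qed

section \<open>Finite products of centred normal laws\<close>

lemma product_sigma_finite_normal:
  "(\<And>i. \<sigma> i > 0) \<Longrightarrow> product_sigma_finite (\<lambda>i. centred_normal (\<sigma> i))"
  by (intro product_sigma_finite.intro prob_space_imp_sigma_finite prob_space_normal_density)

lemma nn_integral_exp_PiM_normal:
  assumes "finite I" "\<And>i. \<sigma> i > 0"
  shows "(\<integral>\<^sup>+x. ennreal (exp (\<Sum>i\<in>I. a i * x i)) \<partial>PiM I (\<lambda>i. centred_normal (\<sigma> i)))
       = ennreal (exp ((\<Sum>i\<in>I. (a i)\<^sup>2 * (\<sigma> i)\<^sup>2) / 2))"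
proof -
  interpret product_sigma_finite "\<lambda>i. centred_normal (\<sigma> i)"
    by (rule product_sigma_finite_normal[OF assms(2)])
  have "(\<integral>\<^sup>+x. ennreal (exp (\<Sum>i\<in>I. a i * x i)) \<partial>PiM I (\<lambda>i. centred_normal (\<sigma> i)))
      = (\<integral>\<^sup>+x. (\<Prod>i\<in>I. ennreal (exp (a i * x i))) \<partial>PiM I (\<lambda>i. centred_normal (\<sigma> i)))"
    by (simp add: exp_sum[OF assms(1)] prod_ennreal)
  also have "\<dots> = (\<Prod>i\<in>I. ennreal (exp ((a i)\<^sup>2 * (\<sigma> i)\<^sup>2 / 2)))"
    by (simp add: product_nn_integral_prod[OF assms(1), of "\<lambda>i x. ennreal (exp (a i * x))"]
        nn_integral_exp_normal[OF assms(2)])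
  finally show ?thesis
    by (simp add: prod_ennreal exp_sum[OF assms(1)] sum_divide_distrib)
qed

text \<open>The finite-dimensional Cameron-Martin formula. Both sides are identified with the
  product of the shifted normals by their values on boxes: the left one because the shift acts
  coordinatewise, the right one because the exponential of a sum and the indicator of a box both
  factor.\<close>

lemma PiM_normal_shift:
  assumes "finite I" "\<And>i. \<sigma> i > 0"
  defines "N \<equiv> PiM I (\<lambda>i. centred_normal (\<sigma> i))"
  shows "distr N (PiM I (\<lambda>_. borel)) (\<lambda>x. \<lambda>i\<in>I. x i + m i)
       = density N (\<lambda>x. ennreal (exp ((\<Sum>i\<in>I. m i / (\<sigma> i)\<^sup>2 * x i) - (\<Sum>i\<in>I. (m i)\<^sup>2 / (\<sigma> i)\<^sup>2) / 2)))"
    (is "?L = ?R")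
proof -
  interpret N: product_sigma_finite "\<lambda>i. centred_normal (\<sigma> i)"
    by (rule product_sigma_finite_normal[OF assms(2)])
  define Q where "Q i = density lborel (\<lambda>x. ennreal (normal_density (m i) (\<sigma> i) x))" for i
  interpret Q: product_sigma_finite Q
    unfolding Q_def
    by (intro product_sigma_finite.intro prob_space_imp_sigma_finite prob_space_normal_density assms(2))
  have sets_N[measurable_cong]: "sets N = sets (PiM I (\<lambda>_. borel))"
    unfolding N_def by (intro sets_PiM_cong) auto
  have sets_Q: "sets (PiM I Q) = sets (PiM I (\<lambda>_. borel))"
    unfolding Q_def by (intro sets_PiM_cong) auto
  have "?L = PiM I Q"
  proof (rule Q.PiM_eqI[OF assms(1)])
    fix A assume "\<And>i. i \<in> I \<Longrightarrow> A i \<in> sets (Q i)"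
    then have A: "\<And>i. i \<in> I \<Longrightarrow> A i \<in> sets borel"
      by (simp add: Q_def)
    have A': "(\<lambda>x. x + m i) -` A i \<in> sets (centred_normal (\<sigma> i))" if "i \<in> I" for i
      using measurable_sets[OF _ A[OF that], of "\<lambda>x. x + m i" borel] by simp
    have "emeasure ?L (Pi\<^sub>E I A) = emeasure N ((\<lambda>x. \<lambda>i\<in>I. x i + m i) -` Pi\<^sub>E I A \<inter> space N)"
      using A assms(1) by (intro emeasure_distr) (auto intro!: sets_PiM_I_finite)
    also have "(\<lambda>x. \<lambda>i\<in>I. x i + m i) -` Pi\<^sub>E I A \<inter> space N = Pi\<^sub>E I (\<lambda>i. (\<lambda>x. x + m i) -` A i)"
      by (auto simp: N_def space_PiM PiE_iff)
    also have "emeasure N \<dots> = (\<Prod>i\<in>I. emeasure (centred_normal (\<sigma> i)) ((\<lambda>x. x + m i) -` A i))"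
      unfolding N_def by (rule N.emeasure_PiM[OF assms(1) A'])
    also have "\<dots> = (\<Prod>i\<in>I. emeasure (Q i) (A i))"
    proof (intro prod.cong refl)
      fix i assume "i \<in> I"
      then show "emeasure (centred_normal (\<sigma> i)) ((\<lambda>x. x + m i) -` A i) = emeasure (Q i) (A i)"
        unfolding Q_def centred_normal_shift[OF assms(2)[of i], of "m i", symmetric]
        using A by (simp add: emeasure_distr)
    qed
    finally show "emeasure ?L (Pi\<^sub>E I A) = (\<Prod>i\<in>I. emeasure (Q i) (A i))" .
  qed (simp add: sets_Q)
  also have "\<dots> = ?R"
  proof (rule Q.PiM_eqI[OF assms(1), symmetric])
    let ?f = "\<lambda>i x. exp (m i / (\<sigma> i)\<^sup>2 * x - (m i)\<^sup>2 / (2 * (\<sigma> i)\<^sup>2))"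
    fix A assume "\<And>i. i \<in> I \<Longrightarrow> A i \<in> sets (Q i)"
    then have A: "\<And>i. i \<in> I \<Longrightarrow> A i \<in> sets borel"
      by (simp add: Q_def)
    have "emeasure ?R (Pi\<^sub>E I A)
        = (\<integral>\<^sup>+x. (\<Prod>i\<in>I. ennreal (?f i (x i)) * indicator (A i) (x i)) \<partial>N)"
    proof (subst emeasure_density)
      show "Pi\<^sub>E I A \<in> sets N"
        unfolding sets_N using A assms(1) by (auto intro!: sets_PiM_I_finite)
      show "(\<integral>\<^sup>+x. ennreal (exp ((\<Sum>i\<in>I. m i / (\<sigma> i)\<^sup>2 * x i) - (\<Sum>i\<in>I. (m i)\<^sup>2 / (\<sigma> i)\<^sup>2) / 2)) * indicator (Pi\<^sub>E I A) x \<partial>N)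
          = (\<integral>\<^sup>+x. (\<Prod>i\<in>I. ennreal (?f i (x i)) * indicator (A i) (x i)) \<partial>N)"
      proof (rule nn_integral_cong)
        fix x assume x: "x \<in> space N"
        have "(indicator (Pi\<^sub>E I A) x :: ennreal) = (\<Prod>i\<in>I. indicator (A i) (x i))"
        proof (cases "x \<in> Pi\<^sub>E I A")
          case True
          then show ?thesis
            by (auto simp: PiE_iff intro!: prod.neutral[symmetric])
        next
          case False
          then obtain i where "i \<in> I" "x i \<notin> A i"
            using x by (auto simp: N_def space_PiM PiE_iff)
          then have "(\<Prod>i\<in>I. indicator (A i) (x i) :: ennreal) = 0"
            by (intro prod_zero assms(1)) (auto simp: indicator_def)
          then show ?thesis
            using False by simp
        qed
        then show "ennreal (exp ((\<Sum>i\<in>I. m i / (\<sigma> i)\<^sup>2 * x i) - (\<Sum>i\<in>I. (m i)\<^sup>2 / (\<sigma> i)\<^sup>2) / 2)) * indicator (Pi\<^sub>E I A) x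
            = (\<Prod>i\<in>I. ennreal (?f i (x i)) * indicator (A i) (x i))"
          by (simp add: prod.distrib prod_ennreal exp_sum[OF assms(1), symmetric] sum_subtractf
              sum_divide_distrib mult.commute)
      qed
      show "(\<lambda>x. ennreal (exp ((\<Sum>i\<in>I. m i / (\<sigma> i)\<^sup>2 * x i) - (\<Sum>i\<in>I. (m i)\<^sup>2 / (\<sigma> i)\<^sup>2) / 2)))
          \<in> borel_measurable N"
        by measurable
    qed
    also have "\<dots> = (\<Prod>i\<in>I. \<integral>\<^sup>+x. ennreal (?f i x) * indicator (A i) x \<partial>centred_normal (\<sigma> i))"
      unfolding N_def using A by (intro N.product_nn_integral_prod[OF assms(1)]) simp
    also have "\<dots> = (\<Prod>i\<in>I. emeasure (Q i) (A i))"
    proof (intro prod.cong refl)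
      fix i assume "i \<in> I"
      then show "(\<integral>\<^sup>+x. ennreal (?f i x) * indicator (A i) x \<partial>centred_normal (\<sigma> i)) = emeasure (Q i) (A i)"
        unfolding Q_def normal_density_eq_tilted[OF assms(2)[of i], of "m i"]
        using A by (subst emeasure_density) auto
    qed
    finally show "emeasure ?R (Pi\<^sub>E I A) = (\<Prod>i\<in>I. emeasure (Q i) (A i))" .
  qed (simp add: sets_N sets_Q)
  finally show ?thesis .
qed

text \<open>The likelihood ratio \<open>L = exp l\<close> satisfies \<open>L \<le> e\<^sup>\<kappa>\<close> or \<open>L \<le> L (L / e\<^sup>\<kappa>)\<^sup>h\<close>; the choice
  \<open>\<kappa> = V/2 + r \<surd>V\<close>, \<open>h = r / \<surd>V\<close> is the Chernoff bound for the Gaussian log-likelihood.\<close>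

lemma gaussian_shift_bound:
  assumes "finite I" "\<And>i. \<sigma> i > 0" "B \<in> sets (PiM I (\<lambda>_. borel))"
    and V: "(\<Sum>i\<in>I. (m i)\<^sup>2 / (\<sigma> i)\<^sup>2) \<le> V" "V > 0" and r: "r \<ge> 0"
  defines "N \<equiv> PiM I (\<lambda>i. centred_normal (\<sigma> i))"
  shows "emeasure (distr N (PiM I (\<lambda>_. borel)) (\<lambda>x. \<lambda>i\<in>I. x i + m i)) B
       \<le> ennreal (exp (V / 2 + r * sqrt V)) * emeasure N B + ennreal (exp (- r\<^sup>2 / 2))"
proof -
  have sets_N[measurable_cong]: "sets N = sets (PiM I (\<lambda>_. borel))"
    unfolding N_def by (intro sets_PiM_cong) auto
  have [measurable]: "B \<in> sets N"
    using assms(3) by (simp add: sets_N)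
  define v where "v = (\<Sum>i\<in>I. (m i)\<^sup>2 / (\<sigma> i)\<^sup>2)"
  define l where "l x = (\<Sum>i\<in>I. m i / (\<sigma> i)\<^sup>2 * x i) - v / 2" for x
  define \<kappa> where "\<kappa> = V / 2 + r * sqrt V"
  define h where "h = r / sqrt V"
  have h: "h \<ge> 0"
    using r V by (simp add: h_def)
  have [measurable]: "l \<in> borel_measurable N"
    unfolding l_def by measurable
  \<comment> \<open>Under \<open>N\<close> the log-likelihood \<open>l\<close> is normal with mean
    \<open>- v / 2\<close> and variance \<open>v\<close>, hence the exponent
    \<open>h * (1 + h) * v / 2\<close>.\<close>
  have "(\<integral>\<^sup>+x. ennreal (exp ((1 + h) * l x)) \<partial>N)
      = (\<integral>\<^sup>+x. ennreal (exp (- (1 + h) * v / 2)) * ennreal (exp (\<Sum>i\<in>I. ((1 + h) * m i / (\<sigma> i)\<^sup>2) * x i)) \<partial>N)"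
    by (intro nn_integral_cong)
       (simp add: l_def ennreal_mult'[symmetric] exp_add[symmetric] algebra_simps sum_distrib_left
         add_divide_distrib diff_divide_distrib)
  also have "\<dots> = ennreal (exp (- (1 + h) * v / 2)) * (\<integral>\<^sup>+x. ennreal (exp (\<Sum>i\<in>I. ((1 + h) * m i / (\<sigma> i)\<^sup>2) * x i)) \<partial>N)"
    by (intro nn_integral_cmult) measurable
  also have "\<dots> = ennreal (exp (- (1 + h) * v / 2)) * ennreal (exp ((\<Sum>i\<in>I. ((1 + h) * m i / (\<sigma> i)\<^sup>2)\<^sup>2 * (\<sigma> i)\<^sup>2) / 2))"
    unfolding N_def by (subst nn_integral_exp_PiM_normal[OF assms(1,2)]) simp
  also have "(\<Sum>i\<in>I. ((1 + h) * m i / (\<sigma> i)\<^sup>2)\<^sup>2 * (\<sigma> i)\<^sup>2) = (1 + h)\<^sup>2 * v"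
    unfolding v_def sum_distrib_left using less_imp_neq[OF assms(2)]
    by (intro sum.cong refl) (simp add: power2_eq_square field_simps)
  finally have mgf: "(\<integral>\<^sup>+x. ennreal (exp ((1 + h) * l x)) \<partial>N) = ennreal (exp (h * (1 + h) * v / 2))"
    by (simp add: ennreal_mult'[symmetric] exp_add[symmetric] field_simps power2_eq_square)
  have "emeasure (distr N (PiM I (\<lambda>_. borel)) (\<lambda>x. \<lambda>i\<in>I. x i + m i)) B
      = (\<integral>\<^sup>+x. ennreal (exp (l x)) * indicator B x \<partial>N)"
    unfolding N_def PiM_normal_shift[OF assms(1,2)]
    unfolding N_def[symmetric] l_def[symmetric, folded v_def] v_def[symmetric]
    by (intro emeasure_density) measurable
  also have "\<dots> \<le> (\<integral>\<^sup>+x. ennreal (exp \<kappa>) * indicator B x + ennreal (exp (- h * \<kappa>)) * ennreal (exp ((1 + h) * l x)) \<partial>N)"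
  proof (rule nn_integral_mono)
    fix x
    show "ennreal (exp (l x)) * indicator B x
        \<le> ennreal (exp \<kappa>) * indicator B x + ennreal (exp (- h * \<kappa>)) * ennreal (exp ((1 + h) * l x))"
    proof (cases "l x \<le> \<kappa>")
      case True
      then show ?thesis
        by (auto simp: indicator_def intro: add_increasing2)
    next
      case False
      have "exp (l x) \<le> exp (- h * \<kappa>) * exp ((1 + h) * l x)"
        using mult_left_mono[of \<kappa> "l x" h] False h by (simp add: exp_add[symmetric] algebra_simps)
      then show ?thesis
        by (auto simp: indicator_def ennreal_mult'[symmetric] intro!: add_increasing ennreal_leI)
    qed
  qed
  also have "\<dots> = ennreal (exp \<kappa>) * emeasure N B + ennreal (exp (- h * \<kappa>)) * ennreal (exp (h * (1 + h) * v / 2))"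
    by (simp add: nn_integral_add nn_integral_cmult mgf)
  also have "ennreal (exp (- h * \<kappa>)) * ennreal (exp (h * (1 + h) * v / 2)) \<le> ennreal (exp (- r\<^sup>2 / 2))"
  proof -
    \<comment> \<open>The energy \<open>v\<close> varies with the finite index set;
      \<open>h \<ge> 0\<close> allows its replacement by the uniform bound \<open>V\<close>.\<close>
    have "h * (1 + h) * v / 2 \<le> h * (1 + h) * V / 2"
      using V(1) h by (intro divide_right_mono mult_left_mono) (auto simp: v_def)
    moreover have "- h * \<kappa> + h * (1 + h) * V / 2 = - r\<^sup>2 / 2"
      using V(2) by (simp add: h_def \<kappa>_def field_simps power2_eq_square)
    ultimately show ?thesis
      by (simp add: ennreal_mult'[symmetric] exp_add[symmetric])
  qed
  finally show ?thesis
    by (simp add: \<kappa>_def add_left_mono)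
qed

section \<open>Wiener integrals of step functions\<close>

text \<open>The default value 1 of \<sigma> keeps all variances positive, since the factors of the
  product form a family over all natural numbers.\<close>

lemma wiener_increments_law:
  assumes "wiener_process M w" "0 \<le> t 0" "\<And>i. i < n \<Longrightarrow> t i < t (Suc i)"
  defines "\<sigma> \<equiv> \<lambda>i. if i < n then sqrt (t (Suc i) - t i) else 1"
  shows "distr M (PiM {..<n} (\<lambda>_. borel)) (\<lambda>\<omega>. \<lambda>i\<in>{..<n}. w (t (Suc i)) \<omega> - w (t i) \<omega>)
       = PiM {..<n} (\<lambda>i. centred_normal (\<sigma> i))"
proof -
  interpret prob_space M
    using assms(1) by (simp add: wiener_process_def)
  let ?X = "\<lambda>i \<omega>. w (t (Suc i)) \<omega> - w (t i) \<omega>"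
  have pos: "0 \<le> t i" if "i \<le> n" for i
    using that
  proof (induction i)
    case (Suc i)
    then show ?case using assms(3)[of i] by simp
  qed (simp add: assms(2))
  have rv: "?X i \<in> borel_measurable M" if "i < n" for i
  proof -
    have "w (t i) \<in> borel_measurable M" "w (t (Suc i)) \<in> borel_measurable M"
      using assms(1) that pos[of i] pos[of "Suc i"] by (simp_all add: wiener_process_def)
    then show ?thesis
      by simp
  qed
  have dist: "distr M borel (?X i) = centred_normal (\<sigma> i)" if "i < n" for i
  proof -
    have "distributed M lborel (?X i) (normal_density 0 (sqrt (t (Suc i) - t i)))"
      using assms(1) that pos[of i] assms(3)[of i] unfolding wiener_process_def by auto
    then show ?thesis
      using that by (simp add: distributed_def \<sigma>_def cong: distr_cong)
  qed
  show ?thesis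
  proof (cases "n = 0")
    \<comment> \<open>Without increments both sides are the one-point probability space; the
      description of independence by the joint law is applied to nonempty index sets only.\<close>
    case True
    interpret N: product_sigma_finite "\<lambda>i. centred_normal (\<sigma> i)"
      by (rule product_sigma_finite_normal) (use assms(3) in \<open>auto simp: \<sigma>_def\<close>)
    have "distr M (PiM {} (\<lambda>_. borel)) (\<lambda>\<omega>. \<lambda>i\<in>{}. ?X i \<omega>) = PiM {} (\<lambda>i. centred_normal (\<sigma> i))"
    proof (rule N.PiM_eqI)
      fix A :: "nat \<Rightarrow> real set"
      show "emeasure (distr M (PiM {} (\<lambda>_. borel)) (\<lambda>\<omega>. \<lambda>i\<in>{}. ?X i \<omega>)) (Pi\<^sub>E {} A)
          = (\<Prod>i\<in>{}. emeasure (centred_normal (\<sigma> i)) (A i))"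
      proof (subst emeasure_distr)
        show "(\<lambda>\<omega>. \<lambda>i\<in>{}. ?X i \<omega>) \<in> M \<rightarrow>\<^sub>M PiM {} (\<lambda>_. borel)"
          by (rule measurable_restrict) simp
        show "Pi\<^sub>E {} A \<in> sets (PiM {} (\<lambda>_. borel))"
          by (simp add: sets_PiM_empty)
        have "(\<lambda>\<omega>. \<lambda>i\<in>{}. ?X i \<omega>) -` Pi\<^sub>E {} A \<inter> space M = space M"
          by auto
        then show "emeasure M ((\<lambda>\<omega>. \<lambda>i\<in>{}. ?X i \<omega>) -` Pi\<^sub>E {} A \<inter> space M)
            = (\<Prod>i\<in>{}. emeasure (centred_normal (\<sigma> i)) (A i))"
          using emeasure_space_1 by simp
      qed
    qed (auto simp: sets_PiM_empty)
    then show ?thesis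
      by (simp add: True)
  next
    case False
    have "indep_vars (\<lambda>_. borel) ?X {..<n}"
      using assms(1-3) unfolding wiener_process_def by blast
    then have "distr M (PiM {..<n} (\<lambda>_. borel)) (\<lambda>\<omega>. \<lambda>i\<in>{..<n}. ?X i \<omega>) = PiM {..<n} (\<lambda>i. distr M borel (?X i))"
      using False by (subst (asm) indep_vars_iff_distr_eq_PiM') (auto intro: rv)
    also have "\<dots> = PiM {..<n} (\<lambda>i. centred_normal (\<sigma> i))"
      using dist by (intro PiM_cong) auto
    finally show ?thesis .
  qed
qed

text \<open>The point 0 is adjoined so that a path starting at 0 is determined on \<open>E\<close>
  by its \<open>n\<close> increments along the mesh.\<close>

lemma finite_set_enumeration:
  fixes E :: "real set"
  assumes "finite E" "E \<subseteq> {0<..}"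
  obtains n and t :: "nat \<Rightarrow> real" where "t 0 = 0" "strict_mono_on {..n} t" "t ` {..n} = insert 0 E"
proof -
  define xs where "xs = sorted_list_of_set (insert 0 E)"
  have xs: "sorted_wrt (<) xs" "set xs = insert 0 E" "xs \<noteq> []"
    using assms(1) strict_sorted_list_of_set[of "insert 0 E"] set_sorted_list_of_set[of "insert 0 E"]
    unfolding xs_def by (auto simp del: sorted_list_of_set_insert_remove)
  have mono: "xs ! i < xs ! j" if "i < j" "j \<le> length xs - 1" for i j
    using sorted_wrt_nth_less[OF xs(1) that(1)] that xs(3) by (cases xs) auto
  have img: "(!) xs ` {..length xs - 1} = insert 0 E"
  proof -
    have "{..length xs - 1} = {..<length xs}"
      using xs(3) by (cases xs) auto
    then show ?thesis
      using xs(2) by (auto simp: set_conv_nth)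
  qed
  moreover have "xs ! 0 = 0"
  proof -
    obtain j where j: "j \<le> length xs - 1" "xs ! j = 0"
      using img by auto (metis (no_types, lifting) atMost_iff imageE insertI1)
    have "0 \<le> xs ! 0"
      using img assms(2) by (metis atMost_iff greaterThan_iff image_eqI insertE less_imp_le order_refl subsetD zero_le)
    then show ?thesis
      using mono[of 0 j] j by (cases "j = 0") auto
  qed
  ultimately show ?thesis
    using that[of "(!) xs" "length xs - 1"] mono by (auto simp: strict_mono_on_def)
qed

text \<open>The 0-1 weights spread each increment over the whole mesh, so that intervals with
  different endpoints share one index set and can be added.\<close>

lemma telescope_increments:
  fixes y :: "real \<Rightarrow> real"
  assumes "strict_mono_on {..n} t" "l \<in> t ` {..n}" "r \<in> t ` {..n}" "l \<le> r"
  shows "y r - y l = (\<Sum>i<n. of_bool (l \<le> t i \<and> t (Suc i) \<le> r) * (y (t (Suc i)) - y (t i)))"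
proof -
  have le_iff: "t i \<le> t j \<longleftrightarrow> i \<le> j" if "i \<le> n" "j \<le> n" for i j
    using strict_mono_on_less_eq[OF assms(1)] that by simp
  obtain a b where ab: "a \<le> n" "b \<le> n" "l = t a" "r = t b"
    using assms(2,3) by auto
  then have "a \<le> b"
    using assms(4) le_iff by simp
  have "(\<Sum>i<n. of_bool (l \<le> t i \<and> t (Suc i) \<le> r) * (y (t (Suc i)) - y (t i)))
      = (\<Sum>i<n. if i \<in> {a..<b} then y (t (Suc i)) - y (t i) else 0)"
    using ab by (intro sum.cong) (auto simp: le_iff)
  also have "\<dots> = (\<Sum>i\<in>{a..<b}. y (t (Suc i)) - y (t i))"
    using ab(2) by (subst sum.inter_restrict[symmetric]) (auto intro!: sum.cong)
  also have "\<dots> = y (t b) - y (t a)"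
    using sum_Suc_diff'[OF \<open>a \<le> b\<close>, of "\<lambda>i. y (t i)"] by simp
  finally show ?thesis
    by (simp add: ab)
qed

section \<open>Step integrals on a common mesh\<close>

lemma step_integral_Nil [simp]: "step_integral [] y = 0"
  by (simp add: step_integral_def)

lemma step_integral_Cons [simp]:
  "step_integral ((a, l, r) # xs) y = a * (y r - y l) + step_integral xs y"
  by (simp add: step_integral_def)

lemma step_integral_add: "step_integral xs (\<lambda>s. y s + z s) = step_integral xs y + step_integral xs z"
  by (induction xs) (auto simp: algebra_simps)

lemma step_integral_cmult: "step_integral xs (\<lambda>s. c * y s) = c * step_integral xs y"
  by (induction xs) (auto simp: algebra_simps)

lemma step_integral_cong:
  "step_valid xs \<Longrightarrow> (\<And>s. 0 < s \<Longrightarrow> s < 1 \<Longrightarrow> y s = z s) \<Longrightarrow> step_integral xs y = step_integral xs z"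
  by (induction xs) auto

lemma step_integral_append: "step_integral (xs @ ys) y = step_integral xs y + step_integral ys y"
  by (simp add: step_integral_def)

text \<open>Overlapping intervals are allowed in a list, so concatenation with negated coefficients
  codes a difference.\<close>

definition step_diff ::
  "(real \<times> real \<times> real) list \<Rightarrow> (real \<times> real \<times> real) list \<Rightarrow> (real \<times> real \<times> real) list" where
  "step_diff xs ys = xs @ map (\<lambda>(a, l, r). (- a, l, r)) ys"

lemma step_diff:
  "step_valid xs \<Longrightarrow> step_valid ys \<Longrightarrow> step_valid (step_diff xs ys)"
  "step_fun (step_diff xs ys) = (\<lambda>s. step_fun xs s - step_fun ys s)"
  "step_integral (step_diff xs ys) y = step_integral xs y - step_integral ys y"
proof -
  have neg: "step_integral (map (\<lambda>(a, l, r). (- a, l, r)) ys) y = - step_integral ys y"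
    "step_fun (map (\<lambda>(a, l, r). (- a, l, r)) ys) s = - step_fun ys s" for s
    by (induction ys) (auto split: prod.splits)
  show "step_valid xs \<Longrightarrow> step_valid ys \<Longrightarrow> step_valid (step_diff xs ys)"
    by (auto simp: step_diff_def step_valid_def split: prod.splits)
  show "step_fun (step_diff xs ys) = (\<lambda>s. step_fun xs s - step_fun ys s)"
  proof
    fix s
    show "step_fun (step_diff xs ys) s = step_fun xs s - step_fun ys s"
      using neg(2)[of s] by (simp add: step_diff_def step_fun_def)
  qed
  show "step_integral (step_diff xs ys) y = step_integral xs y - step_integral ys y"
    unfolding step_diff_def step_integral_append neg(1) by simp
qed

text \<open>The indicator of (l,r] at \<open>s\<close> is the increment over (l,r] of the path that
  jumps from 0 to 1 at \<open>s\<close>. Hence an identity between step integrals valid for all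
  paths is also one between step functions.\<close>

lemma step_fun_as_integral:
  "step_valid xs \<Longrightarrow> step_fun xs s = step_integral xs (\<lambda>\<tau>. of_bool (s \<le> \<tau>))"
  by (induction xs) (auto simp: indicator_def)

text \<open>Intervals of the list may overlap, and then their increments are dependent. On the mesh
  of all endpoints the same integral is a combination of increments over disjoint intervals.\<close>

lemma step_refinement:
  assumes "step_valid xs"
  obtains n and t c :: "nat \<Rightarrow> real" where "t 0 = 0" "strict_mono_on {..n} t" "t n < 1"
    "step_integral xs = (\<lambda>y. \<Sum>i<n. c i * (y (t (Suc i)) - y (t i)))"
    "step_fun xs = (\<lambda>s. \<Sum>i<n. c i * indicator {t i<..t (Suc i)} s)"
proof -
  define E where "E = (\<Union>(a, l, r)\<in>set xs. {l, r})"
  have E: "finite E" "E \<subseteq> {0<..}" "\<And>e. e \<in> E \<Longrightarrow> e < 1"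
    using assms by (auto simp: E_def step_valid_def split: prod.splits) fastforce+
  obtain n and t :: "nat \<Rightarrow> real" where t0: "t 0 = 0" and mono: "strict_mono_on {..n} t" and img: "t ` {..n} = insert 0 E"
    by (rule finite_set_enumeration[OF E(1,2)])
  note t = t0 strict_mono_onD[OF mono] img
  define c where "c i = (\<Sum>(a, l, r)\<leftarrow>xs. a * of_bool (l \<le> t i \<and> t (Suc i) \<le> r))" for i
  have "t n \<in> insert 0 E"
    using t(3) by auto
  then have tn: "t n < 1"
    using E(3) by auto
  have int: "step_integral xs y = (\<Sum>i<n. c i * (y (t (Suc i)) - y (t i)))" for y
  proof -
    \<comment> \<open>The mesh stays that of \<open>xs\<close> while the induction runs over lists
      \<open>zs\<close> with entries from \<open>xs\<close>, whose endpoints all lie on it.\<close>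
    have "step_integral zs y = (\<Sum>i<n. (\<Sum>(a, l, r)\<leftarrow>zs. a * of_bool (l \<le> t i \<and> t (Suc i) \<le> r)) * (y (t (Suc i)) - y (t i)))"
      if "set zs \<subseteq> set xs" for zs
      using that
    proof (induction zs)
      case (Cons z zs)
      obtain a l r where z: "z = (a, l, r)"
        by (cases z)
      have "l \<in> t ` {..n}" "r \<in> t ` {..n}" "l \<le> r"
        using Cons.prems assms by (auto simp: z t(3) E_def step_valid_def)
      then have tel: "y r - y l = (\<Sum>i<n. of_bool (l \<le> t i \<and> t (Suc i) \<le> r) * (y (t (Suc i)) - y (t i)))"
        by (intro telescope_increments mono)
      show ?case
        using Cons by (simp add: z tel distrib_right sum.distrib sum_distrib_left mult.assoc
            del: sum_of_bool_mult_eq sum_mult_of_bool_eq)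
    qed simp
    from this[of xs] show ?thesis
      by (simp add: c_def)
  qed
  have "step_fun xs s = (\<Sum>i<n. c i * indicator {t i<..t (Suc i)} s)" for s
    unfolding step_fun_as_integral[OF assms] int
  proof (intro sum.cong refl)
    fix i assume "i \<in> {..<n}"
    then have "t i < t (Suc i)"
      by (intro t(2)) auto
    then show "c i * (of_bool (s \<le> t (Suc i)) - of_bool (s \<le> t i)) = c i * indicator {t i<..t (Suc i)} s"
      by (auto simp: indicator_def)
  qed
  from that[OF t0 mono tn ext[OF int] ext[OF this]] show ?thesis .
qed

lemma integral_unit_indicator:
  assumes "0 \<le> a" "a \<le> b" "b < (1::real)"
  shows "(LINT s|lebesgue_on {0<..<1}. indicator {a<..b} s) = b - a"
proof -
  have "{a<..b} \<subseteq> {0<..<1}"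
  proof
    fix x assume "x \<in> {a<..b}"
    then have "0 < x" "x < 1"
      using assms by simp_all
    then show "x \<in> {0<..<1}"
      by simp
  qed
  then have "(LINT s|lebesgue_on {0<..<1}. indicator {a<..b} s) = measure (lebesgue_on {0<..<1}) {a<..b}"
    by (simp add: space_restrict_space Int_absorb1 Int_absorb2)
  also have "\<dots> = b - a"
    using assms \<open>{a<..b} \<subseteq> {0<..<1}\<close> by (subst measure_restrict_space) auto
  finally show ?thesis .
qed

lemma l2norm_disjoint_steps:
  assumes "0 \<le> t 0" "strict_mono_on {..n} t" "t n < (1::real)"
  shows "(l2norm (\<lambda>s. \<Sum>i<n. c i * indicator {t i<..t (Suc i)} s))\<^sup>2 = (\<Sum>i<n. (c i)\<^sup>2 * (t (Suc i) - t i))"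
proof -
  have le: "t i \<le> t j" if "i \<le> j" "j \<le> n" for i j
    using strict_mono_on_less_eq[OF assms(2)] that by simp
  have sq: "(\<Sum>i<n. c i * indicator {t i<..t (Suc i)} s)\<^sup>2 = (\<Sum>i<n. (c i)\<^sup>2 * indicator {t i<..t (Suc i)} s)" for s
  proof -
    have disj: "indicator {t i<..t (Suc i)} s * indicator {t j<..t (Suc j)} s = (0::real)"
      if "i < n" "j < n" "i \<noteq> j" for i j
      using le[of "Suc i" j] le[of "Suc j" i] that by (cases i j rule: linorder_cases) (auto simp: indicator_def)
    have "(\<Sum>i<n. c i * indicator {t i<..t (Suc i)} s)\<^sup>2
        = (\<Sum>i<n. \<Sum>j<n. c i * c j * (indicator {t i<..t (Suc i)} s * indicator {t j<..t (Suc j)} s))"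
      unfolding power2_eq_square sum_product by (intro sum.cong refl) (simp only: mult_ac)
    also have "\<dots> = (\<Sum>i<n. \<Sum>j<n. if j = i then (c i)\<^sup>2 * indicator {t i<..t (Suc i)} s else 0)"
    proof (intro sum.cong refl)
      fix i j assume "i \<in> {..<n}" "j \<in> {..<n}"
      then show "c i * c j * (indicator {t i<..t (Suc i)} s * indicator {t j<..t (Suc j)} s)
          = (if j = i then (c i)\<^sup>2 * indicator {t i<..t (Suc i)} s else 0)"
        using disj[of i j] by (auto simp: power2_eq_square indicator_def)
    qed
    finally show ?thesis
      by simp
  qed
  have int: "integrable (lebesgue_on {0<..<1}) (\<lambda>s. indicator {t i<..t (Suc i)} s :: real)" for i
    by (rule L2_unit_integrable[OF L2_unit_indicator])
  have "(l2norm (\<lambda>s. \<Sum>i<n. c i * indicator {t i<..t (Suc i)} s))\<^sup>2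
      = (\<Sum>i<n. (c i)\<^sup>2 * (LINT s|lebesgue_on {0<..<1}. indicator {t i<..t (Suc i)} s))"
    unfolding l2norm_sq sq using int
    by (subst Bochner_Integration.integral_sum) auto
  also have "\<dots> = (\<Sum>i<n. (c i)\<^sup>2 * (t (Suc i) - t i))"
  proof (intro sum.cong refl arg_cong2[of _ _ _ _ "(*)"] integral_unit_indicator)
    fix i assume i: "i \<in> {..<n}"
    show "0 \<le> t i" "t i \<le> t (Suc i)" "t (Suc i) < 1"
      using le[of 0 i] le[of i "Suc i"] le[of "Suc i" n] assms i by auto
  qed
  finally show ?thesis .
qed

text \<open>On the common mesh the integral is a linear combination of independent centred normals
  whose total variance is the squared L2 norm: the isometry of the Wiener integral, in the form of a
  moment generating function.\<close>

lemma step_integral_mgf: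
  assumes "wiener_process M w" "step_valid xs"
  shows "(\<integral>\<^sup>+\<omega>. ennreal (exp (a * step_integral xs (\<lambda>s. w s \<omega>))) \<partial>M)
       = ennreal (exp (a\<^sup>2 * (l2norm (step_fun xs))\<^sup>2 / 2))"
proof -
  obtain n and t c :: "nat \<Rightarrow> real" where t: "t 0 = 0" "strict_mono_on {..n} t" "t n < 1"
    and int: "step_integral xs = (\<lambda>y. \<Sum>i<n. c i * (y (t (Suc i)) - y (t i)))"
    and stp: "step_fun xs = (\<lambda>s. \<Sum>i<n. c i * indicator {t i<..t (Suc i)} s)"
    by (rule step_refinement[OF assms(2)])
  have step: "t i < t (Suc i)" if "i < n" for i
    using that by (intro strict_mono_onD[OF t(2)]) auto
  define \<sigma> where "\<sigma> i = (if i < n then sqrt (t (Suc i) - t i) else 1)" for i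
  have \<sigma>: "\<sigma> i > 0" for i
    using step[of i] by (simp add: \<sigma>_def)
  have law: "distr M (PiM {..<n} (\<lambda>_. borel)) (\<lambda>\<omega>. \<lambda>i\<in>{..<n}. w (t (Suc i)) \<omega> - w (t i) \<omega>)
      = PiM {..<n} (\<lambda>i. centred_normal (\<sigma> i))"
    unfolding \<sigma>_def by (rule wiener_increments_law[OF assms(1)]) (auto simp: t step)
  have nonneg: "0 \<le> t i" if "i \<le> n" for i
    using strict_mono_on_less_eq[OF t(2), of 0 i] that by (simp add: t(1))
  have w: "w (t i) \<in> borel_measurable M" if "i \<le> n" for i
    using assms(1) nonneg[OF that] by (simp add: wiener_process_def)
  have [measurable]: "(\<lambda>\<omega>. \<lambda>i\<in>{..<n}. w (t (Suc i)) \<omega> - w (t i) \<omega>) \<in> M \<rightarrow>\<^sub>M PiM {..<n} (\<lambda>_. borel)"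
    by (intro measurable_restrict borel_measurable_diff w) auto
  have "(\<integral>\<^sup>+\<omega>. ennreal (exp (a * step_integral xs (\<lambda>s. w s \<omega>))) \<partial>M)
      = (\<integral>\<^sup>+x. ennreal (exp (\<Sum>i<n. (a * c i) * x i)) \<partial>PiM {..<n} (\<lambda>i. centred_normal (\<sigma> i)))"
    unfolding law[symmetric] by (subst nn_integral_distr) (auto simp: int sum_distrib_left mult.assoc)
  also have "\<dots> = ennreal (exp ((\<Sum>i<n. (a * c i)\<^sup>2 * (\<sigma> i)\<^sup>2) / 2))"
    by (rule nn_integral_exp_PiM_normal[OF _ \<sigma>]) simp
  also have "(\<Sum>i<n. (a * c i)\<^sup>2 * (\<sigma> i)\<^sup>2) = a\<^sup>2 * (l2norm (step_fun xs))\<^sup>2"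
  proof -
    have "(\<sigma> i)\<^sup>2 = t (Suc i) - t i" if "i < n" for i
      using step[OF that] that by (simp add: \<sigma>_def)
    then show ?thesis
      unfolding stp using t
      by (subst l2norm_disjoint_steps) (auto simp: power_mult_distrib sum_distrib_left mult.assoc)
  qed
  finally show ?thesis .
qed

section \<open>Shifts of the law of the observed path\<close>

lemma l2inner_indicator_primitive:
  assumes "L2_unit g" "0 \<le> t" "t \<le> 1"
  shows "(LINT s|lebesgue_on {0<..<t}. g s) = l2inner (\<lambda>s. indicator {0<..t} s) g"
proof -
  have "l2inner (\<lambda>s. indicator {0<..t} s) g = (LINT s|lebesgue. indicator {0<..<1} s * (indicator {0<..t} s * g s))"
    unfolding l2inner_def by (subst integral_restrict_space) auto
  also have "\<dots> = (LINT s|lebesgue. indicator {0<..<t} s * g s)"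
  proof (rule integral_cong_AE)
    have g: "(\<lambda>s. indicator {0<..<1} s * g s) \<in> borel_measurable lebesgue"
      using L2_unit_measurable[OF assms(1)] by (simp add: borel_measurable_restrict_space_iff)
    have "(\<lambda>s. indicator {0<..t} s * (indicator {0<..<1} s * g s)) \<in> borel_measurable lebesgue"
      "(\<lambda>s. indicator {0<..<t} s * (indicator {0<..<1} s * g s)) \<in> borel_measurable lebesgue"
      by (intro borel_measurable_times g borel_measurable_indicator; simp)+
    moreover have "(\<lambda>s. indicator {0<..<t} s * (indicator {0<..<1} s * g s)) = (\<lambda>s. indicator {0<..<t} s * g s)"
      using assms(3) by (auto simp: indicator_def fun_eq_iff)
    ultimately show "(\<lambda>s. indicator {0<..<1} s * (indicator {0<..t} s * g s)) \<in> borel_measurable lebesgue"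
      "(\<lambda>s. indicator {0<..<t} s * g s) \<in> borel_measurable lebesgue"
      by (simp_all add: mult.left_commute)
    \<comment> \<open>The two integrands can differ only at an endpoint, a null set.\<close>
    have "AE s in lebesgue. s \<notin> {t, 1}"
      by (intro AE_not_in) (simp add: negligible_iff_null_sets[symmetric])
    then show "AE s in lebesgue. indicator {0<..<1} s * (indicator {0<..t} s * g s) = indicator {0<..<t} s * g s"
      by eventually_elim (use assms(3) in \<open>auto simp: indicator_def\<close>)
  qed
  also have "\<dots> = (LINT s|lebesgue_on {0<..<t}. g s)"
    by (subst integral_restrict_space) auto
  finally show ?thesis ..
qed

lemma l2inner_indicator_increment:
  assumes "L2_unit g" "0 \<le> l" "l \<le> r" "r \<le> 1"
  shows "l2inner (\<lambda>s. indicator {l<..r} s) g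
       = (LINT s|lebesgue_on {0<..<r}. g s) - (LINT s|lebesgue_on {0<..<l}. g s)"
proof -
  have "(\<lambda>s. indicator {l<..r} s :: real) = (\<lambda>s. indicator {0<..r} s - indicator {0<..l} s)"
    using assms(2,3) by (auto simp: indicator_def fun_eq_iff)
  then show ?thesis
    using assms by (simp add: l2inner_indicator_primitive l2inner_diff L2_unit_indicator)
qed

text \<open>The step integral of the drift is the mean of the step integral of the observation.
  Written as an inner product, it extends to L2 limits of step functions.\<close>

lemma l2inner_step_fun:
  assumes "L2_unit g"
  shows "step_valid xs \<Longrightarrow> step_integral xs (\<lambda>t. LINT s|lebesgue_on {0<..<t}. g s) = l2inner (step_fun xs) g"
proof (induction xs)
  case Nil
  then show ?case by (simp add: l2inner_def)
next
  case (Cons x xs)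
  obtain a l r where x: "x = (a, l, r)"
    by (cases x)
  show ?case
    using Cons by (simp add: x l2inner_add[OF L2_unit_cmult[OF L2_unit_indicator] L2_unit_step_fun assms]
        l2inner_cmult l2inner_indicator_increment[OF assms])
qed

text \<open>Cauchy-Schwarz against the step function with the slopes of the primitive of \<open>g\<close>.\<close>

lemma primitive_energy_le:
  assumes "L2_unit g" "t 0 = 0" "strict_mono_on {..n} t" "t n < (1::real)"
  defines "\<gamma> \<equiv> \<lambda>t. LINT s|lebesgue_on {0<..<t}. g s"
  shows "(\<Sum>i<n. (\<gamma> (t (Suc i)) - \<gamma> (t i))\<^sup>2 / (t (Suc i) - t i)) \<le> (l2norm g)\<^sup>2"
proof -
  have le: "t i \<le> t j" if "i \<le> j" "j \<le> n" for i j
    using strict_mono_on_less_eq[OF assms(3)] that by simp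
  have less: "t i < t (Suc i)" if "i < n" for i
    using that by (intro strict_mono_onD[OF assms(3)]) auto
  define c where "c i = (\<gamma> (t (Suc i)) - \<gamma> (t i)) / (t (Suc i) - t i)" for i
  define v where "v = (\<Sum>i<n. (\<gamma> (t (Suc i)) - \<gamma> (t i))\<^sup>2 / (t (Suc i) - t i))"
  define f where "f s = (\<Sum>i<n. c i * indicator {t i<..t (Suc i)} s)" for s
  have f: "L2_unit f \<and> l2inner f g = (\<Sum>i<n. c i * (\<gamma> (t (Suc i)) - \<gamma> (t i)))"
  proof -
    have "L2_unit (\<lambda>s. \<Sum>i<k. c i * indicator {t i<..t (Suc i)} s)
        \<and> l2inner (\<lambda>s. \<Sum>i<k. c i * indicator {t i<..t (Suc i)} s) g = (\<Sum>i<k. c i * (\<gamma> (t (Suc i)) - \<gamma> (t i)))"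
      if "k \<le> n" for k
      using that
    proof (induction k)
      case 0
      then show ?case by (simp add: L2_unit_const l2inner_def)
    next
      case (Suc k)
      have "0 \<le> t k" "t k \<le> t (Suc k)" "t (Suc k) \<le> 1"
        using le[of 0 k] le[of k "Suc k"] le[of "Suc k" n] Suc.prems assms(2,4) by auto
      then have "l2inner (\<lambda>s. indicator {t k<..t (Suc k)} s) g = \<gamma> (t (Suc k)) - \<gamma> (t k)"
        unfolding \<gamma>_def by (rule l2inner_indicator_increment[OF assms(1)])
      moreover have "L2_unit (\<lambda>s. c k * indicator {t k<..t (Suc k)} s)"
        by (intro L2_unit_cmult L2_unit_indicator)
      ultimately show ?case
        using Suc by (simp add: L2_unit_add l2inner_add[OF _ _ assms(1)] l2inner_cmult)
    qed
    from this[of n] show ?thesis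
      by (simp add: f_def[abs_def])
  qed
  have fg: "l2inner f g = v"
    unfolding f[THEN conjunct2] v_def c_def by (simp add: power2_eq_square)
  have "(l2norm f)\<^sup>2 = (\<Sum>i<n. (c i)\<^sup>2 * (t (Suc i) - t i))"
    unfolding f_def using assms(2-4) by (intro l2norm_disjoint_steps) auto
  also have "\<dots> = v"
    unfolding v_def c_def using less by (intro sum.cong refl) (force simp: power2_eq_square)
  finally have ff: "(l2norm f)\<^sup>2 = v" .
  \<comment> \<open>\<open>l2inner f g\<close> and \<open>(l2norm f)\<^sup>2\<close> have the same
    value \<open>v\<close>, so one factor \<open>l2norm f\<close> cancels unless it is 0.\<close>
  have "v \<le> l2norm f * l2norm g"
    using l2_Cauchy_Schwarz[of f g] f assms(1) fg by simp
  then have "l2norm f * l2norm f \<le> l2norm f * l2norm g"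
    unfolding ff[symmetric] power2_eq_square .
  then have "l2norm f \<le> l2norm g"
    using mult_le_cancel_left_pos[of "l2norm f" "l2norm f" "l2norm g"]
    by (cases "l2norm f = 0") (auto simp: less_le)
  then have "v \<le> (l2norm g)\<^sup>2"
    unfolding ff[symmetric] by (intro power_mono) auto
  then show ?thesis
    by (simp add: v_def)
qed

text \<open>A single \<open>B\<close> has to serve both measures, hence the sum. Complements keep
  the symmetric difference; a countable union is cut to \<open>N\<close> sets by continuity from
  below, with half of \<open>e\<close> for the tail and the other half shared among the
  \<open>N\<close> approximations.\<close>

lemma algebra_approximation:
  assumes "algebra \<Omega> G" "finite_measure P" "finite_measure Q"
    and "sets P = sigma_sets \<Omega> G" "sets Q = sigma_sets \<Omega> G"
    and "A \<in> sigma_sets \<Omega> G" "e > 0"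
  shows "\<exists>B\<in>G. measure P (sym_diff A B) + measure Q (sym_diff A B) < e"
  using assms(6,7)
proof (induction arbitrary: e)
  case (Basic A)
  then show ?case by (intro bexI[of _ A]) auto
next
  case Empty
  then show ?case using assms(1) by (intro bexI[of _ "{}"]) (auto simp: algebra_iff_Un)
next
  case (Compl A)
  then obtain B where B: "B \<in> G" "measure P (sym_diff A B) + measure Q (sym_diff A B) < e"
    by blast
  have "G \<subseteq> Pow \<Omega>"
    using assms(1) by (simp add: algebra_iff_Un)
  then have "sym_diff (\<Omega> - A) (\<Omega> - B) = sym_diff A B"
    using B(1) sigma_sets_into_sp[OF _ Compl.hyps] by blast
  then show ?case
    using B assms(1) by (intro bexI[of _ "\<Omega> - B"]) (auto simp: algebra_iff_Un)
next
  case (Union A)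
  interpret P: finite_measure P by fact
  interpret Q: finite_measure Q by fact
  have A: "A i \<in> sets P" "A i \<in> sets Q" for i
    using Union.hyps by (auto simp: assms(4,5))
  define U where "U N = (\<Union>i<N. A i)" for N :: nat
  have U: "U N \<in> sets P" "U N \<in> sets Q" for N
    using A by (auto simp: U_def)
  have UU: "(\<Union>N. U N) = (\<Union>i. A i)"
    by (auto simp: U_def)
  have "incseq U"
    by (auto simp: U_def incseq_def intro: less_le_trans)
  then have "(\<lambda>N. measure P (U N)) \<longlonglongrightarrow> measure P (\<Union>i. A i)" "(\<lambda>N. measure Q (U N)) \<longlonglongrightarrow> measure Q (\<Union>i. A i)"
    using P.finite_Lim_measure_incseq[of U] Q.finite_Lim_measure_incseq[of U] U unfolding UU by auto
  then have "(\<lambda>N. (measure P (\<Union>i. A i) - measure P (U N)) + (measure Q (\<Union>i. A i) - measure Q (U N))) \<longlonglongrightarrow> 0"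
    by (auto intro!: tendsto_eq_intros)
  then have "\<forall>\<^sub>F N in sequentially. (measure P (\<Union>i. A i) - measure P (U N)) + (measure Q (\<Union>i. A i) - measure Q (U N)) < e / 2"
    using Union.prems by (intro order_tendstoD) auto
  then obtain N where "(measure P (\<Union>i. A i) - measure P (U N)) + (measure Q (\<Union>i. A i) - measure Q (U N)) < e / 2"
    by (auto simp: eventually_sequentially)
  moreover have "U N \<subseteq> (\<Union>i. A i)"
    by (auto simp: U_def)
  ultimately have N: "measure P ((\<Union>i. A i) - U N) + measure Q ((\<Union>i. A i) - U N) < e / 2"
    using U A by (simp add: P.finite_measure_Diff Q.finite_measure_Diff)
  \<comment> \<open>\<open>N + 1\<close> instead of \<open>N\<close> keeps the share positive for
    \<open>N = 0\<close>.\<close>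
  have "\<exists>B\<in>G. measure P (sym_diff (A i) B) + measure Q (sym_diff (A i) B) < e / (2 * (N + 1))" for i
    using Union.IH[of "e / (2 * (N + 1))" i] Union.prems by simp
  then obtain B where B: "\<And>i. B i \<in> G"
    "\<And>i. measure P (sym_diff (A i) (B i)) + measure Q (sym_diff (A i) (B i)) < e / (2 * (N + 1))"
    by metis
  define C where "C = (\<Union>i<N. B i)"
  have "C \<in> G"
    unfolding C_def using B(1) assms(1)
    by (intro ring_of_sets.finite_UN[OF algebra.axioms(1)]) auto
  have BS: "B i \<in> sets P" "B i \<in> sets Q" for i
    using B(1) by (auto simp: assms(4,5))
  have D: "sym_diff (A i) (B i) \<in> sets P" "sym_diff (A i) (B i) \<in> sets Q" for i
    using A BS by auto
  have sub: "sym_diff (\<Union>i. A i) C \<subseteq> ((\<Union>i. A i) - U N) \<union> (\<Union>i<N. sym_diff (A i) (B i))"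
    by (auto simp: U_def C_def)
  have *: "measure R (sym_diff (\<Union>i. A i) C)
      \<le> measure R ((\<Union>i. A i) - U N) + (\<Sum>i<N. measure R (sym_diff (A i) (B i)))"
    if "finite_measure R" "sets R = sets P" for R
  proof -
    interpret R: finite_measure R by fact
    have "measure R (sym_diff (\<Union>i. A i) C) \<le> measure R (((\<Union>i. A i) - U N) \<union> (\<Union>i<N. sym_diff (A i) (B i)))"
      using A(1) U(1) D(1) by (intro R.finite_measure_mono sub) (auto simp: that(2))
    also have "\<dots> \<le> measure R ((\<Union>i. A i) - U N) + measure R (\<Union>i<N. sym_diff (A i) (B i))"
      using A(1) U(1) D(1) by (intro measure_Un_le) (auto simp: that(2))
    also have "measure R (\<Union>i<N. sym_diff (A i) (B i)) \<le> (\<Sum>i<N. measure R (sym_diff (A i) (B i)))"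
      using D(1) by (intro measure_UNION_le) (auto simp: that(2))
    finally show ?thesis
      by simp
  qed
  have "measure P (sym_diff (\<Union>i. A i) C) + measure Q (sym_diff (\<Union>i. A i) C)
      \<le> (measure P ((\<Union>i. A i) - U N) + measure Q ((\<Union>i. A i) - U N))
        + (\<Sum>i<N. measure P (sym_diff (A i) (B i)) + measure Q (sym_diff (A i) (B i)))"
    using *[OF assms(2)] *[OF assms(3)] by (simp add: assms(4,5) sum.distrib)
  also have "(\<Sum>i<N. measure P (sym_diff (A i) (B i)) + measure Q (sym_diff (A i) (B i))) \<le> (\<Sum>i<N. e / (2 * (N + 1)))"
    by (intro sum_mono less_imp_le B(2))
  also have "\<dots> \<le> e / 2"
    using Union.prems by (simp add: field_simps)
  finally show ?case
    using N \<open>C \<in> G\<close> by (intro bexI[of _ C]) auto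
qed

text \<open>An inequality of this form is continuous in the event for the distance given by measures
  of symmetric differences, and the algebra is dense for that distance.\<close>

lemma measure_bound_from_algebra:
  assumes "algebra \<Omega> G" "finite_measure P" "finite_measure Q"
    and "sets P = sigma_sets \<Omega> G" "sets Q = sigma_sets \<Omega> G"
    and bound: "\<And>B. B \<in> G \<Longrightarrow> measure P B \<le> c * measure Q B + k" and "c \<ge> 0"
    and A: "A \<in> sigma_sets \<Omega> G"
  shows "measure P A \<le> c * measure Q A + k"
proof (rule field_le_epsilon)
  interpret P: finite_measure P by fact
  interpret Q: finite_measure Q by fact
  fix e :: real assume "e > 0"
  \<comment> \<open>The approximation error enters once through \<open>P\<close> and
    \<open>c\<close> times through \<open>Q\<close>, so \<open>e / (1 + c)\<close> suffices.\<close>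
  then obtain B where B: "B \<in> G" "measure P (sym_diff A B) + measure Q (sym_diff A B) < e / (1 + c)"
    using algebra_approximation[OF assms(1-5) A, of "e / (1 + c)"] assms(7) by auto
  have sets: "A \<in> sets P" "A \<in> sets Q" "B \<in> sets P" "B \<in> sets Q"
    using A B(1) by (auto simp: assms(4,5))
  have "measure P A \<le> measure P (B \<union> sym_diff A B)"
    using sets by (intro P.finite_measure_mono) auto
  also have "\<dots> \<le> measure P B + measure P (sym_diff A B)"
    using sets by (intro measure_Un_le) auto
  finally have 1: "measure P A \<le> measure P B + measure P (sym_diff A B)" .
  have "measure Q B \<le> measure Q (A \<union> sym_diff A B)"
    using sets by (intro Q.finite_measure_mono) auto
  also have "\<dots> \<le> measure Q A + measure Q (sym_diff A B)"
    using sets by (intro measure_Un_le) auto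
  finally have "c * measure Q B \<le> c * (measure Q A + measure Q (sym_diff A B))"
    using assms(7) by (intro mult_left_mono)
  with 1 bound[OF B(1)]
  have "measure P A \<le> c * measure Q A + k + (measure P (sym_diff A B) + c * measure Q (sym_diff A B))"
    by (simp add: algebra_simps)
  also have "measure P (sym_diff A B) + c * measure Q (sym_diff A B)
      \<le> (1 + c) * (measure P (sym_diff A B) + measure Q (sym_diff A B))"
    using assms(7) by (simp add: algebra_simps mult_nonneg_nonneg)
  also have "\<dots> \<le> (1 + c) * (e / (1 + c))"
    using B(2) assms(7) by (intro mult_left_mono) auto
  also have "\<dots> = e"
    using assms(7) by simp
  finally show "measure P A \<le> c * measure Q A + k + e"
    by simp
qed

section \<open>Cylinder sets of the path space\<close>

definition path_cylinder :: "real set \<Rightarrow> (real \<Rightarrow> real) set \<Rightarrow> (real \<Rightarrow> real) set" where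
  "path_cylinder J B = {f \<in> space path_space. restrict f J \<in> B}"

definition path_cylinders :: "(real \<Rightarrow> real) set set" where
  "path_cylinders = {path_cylinder J B | J B. finite J \<and> J \<subseteq> {0<..<1} \<and> B \<in> sets (PiM J (\<lambda>_. borel))}"

lemma space_path_space: "space path_space = (\<Pi>\<^sub>E t\<in>{0<..<1}. UNIV)"
  by (simp add: path_space_def space_PiM)

lemma measurable_path_restrict:
  "J \<subseteq> {0<..<1} \<Longrightarrow> (\<lambda>f. restrict f J) \<in> path_space \<rightarrow>\<^sub>M PiM J (\<lambda>_. borel)"
  unfolding path_space_def by (rule measurable_restrict_subset)

lemma path_cylinder_measurable:
  assumes "J \<subseteq> {0<..<1}" "B \<in> sets (PiM J (\<lambda>_. borel))"
  shows "path_cylinder J B \<in> sets path_space"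
  using measurable_sets[OF measurable_path_restrict[OF assms(1)] assms(2)]
  by (simp add: path_cylinder_def vimage_def Int_def conj_commute)

text \<open>Brings two cylinders to the same finite set of times before they are
  intersected.\<close>

lemma path_cylinder_extend:
  assumes "J \<subseteq> K" "B \<in> sets (PiM J (\<lambda>_. borel))"
  obtains C where "C \<in> sets (PiM K (\<lambda>_. borel))" "path_cylinder J B = path_cylinder K C"
proof
  let ?C = "(\<lambda>f. restrict f J) -` B \<inter> space (PiM K (\<lambda>_. borel))"
  show "?C \<in> sets (PiM K (\<lambda>_. borel))"
    by (rule measurable_sets[OF measurable_restrict_subset[OF assms(1)] assms(2)])
  show "path_cylinder J B = path_cylinder K ?C"
    using assms(1) by (auto simp: path_cylinder_def space_PiM Int_absorb1 Int_absorb2)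
qed

lemma algebra_path_cylinders: "algebra (space path_space) path_cylinders"
  unfolding algebra_iff_Int
proof (intro conjI ballI)
  show "path_cylinders \<subseteq> Pow (space path_space)"
    by (auto simp: path_cylinders_def path_cylinder_def)
  have "{} = path_cylinder {} {}"
    by (simp add: path_cylinder_def)
  then show "{} \<in> path_cylinders"
    unfolding path_cylinders_def by blast
next
  fix A assume "A \<in> path_cylinders"
  then obtain J B where J: "A = path_cylinder J B" "finite J" "J \<subseteq> {0<..<1}" "B \<in> sets (PiM J (\<lambda>_. borel))"
    by (auto simp: path_cylinders_def)
  have "space path_space - A = path_cylinder J (space (PiM J (\<lambda>_. borel)) - B)"
    by (auto simp: J(1) path_cylinder_def space_PiM)
  then show "space path_space - A \<in> path_cylinders"
    using J unfolding path_cylinders_def by blast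
next
  fix A A' assume "A \<in> path_cylinders" "A' \<in> path_cylinders"
  then obtain J B J' B' where J: "A = path_cylinder J B" "finite J" "J \<subseteq> {0<..<1}" "B \<in> sets (PiM J (\<lambda>_. borel))"
    and J': "A' = path_cylinder J' B'" "finite J'" "J' \<subseteq> {0<..<1}" "B' \<in> sets (PiM J' (\<lambda>_. borel))"
    by (auto simp: path_cylinders_def)
  obtain C where C: "C \<in> sets (PiM (J \<union> J') (\<lambda>_. borel))" "A = path_cylinder (J \<union> J') C"
    using path_cylinder_extend[OF _ J(4), of "J \<union> J'"] J(1) by auto
  obtain C' where C': "C' \<in> sets (PiM (J \<union> J') (\<lambda>_. borel))" "A' = path_cylinder (J \<union> J') C'"
    using path_cylinder_extend[OF _ J'(4), of "J \<union> J'"] J'(1) by auto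
  have "A \<inter> A' = path_cylinder (J \<union> J') (C \<inter> C')"
    by (auto simp: C C' path_cylinder_def)
  moreover have "C \<inter> C' \<in> sets (PiM (J \<union> J') (\<lambda>_. borel))"
    using C C' by auto
  moreover have "finite (J \<union> J')" "J \<union> J' \<subseteq> {0<..<1}"
    using J J' by auto
  ultimately show "A \<inter> A' \<in> path_cylinders"
    unfolding path_cylinders_def by blast
qed

lemma sets_path_space: "sets path_space = sigma_sets (space path_space) path_cylinders"
proof
  show "sigma_sets (space path_space) path_cylinders \<subseteq> sets path_space"
    by (rule sets.sigma_sets_subset) (auto simp: path_cylinders_def path_cylinder_measurable)
  have "{{f \<in> \<Pi>\<^sub>E i\<in>{0<..<1}. UNIV. f i \<in> A} |i A. i \<in> {0<..<1} \<and> A \<in> sets borel} \<subseteq> path_cylinders"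
  proof safe
    fix i :: real and A :: "real set" assume iA: "i \<in> {0<..<1}" "A \<in> sets borel"
    have "{f \<in> \<Pi>\<^sub>E i\<in>{0<..<1}. UNIV. f i \<in> A} = path_cylinder {i} {f \<in> space (PiM {i} (\<lambda>_. borel)). f i \<in> A}"
      by (auto simp: path_cylinder_def space_path_space space_PiM)
    moreover have "{f \<in> space (PiM {i} (\<lambda>_. borel)). f i \<in> A} \<in> sets (PiM {i} (\<lambda>_. borel :: real measure))"
      using iA(2) by measurable
    ultimately show "{f \<in> \<Pi>\<^sub>E i\<in>{0<..<1}. UNIV. f i \<in> A} \<in> path_cylinders"
      using iA(1) unfolding path_cylinders_def by blast
  qed
  from sigma_sets_mono'[OF this] show "sets path_space \<subseteq> sigma_sets (space path_space) path_cylinders"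
    unfolding space_path_space unfolding path_space_def sets_PiM_single space_borel .
qed

text \<open>The drift is an arbitrary function of time, not the primitive of a signal, so that a
  change of signal amounts to an added function.\<close>

definition drift_law :: "'a measure \<Rightarrow> (real \<Rightarrow> 'a \<Rightarrow> real) \<Rightarrow> (real \<Rightarrow> real) \<Rightarrow> real \<Rightarrow> (real \<Rightarrow> real) measure" where
  "drift_law M w d \<epsilon> = distr M path_space (\<lambda>\<omega>. \<lambda>t\<in>{0<..<1}. d t + \<epsilon> * w t \<omega>)"

lemma obs_law_drift_law:
  "obs_law M w S \<epsilon> \<theta> = drift_law M w (\<lambda>t. LINT s|lebesgue_on {0<..<t}. S s \<theta>) \<epsilon>"
  by (simp add: obs_law_def drift_law_def observation_def)

lemma sets_drift_law [measurable_cong, simp]: "sets (drift_law M w d \<epsilon>) = sets path_space"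
  by (simp add: drift_law_def)

lemma space_drift_law [simp]: "space (drift_law M w d \<epsilon>) = space path_space"
  by (simp add: drift_law_def)

lemma wiener_measurable: "wiener_process M w \<Longrightarrow> 0 \<le> t \<Longrightarrow> w t \<in> borel_measurable M"
  by (simp add: wiener_process_def)

lemma drift_path_measurable:
  assumes "wiener_process M w"
  shows "(\<lambda>\<omega>. \<lambda>t\<in>{0<..<1}. d t + \<epsilon> * w t \<omega>) \<in> M \<rightarrow>\<^sub>M path_space"
proof -
  have "(\<lambda>\<omega>. d t + \<epsilon> * w t \<omega>) \<in> borel_measurable M" if "t \<in> {0<..<1}" for t
    using wiener_measurable[OF assms, of t] that by simp
  then show ?thesis
    unfolding path_space_def by (intro measurable_restrict)
qed

lemma prob_space_drift_law: "wiener_process M w \<Longrightarrow> prob_space (drift_law M w d \<epsilon>)"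
  unfolding drift_law_def
  by (intro prob_space.prob_space_distr drift_path_measurable) (simp_all add: wiener_process_def)

text \<open>In the coordinates of the increments over the mesh, the measure \<open>N\<close> is the
  same for all drifts and only the event moves with \<open>d\<close>. The observation at
  \<open>s\<close> is recovered by adding the increments up to \<open>s\<close>; since
  \<open>w 0 = 0\<close> holds almost surely, the two events agree up to a null set.\<close>

lemma drift_law_cylinder:
  assumes W: "wiener_process M w" and t: "t 0 = 0" "strict_mono_on {..n} t" "t ` {..n} = insert 0 J"
    and J: "J \<subseteq> {0<..<1}" and B: "B \<in> sets (PiM J (\<lambda>_. borel))"
  defines "\<sigma> \<equiv> \<lambda>i. if i < n then sqrt (t (Suc i) - t i) else 1"
  defines "N \<equiv> PiM {..<n} (\<lambda>i. centred_normal (\<sigma> i))"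
  shows "emeasure (drift_law M w d \<epsilon>) (path_cylinder J B)
       = emeasure N {x \<in> space N. (\<lambda>s\<in>J. d s + \<epsilon> * (\<Sum>i<n. of_bool (t (Suc i) \<le> s) * x i)) \<in> B}"
proof -
  let ?Y = "\<lambda>\<omega>. \<lambda>t\<in>{0<..<1}. d t + \<epsilon> * w t \<omega>"
  let ?G = "\<lambda>x. \<lambda>s\<in>J. d s + \<epsilon> * (\<Sum>i<n. of_bool (t (Suc i) \<le> s) * x i)"
  let ?D = "\<lambda>\<omega>. \<lambda>i\<in>{..<n}. w (t (Suc i)) \<omega> - w (t i) \<omega>"
  have less: "t i < t (Suc i)" if "i < n" for i
    using that by (intro strict_mono_onD[OF t(2)]) auto
  have nonneg: "0 \<le> t i" if "i \<le> n" for i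
    using strict_mono_on_less_eq[OF t(2), of 0 i] that by (simp add: t(1))
  have law: "distr M (PiM {..<n} (\<lambda>_. borel)) ?D = N"
    unfolding N_def \<sigma>_def by (rule wiener_increments_law[OF W]) (auto simp: t(1) less)
  have D: "?D \<in> M \<rightarrow>\<^sub>M PiM {..<n} (\<lambda>_. borel)"
    by (intro measurable_restrict borel_measurable_diff wiener_measurable[OF W] nonneg) auto
  have sets_N[measurable_cong]: "sets N = sets (PiM {..<n} (\<lambda>_. borel))"
    unfolding law[symmetric] by simp
  then have space_N: "space N = space (PiM {..<n} (\<lambda>_. borel))"
    by (rule sets_eq_imp_space_eq)
  have G: "?G \<in> N \<rightarrow>\<^sub>M PiM J (\<lambda>_. borel)"
    by measurable
  have "emeasure (drift_law M w d \<epsilon>) (path_cylinder J B) = emeasure M (?Y -` path_cylinder J B \<inter> space M)"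
    unfolding drift_law_def using path_cylinder_measurable[OF J B]
    by (intro emeasure_distr drift_path_measurable[OF W])
  also have "\<dots> = emeasure M (?D -` {x \<in> space N. ?G x \<in> B} \<inter> space M)"
  proof (rule emeasure_eq_AE)
    have "AE \<omega> in M. w 0 \<omega> = 0"
      using W by (simp add: wiener_process_def)
    then show "AE \<omega> in M. \<omega> \<in> ?Y -` path_cylinder J B \<inter> space M \<longleftrightarrow> \<omega> \<in> ?D -` {x \<in> space N. ?G x \<in> B} \<inter> space M"
    proof eventually_elim
      case (elim \<omega>)
      have w: "w s \<omega> = (\<Sum>i<n. of_bool (t (Suc i) \<le> s) * (w (t (Suc i)) \<omega> - w (t i) \<omega>))" if "s \<in> J" for s
      proof -
        have "w s \<omega> - w 0 \<omega> = (\<Sum>i<n. of_bool (0 \<le> t i \<and> t (Suc i) \<le> s) * (w (t (Suc i)) \<omega> - w (t i) \<omega>))"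
          using that J t(3) by (intro telescope_increments[OF t(2), of 0 s "\<lambda>s. w s \<omega>"]) auto
        also have "\<dots> = (\<Sum>i<n. of_bool (t (Suc i) \<le> s) * (w (t (Suc i)) \<omega> - w (t i) \<omega>))"
          using nonneg by (intro sum.cong refl) auto
        finally show ?thesis
          using elim by simp
      qed
      have "?G (?D \<omega>) = restrict (?Y \<omega>) J"
      proof
        fix s
        have "(\<Sum>i<n. of_bool (t (Suc i) \<le> s) * ?D \<omega> i) = (\<Sum>i<n. of_bool (t (Suc i) \<le> s) * (w (t (Suc i)) \<omega> - w (t i) \<omega>))"
          by (intro sum.cong) auto
        then show "?G (?D \<omega>) s = restrict (?Y \<omega>) J s"
          using J w[of s] by auto
      qed
      moreover have "?Y \<omega> \<in> space path_space" "?D \<omega> \<in> space N"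
        by (auto simp: space_path_space space_N space_PiM)
      ultimately show ?case
        by (auto simp: path_cylinder_def)
    qed
    show "?Y -` path_cylinder J B \<inter> space M \<in> sets M"
      by (intro measurable_sets[OF drift_path_measurable[OF W]] path_cylinder_measurable J B)
    show "?D -` {x \<in> space N. ?G x \<in> B} \<inter> space M \<in> sets M"
      using measurable_sets[OF G B] by (intro measurable_sets[OF D]) (simp add: sets_N vimage_def Int_def conj_commute)
  qed
  also have "\<dots> = emeasure N {x \<in> space N. ?G x \<in> B}"
    unfolding law[symmetric]
  proof (subst emeasure_distr[OF D])
    show "{x \<in> space (distr M (PiM {..<n} (\<lambda>_. borel)) ?D). ?G x \<in> B} \<in> sets (PiM {..<n} (\<lambda>_. borel))"
      using measurable_sets[OF G B] unfolding law by (simp add: sets_N vimage_def Int_def conj_commute)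
  qed simp
  finally show ?thesis .
qed

text \<open>Adding \<gamma> to the drift translates the increments by \<open>m\<close>, so on
  cylinders the finite-dimensional bound applies. Its constants depend only on the energy bound
  \<open>v\<^sup>2\<close>, which holds for every mesh, and this uniformity lets the bound extend to
  the generated sigma-algebra.\<close>

lemma drift_shift_bound:
  assumes W: "wiener_process M w" and g: "L2_unit g" and \<epsilon>: "\<epsilon> > 0"
    and v: "l2norm g / \<epsilon> \<le> v" "v > 0" and r: "r \<ge> 0" and A: "A \<in> sets path_space"
  shows "measure (drift_law M w (\<lambda>t. d t + (LINT s|lebesgue_on {0<..<t}. g s)) \<epsilon>) A
       \<le> exp (v\<^sup>2 / 2 + r * v) * measure (drift_law M w d \<epsilon>) A + exp (- r\<^sup>2 / 2)"
proof -
  define \<gamma> where "\<gamma> t = (LINT s|lebesgue_on {0<..<t}. g s)" for t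
  let ?P = "drift_law M w (\<lambda>t. d t + \<gamma> t) \<epsilon>" and ?Q = "drift_law M w d \<epsilon>"
  interpret P: prob_space ?P by (rule prob_space_drift_law[OF W])
  interpret Q: prob_space ?Q by (rule prob_space_drift_law[OF W])
  have "measure ?P A \<le> exp (v\<^sup>2 / 2 + r * v) * measure ?Q A + exp (- r\<^sup>2 / 2)"
  proof (rule measure_bound_from_algebra[OF algebra_path_cylinders P.finite_measure_axioms Q.finite_measure_axioms])
    fix C assume "C \<in> path_cylinders"
    then obtain J B where C: "C = path_cylinder J B" and J: "finite J" "J \<subseteq> {0<..<1}" and B: "B \<in> sets (PiM J (\<lambda>_. borel))"
      by (auto simp: path_cylinders_def)
    have "J \<subseteq> {0<..}"
      using J(2) by auto
    obtain n and t :: "nat \<Rightarrow> real" where t: "t 0 = 0" "strict_mono_on {..n} t" "t ` {..n} = insert 0 J"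
      by (rule finite_set_enumeration[OF J(1) \<open>J \<subseteq> {0<..}\<close>])
    have less: "t i < t (Suc i)" if "i < n" for i
      using that by (intro strict_mono_onD[OF t(2)]) auto
    have nonneg: "0 \<le> t i" if "i \<le> n" for i
      using strict_mono_on_less_eq[OF t(2), of 0 i] that by (simp add: t(1))
    have "t n \<in> insert 0 J"
      using t(3) by auto
    then have tn: "t n < 1"
      using J(2) by auto
    define \<sigma> where "\<sigma> = (\<lambda>i. if i < n then sqrt (t (Suc i) - t i) else 1)"
    have \<sigma>: "\<sigma> i > 0" for i
      using less[of i] by (simp add: \<sigma>_def)
    define N where "N = PiM {..<n} (\<lambda>i. centred_normal (\<sigma> i))"
    have sets_N[measurable_cong]: "sets N = sets (PiM {..<n} (\<lambda>_. borel))"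
      unfolding N_def by (intro sets_PiM_cong) auto
    then have space_N: "space N = (\<Pi>\<^sub>E i\<in>{..<n}. UNIV)"
      by (auto dest!: sets_eq_imp_space_eq simp: space_PiM)
    \<comment> \<open>The noise is \<open>\<epsilon> * w\<close> while \<open>N\<close> is the law
      of the increments of \<open>w\<close> itself; hence the division by \<epsilon>.\<close>
    define m where "m i = (\<gamma> (t (Suc i)) - \<gamma> (t i)) / \<epsilon>" for i
    let ?G = "\<lambda>d x. \<lambda>s\<in>J. d s + \<epsilon> * (\<Sum>i<n. of_bool (t (Suc i) \<le> s) * x i)"
    let ?H = "\<lambda>x. \<lambda>i\<in>{..<n}. x i + m i"
    define B' where "B' = {x \<in> space N. ?G d x \<in> B}"
    have G: "?G d \<in> N \<rightarrow>\<^sub>M PiM J (\<lambda>_. borel)"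
      by measurable
    have B': "B' \<in> sets (PiM {..<n} (\<lambda>_. borel))"
      using measurable_sets[OF G B] by (simp add: B'_def sets_N vimage_def Int_def conj_commute)
    have energy: "(\<Sum>i<n. (m i)\<^sup>2 / (\<sigma> i)\<^sup>2) \<le> v\<^sup>2"
    proof -
      have "(\<Sum>i<n. (m i)\<^sup>2 / (\<sigma> i)\<^sup>2) = (\<Sum>i<n. (\<gamma> (t (Suc i)) - \<gamma> (t i))\<^sup>2 / (t (Suc i) - t i)) / \<epsilon>\<^sup>2"
        unfolding sum_divide_distrib
      proof (intro sum.cong refl)
        fix i assume "i \<in> {..<n}"
        then show "(m i)\<^sup>2 / (\<sigma> i)\<^sup>2 = (\<gamma> (t (Suc i)) - \<gamma> (t i))\<^sup>2 / (t (Suc i) - t i) / \<epsilon>\<^sup>2"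
          using less[of i] by (simp add: m_def \<sigma>_def power_divide)
      qed
      also have "\<dots> \<le> (l2norm g)\<^sup>2 / \<epsilon>\<^sup>2"
        unfolding \<gamma>_def by (intro divide_right_mono primitive_energy_le[OF g t(1,2) tn]) simp
      also have "\<dots> = (l2norm g / \<epsilon>)\<^sup>2"
        by (simp add: power_divide)
      also have "\<dots> \<le> v\<^sup>2"
        using v \<epsilon> by (intro power_mono) auto
      finally show ?thesis .
    qed
    have "emeasure ?P C = emeasure N {x \<in> space N. ?G (\<lambda>t. d t + \<gamma> t) x \<in> B}"
      unfolding C N_def \<sigma>_def by (rule drift_law_cylinder[OF W t J(2) B])
    also have "{x \<in> space N. ?G (\<lambda>t. d t + \<gamma> t) x \<in> B} = ?H -` B' \<inter> space N"
    proof -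
      have "?G (\<lambda>t. d t + \<gamma> t) x = ?G d (?H x)" for x
      proof
        fix s
        have "\<gamma> s = \<epsilon> * (\<Sum>i<n. of_bool (t (Suc i) \<le> s) * m i)" if "s \<in> J"
        proof -
          have "\<gamma> s - \<gamma> 0 = (\<Sum>i<n. of_bool (0 \<le> t i \<and> t (Suc i) \<le> s) * (\<gamma> (t (Suc i)) - \<gamma> (t i)))"
            using that J t(3) by (intro telescope_increments[OF t(2), of 0 s \<gamma>]) auto
          also have "\<dots> = (\<Sum>i<n. of_bool (t (Suc i) \<le> s) * (\<epsilon> * m i))"
            using nonneg \<epsilon> by (intro sum.cong refl) (auto simp: m_def)
          also have "\<dots> = \<epsilon> * (\<Sum>i<n. of_bool (t (Suc i) \<le> s) * m i)"
            unfolding sum_distrib_left by (intro sum.cong refl) auto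
          finally show ?thesis
            by (simp add: \<gamma>_def)
        qed
        moreover have "(\<Sum>i<n. of_bool (t (Suc i) \<le> s) * ?H x i)
            = (\<Sum>i<n. of_bool (t (Suc i) \<le> s) * x i) + (\<Sum>i<n. of_bool (t (Suc i) \<le> s) * m i)"
          unfolding sum.distrib[symmetric] by (intro sum.cong refl) (auto simp: algebra_simps)
        ultimately show "?G (\<lambda>t. d t + \<gamma> t) x s = ?G d (?H x) s"
          by (auto simp: algebra_simps)
      qed
      then show ?thesis
        by (auto simp: B'_def space_N)
    qed
    also have "emeasure N \<dots> = emeasure (distr N (PiM {..<n} (\<lambda>_. borel)) ?H) B'"
      using B' by (subst emeasure_distr) (simp_all add: measurable_restrict)
    also have "\<dots> \<le> ennreal (exp (v\<^sup>2 / 2 + r * sqrt (v\<^sup>2))) * emeasure N B' + ennreal (exp (- r\<^sup>2 / 2))"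
      unfolding N_def using v(2)
      by (intro gaussian_shift_bound[OF _ \<sigma> B' energy _ r]) auto
    also have "emeasure N B' = emeasure ?Q C"
      unfolding C N_def \<sigma>_def B'_def by (rule drift_law_cylinder[OF W t J(2) B, symmetric])
    finally have "ennreal (measure ?P C) \<le> ennreal (exp (v\<^sup>2 / 2 + r * v) * measure ?Q C + exp (- r\<^sup>2 / 2))"
      using v(2) by (simp add: P.emeasure_eq_measure Q.emeasure_eq_measure ennreal_mult' ennreal_plus)
    then show "measure ?P C \<le> exp (v\<^sup>2 / 2 + r * v) * measure ?Q C + exp (- r\<^sup>2 / 2)"
      by (subst (asm) ennreal_le_iff) (auto intro: add_nonneg_nonneg)
  qed (use A in \<open>auto simp: sets_path_space\<close>)
  then show ?thesis
    by (simp add: \<gamma>_def)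
qed

section \<open>The stochastic integral\<close>

abbreviation signal_law :: "'a measure \<Rightarrow> (real \<Rightarrow> 'a \<Rightarrow> real) \<Rightarrow> (real \<Rightarrow> real) \<Rightarrow> real \<Rightarrow> (real \<Rightarrow> real) measure" where
  "signal_law M w f \<epsilon> \<equiv> drift_law M w (\<lambda>t. LINT s|lebesgue_on {0<..<t}. f s) \<epsilon>"

lemma step_integral_measurable [measurable]:
  assumes "step_valid xs"
  shows "step_integral xs \<in> borel_measurable path_space"
proof -
  have comp: "(\<lambda>y. y t) \<in> borel_measurable path_space" if "0 < t" "t < 1" for t
    unfolding path_space_def using that by (intro measurable_component_singleton) auto
  show ?thesis
    using assms
  proof (induction xs)
    case (Cons x xs)
    obtain a l r where x: "x = (a, l, r)"
      by (cases x)
    then have "(\<lambda>y. a * (y r - y l) + step_integral xs y) \<in> borel_measurable path_space"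
      using Cons by (intro borel_measurable_add borel_measurable_times borel_measurable_diff comp) auto
    then show ?case
      by (simp add: x cong: measurable_cong)
  qed (simp add: step_integral_def[abs_def])
qed

lemma signal_mgf:
  assumes W: "wiener_process M w" and f: "L2_unit f" and xs: "step_valid xs"
  shows "(\<integral>\<^sup>+y. ennreal (exp (a * (step_integral xs y - l2inner (step_fun xs) f))) \<partial>signal_law M w f \<epsilon>)
       = ennreal (exp (a\<^sup>2 * \<epsilon>\<^sup>2 * (l2norm (step_fun xs))\<^sup>2 / 2))"
proof -
  let ?d = "\<lambda>t. LINT s|lebesgue_on {0<..<t}. f s"
  let ?Y = "\<lambda>\<omega>. \<lambda>t\<in>{0<..<1}. ?d t + \<epsilon> * w t \<omega>"
  have eq: "step_integral xs (?Y \<omega>) - l2inner (step_fun xs) f = \<epsilon> * step_integral xs (\<lambda>t. w t \<omega>)" for \<omega>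
  proof -
    have "step_integral xs (?Y \<omega>) = step_integral xs (\<lambda>t. ?d t + \<epsilon> * w t \<omega>)"
      by (rule step_integral_cong[OF xs]) auto
    then show ?thesis
      by (simp add: step_integral_add step_integral_cmult l2inner_step_fun[OF f xs])
  qed
  have "(\<integral>\<^sup>+y. ennreal (exp (a * (step_integral xs y - l2inner (step_fun xs) f))) \<partial>signal_law M w f \<epsilon>)
      = (\<integral>\<^sup>+\<omega>. ennreal (exp ((a * \<epsilon>) * step_integral xs (\<lambda>t. w t \<omega>))) \<partial>M)"
    unfolding drift_law_def using step_integral_measurable[OF xs]
    by (subst nn_integral_distr[OF drift_path_measurable[OF W]]) (simp_all add: eq mult.assoc)
  also have "\<dots> = ennreal (exp ((a * \<epsilon>)\<^sup>2 * (l2norm (step_fun xs))\<^sup>2 / 2))"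
    by (rule step_integral_mgf[OF W xs])
  finally show ?thesis
    by (simp add: power_mult_distrib)
qed

text \<open>Turns bounds on the moment generating function at a point and at its negative into a
  bound on the second moment.\<close>

lemma square_le_two_exp: "(x::real)\<^sup>2 \<le> 2 * exp x + 2 * exp (- x)"
proof -
  have "x\<^sup>2 \<le> 2 * exp \<bar>x\<bar>"
    using exp_lower_Taylor_quadratic[of "\<bar>x\<bar>"] by simp
  moreover have "exp \<bar>x\<bar> \<le> exp x + exp (- x)"
    by (cases "x \<ge> 0") auto
  ultimately show ?thesis
    by linarith
qed

text \<open>\<open>V\<close> stands for the norm, which may vanish. The mean contributes through
  Cauchy-Schwarz and the noise through exponential moments, both in proportion to
  \<open>V\<^sup>2\<close>.\<close>

lemma signal_second_moment:
  assumes W: "wiener_process M w" and f: "L2_unit f" and xs: "step_valid xs" and \<epsilon>: "\<epsilon> > 0"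
    and V: "l2norm (step_fun xs) \<le> V" "V > 0"
  shows "(\<integral>\<^sup>+y. ennreal ((step_integral xs y)\<^sup>2) \<partial>signal_law M w f \<epsilon>)
       \<le> ennreal ((2 * (l2norm f)\<^sup>2 + 16 * \<epsilon>\<^sup>2) * V\<^sup>2)"
proof -
  interpret prob_space "signal_law M w f \<epsilon>"
    by (rule prob_space_drift_law[OF W])
  define m where "m = l2inner (step_fun xs) f"
  \<comment> \<open>At this scale the exponents of the moment generating function at
    \<open>b\<close> and \<open>- b\<close> are at most 1/2, so both values are at most 2. The two
    exponential terms then add up to \<open>16 / b\<^sup>2\<close>, the source of the constant
    16.\<close>
  define b where "b = 1 / (\<epsilon> * V)"
  have b: "b > 0"
    using \<epsilon> V by (simp add: b_def)
  note [measurable] = step_integral_measurable[OF xs]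
  have pw: "(step_integral xs y)\<^sup>2
      \<le> 2 * m\<^sup>2 + 4 / b\<^sup>2 * exp (b * (step_integral xs y - m)) + 4 / b\<^sup>2 * exp (- b * (step_integral xs y - m))" for y
  proof -
    let ?z = "step_integral xs y - m"
    have "b\<^sup>2 * ?z\<^sup>2 \<le> 2 * exp (b * ?z) + 2 * exp (- b * ?z)"
      using square_le_two_exp[of "b * ?z"] by (simp add: power_mult_distrib)
    then have "?z\<^sup>2 \<le> (2 * exp (b * ?z) + 2 * exp (- b * ?z)) / b\<^sup>2"
      using b by (simp add: pos_le_divide_eq mult.commute)
    moreover have "(step_integral xs y)\<^sup>2 \<le> 2 * m\<^sup>2 + 2 * ?z\<^sup>2"
      using zero_le_power2[of "step_integral xs y - 2 * m"] by (simp add: power2_eq_square algebra_simps)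
    ultimately show ?thesis
      by (simp add: add_divide_distrib)
  qed
  have mgf: "(\<integral>\<^sup>+y. ennreal (exp (a * (step_integral xs y - m))) \<partial>signal_law M w f \<epsilon>) \<le> 2" if "a\<^sup>2 = b\<^sup>2" for a
  proof -
    have "a\<^sup>2 * \<epsilon>\<^sup>2 * (l2norm (step_fun xs))\<^sup>2 / 2 \<le> b\<^sup>2 * \<epsilon>\<^sup>2 * V\<^sup>2 / 2"
      unfolding that using V by (intro divide_right_mono mult_left_mono power_mono) auto
    also have "\<dots> = 1 / 2"
      using \<epsilon> V by (simp add: b_def power_divide power_mult_distrib)
    finally have "exp (a\<^sup>2 * \<epsilon>\<^sup>2 * (l2norm (step_fun xs))\<^sup>2 / 2) \<le> 2"
      using exp_half_le2 by (meson exp_le_cancel_iff order_trans)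
    then show ?thesis
      unfolding m_def signal_mgf[OF W f xs] using ennreal_leI by fastforce
  qed
  have "(\<integral>\<^sup>+y. ennreal ((step_integral xs y)\<^sup>2) \<partial>signal_law M w f \<epsilon>)
      \<le> (\<integral>\<^sup>+y. ennreal (2 * m\<^sup>2) + ennreal (4 / b\<^sup>2) * ennreal (exp (b * (step_integral xs y - m)))
          + ennreal (4 / b\<^sup>2) * ennreal (exp (- b * (step_integral xs y - m))) \<partial>signal_law M w f \<epsilon>)"
    using pw by (intro nn_integral_mono) (simp add: ennreal_mult'[symmetric] ennreal_plus[symmetric] ennreal_leI del: ennreal_plus)
  also have "\<dots> = ennreal (2 * m\<^sup>2) + ennreal (4 / b\<^sup>2) * (\<integral>\<^sup>+y. ennreal (exp (b * (step_integral xs y - m))) \<partial>signal_law M w f \<epsilon>)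
      + ennreal (4 / b\<^sup>2) * (\<integral>\<^sup>+y. ennreal (exp (- b * (step_integral xs y - m))) \<partial>signal_law M w f \<epsilon>)"
    by (simp add: nn_integral_add nn_integral_cmult emeasure_space_1[simplified])
  also have "\<dots> \<le> ennreal (2 * m\<^sup>2) + ennreal (4 / b\<^sup>2) * ennreal 2 + ennreal (4 / b\<^sup>2) * ennreal 2"
    using mgf[of b] mgf[of "- b"] by (intro add_mono mult_left_mono order_refl) simp_all
  also have "\<dots> = ennreal (2 * m\<^sup>2 + 16 / b\<^sup>2)"
  proof -
    have "ennreal (4 / b\<^sup>2) * ennreal 2 = ennreal (8 / b\<^sup>2)"
      by (subst ennreal_mult'[symmetric]) auto
    then show ?thesis
      by (simp add: ennreal_plus[symmetric] del: ennreal_plus)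
  qed
  also have "\<dots> \<le> ennreal ((2 * (l2norm f)\<^sup>2 + 16 * \<epsilon>\<^sup>2) * V\<^sup>2)"
  proof (rule ennreal_leI)
    have "\<bar>m\<bar> \<le> V * l2norm f"
      unfolding m_def using l2_Cauchy_Schwarz[OF L2_unit_step_fun f, of xs] V
      by (meson l2norm_nonneg mult_right_mono order_trans)
    then have "m\<^sup>2 \<le> (V * l2norm f)\<^sup>2"
      by (simp add: abs_le_square_iff[symmetric] abs_mult V less_imp_le)
    then show "2 * m\<^sup>2 + 16 / b\<^sup>2 \<le> (2 * (l2norm f)\<^sup>2 + 16 * \<epsilon>\<^sup>2) * V\<^sup>2"
      by (simp add: b_def power_divide power_mult_distrib algebra_simps)
  qed
  finally show ?thesis .
qed

text \<open>The geometric rate makes successive differences summable, so that step integrals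
  converge almost surely along the whole sequence and not along a subsequence that varies with the
  law.\<close>

lemma fast_step_approximation:
  assumes "L2_unit f"
  obtains xs where "\<And>n. step_valid (xs n)" "\<And>n. l2norm (\<lambda>s. step_fun (xs n) s - f s) < (1 / 2) ^ n"
proof -
  have "\<forall>n. \<exists>xs. step_valid xs \<and> l2norm (\<lambda>s. step_fun xs s - f s) < (1 / 2) ^ n"
    using step_approximable_L2[OF assms] by (simp add: step_approximable_def)
  from choice[OF this] show thesis
    using that by blast
qed

text \<open>One version has to serve all noise levels and signals. It is the pointwise limit of step
  integrals along a rapidly convergent sequence; the sequence is chosen before the law, and the
  limit exists almost surely under each of the laws.\<close>

lemma stoch_integral_exists:
  assumes W: "wiener_process M w" and f: "L2_unit f"
  shows "\<exists>J. \<forall>\<epsilon>>0. \<forall>g. L2_unit g \<longrightarrow> is_stoch_integral (signal_law M w g \<epsilon>) f J"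
proof -
  obtain xs where valid: "\<And>n. step_valid (xs n)"
    and fast: "\<And>n. l2norm (\<lambda>s. step_fun (xs n) s - f s) < (1 / 2) ^ n"
    using fast_step_approximation[OF f] by metis
  define J where "J y = lim (\<lambda>n. step_integral (xs n) y)" for y
  note [measurable] = step_integral_measurable[OF valid]
  have J[measurable]: "J \<in> borel_measurable path_space"
    unfolding J_def by measurable
  have L2: "L2_unit (step_fun (xs n))" for n
    by (rule L2_unit_step_fun)
  have l2_lim: "(\<lambda>n. LINT s|lebesgue_on {0<..<1}. (step_fun (xs n) s - f s)\<^sup>2) \<longlonglongrightarrow> 0"
  proof -
    have "(\<lambda>n. l2norm (\<lambda>s. step_fun (xs n) s - f s)) \<longlonglongrightarrow> 0"
      using fast by (intro tendsto_sandwich[OF _ _ tendsto_const LIMSEQ_power_zero[of "1/2 :: real"]])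
        (auto intro!: always_eventually less_imp_le)
    then have "(\<lambda>n. (l2norm (\<lambda>s. step_fun (xs n) s - f s))\<^sup>2) \<longlonglongrightarrow> 0"
      by (auto intro!: tendsto_eq_intros)
    then show ?thesis
      by (simp add: l2norm_sq)
  qed
  have cauchy: "l2norm (step_fun (step_diff (xs n) (xs m))) \<le> 2 * (1 / 2) ^ n" if "n \<le> m" for n m
  proof -
    have "l2norm (\<lambda>s. (step_fun (xs n) s - f s) + (f s - step_fun (xs m) s))
        \<le> l2norm (\<lambda>s. step_fun (xs n) s - f s) + l2norm (\<lambda>s. f s - step_fun (xs m) s)"
      by (intro l2norm_triangle L2_unit_diff L2 f)
    also have "\<dots> \<le> (1 / 2) ^ n + (1 / 2) ^ m"
      using fast[of n] fast[of m] by (simp add: l2norm_minus_commute[of f])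
    also have "(1 / 2 :: real) ^ m \<le> (1 / 2) ^ n"
      using that by (intro power_decreasing) auto
    finally show ?thesis
      by (simp add: step_diff(2))
  qed
  have "is_stoch_integral (signal_law M w g \<epsilon>) f J" if \<epsilon>: "\<epsilon> > 0" and g: "L2_unit g" for g \<epsilon>
  proof -
    let ?P = "signal_law M w g \<epsilon>"
    let ?s = "\<lambda>n y. step_integral (xs n) y"
    define K where "K = 2 * (l2norm g)\<^sup>2 + 16 * \<epsilon>\<^sup>2"
    have K: "K \<ge> 0"
      by (simp add: K_def)
    interpret prob_space ?P
      by (rule prob_space_drift_law[OF W])
    have msq: "(\<integral>\<^sup>+y. ennreal ((?s n y - ?s m y)\<^sup>2) \<partial>?P) \<le> ennreal (4 * K * (1 / 4) ^ n)" if "n \<le> m" for n m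
    proof -
      have "(\<integral>\<^sup>+y. ennreal ((?s n y - ?s m y)\<^sup>2) \<partial>?P)
          = (\<integral>\<^sup>+y. ennreal ((step_integral (step_diff (xs n) (xs m)) y)\<^sup>2) \<partial>?P)"
        by (simp add: step_diff(3))
      also have "\<dots> \<le> ennreal (K * (2 * (1 / 2) ^ n)\<^sup>2)"
        unfolding K_def using step_diff(1)[OF valid valid] cauchy[OF that]
        by (intro signal_second_moment[OF W g _ \<epsilon>]) auto
      also have "K * (2 * (1 / 2) ^ n)\<^sup>2 = 4 * K * (1 / 4 :: real) ^ n"
      proof -
        have "(1 / 2 :: real) ^ n * (1 / 2) ^ n = (1 / 4) ^ n"
          by (simp flip: power_mult_distrib)
        then show ?thesis
          by (simp add: power2_eq_square)
      qed
      finally show ?thesis .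
    qed
    have conv: "AE y in ?P. (\<lambda>n. ?s n y) \<longlonglongrightarrow> J y"
    proof -
      have abs: "(\<integral>\<^sup>+y. ennreal \<bar>?s (Suc n) y - ?s n y\<bar> \<partial>?P) \<le> ennreal ((4 * K + 1) * (1 / 2) ^ n)" for n
      proof -
        \<comment> \<open>The weight \<open>2 ^ n\<close> balances the two terms: second moments of
          the differences are of order \<open>(1 / 4) ^ n\<close>, so first moments are of order
          \<open>(1 / 2) ^ n\<close> and summable.\<close>
        have pw: "\<bar>x\<bar> \<le> 2 ^ n * x\<^sup>2 + (1 / 2) ^ n" for x :: real
        proof -
          have "2 * \<bar>x\<bar> \<le> 2 ^ n * x\<^sup>2 + (1 / 2) ^ n"
          proof -
            have "0 \<le> (2 ^ n * \<bar>x\<bar> - 1)\<^sup>2 * (1 / 2) ^ n"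
              by simp
            also have "\<dots> = 2 ^ n * x\<^sup>2 + (1 / 2) ^ n - 2 * \<bar>x\<bar>"
              by (simp add: power2_eq_square power_divide field_simps)
            finally show ?thesis
              by simp
          qed
          then show ?thesis
            by linarith
        qed
        have "(\<integral>\<^sup>+y. ennreal \<bar>?s (Suc n) y - ?s n y\<bar> \<partial>?P)
            \<le> (\<integral>\<^sup>+y. ennreal (2 ^ n) * ennreal ((?s n y - ?s (Suc n) y)\<^sup>2) + ennreal ((1 / 2) ^ n) \<partial>?P)"
        proof (rule nn_integral_mono)
          fix y
          show "ennreal \<bar>?s (Suc n) y - ?s n y\<bar> \<le> ennreal (2 ^ n) * ennreal ((?s n y - ?s (Suc n) y)\<^sup>2) + ennreal ((1 / 2) ^ n)"
            using pw[of "?s n y - ?s (Suc n) y"]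
            by (simp add: abs_minus_commute ennreal_mult'[symmetric] ennreal_plus[symmetric] ennreal_leI del: ennreal_plus)
        qed
        also have "\<dots> = ennreal (2 ^ n) * (\<integral>\<^sup>+y. ennreal ((?s n y - ?s (Suc n) y)\<^sup>2) \<partial>?P) + ennreal ((1 / 2) ^ n)"
          by (simp add: nn_integral_add nn_integral_cmult emeasure_space_1[simplified])
        also have "\<dots> \<le> ennreal (2 ^ n) * ennreal (4 * K * (1 / 4) ^ n) + ennreal ((1 / 2) ^ n)"
          by (intro add_mono mult_left_mono msq) auto
        also have "\<dots> = ennreal ((4 * K + 1) * (1 / 2) ^ n)"
        proof -
          have "(2::real) ^ n * (1 / 4) ^ n = (1 / 2) ^ n"
            by (simp add: power_mult_distrib[symmetric])
          then show ?thesis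
            using K by (simp add: ennreal_mult'[symmetric] ennreal_plus[symmetric] algebra_simps del: ennreal_plus)
        qed
        finally show ?thesis .
      qed
      have "(\<integral>\<^sup>+y. (\<Sum>n. ennreal \<bar>?s (Suc n) y - ?s n y\<bar>) \<partial>?P) = (\<Sum>n. \<integral>\<^sup>+y. ennreal \<bar>?s (Suc n) y - ?s n y\<bar> \<partial>?P)"
        by (intro nn_integral_suminf) measurable
      also have "\<dots> \<le> (\<Sum>n. ennreal ((4 * K + 1) * (1 / 2) ^ n))"
        by (intro suminf_le abs) auto
      also have "\<dots> < \<infinity>"
      proof -
        have "summable (\<lambda>n. (4 * K + 1) * (1 / 2 :: real) ^ n)"
          by (intro summable_mult summable_geometric) simp
        then have "(\<Sum>n. ennreal ((4 * K + 1) * (1 / 2) ^ n)) \<noteq> top"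
          using K by (intro ennreal_suminf_neq_top) auto
        then show ?thesis
          by (simp add: less_top)
      qed
      finally have "AE y in ?P. (\<Sum>n. ennreal \<bar>?s (Suc n) y - ?s n y\<bar>) \<noteq> \<infinity>"
        by (intro nn_integral_noteq_infinite) auto
      then show ?thesis
      proof eventually_elim
        case (elim y)
        then have "summable (\<lambda>n. \<bar>?s (Suc n) y - ?s n y\<bar>)"
          by (intro summable_suminf_not_top) auto
        then have "summable (\<lambda>n. ?s (Suc n) y - ?s n y)"
          by (rule summable_rabs_cancel)
        then have "convergent (\<lambda>n. ?s n y - ?s 0 y)"
          using sum_lessThan_telescope[of "\<lambda>n. ?s n y"] by (simp add: summable_iff_convergent)
        then have "convergent (\<lambda>n. (?s n y - ?s 0 y) + ?s 0 y)"
          by (intro convergent_add convergent_const)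
        then show ?case
          by (simp add: J_def convergent_LIMSEQ_iff)
      qed
    qed
    \<comment> \<open>Fatou in the second index carries the bound between two step integrals over to
      the limit \<open>J\<close>.\<close>
    have fatou: "(\<integral>\<^sup>+y. ennreal ((?s n y - J y)\<^sup>2) \<partial>?P) \<le> ennreal (4 * K * (1 / 4) ^ n)" for n
    proof -
      have "(\<integral>\<^sup>+y. ennreal ((?s n y - J y)\<^sup>2) \<partial>?P) = (\<integral>\<^sup>+y. liminf (\<lambda>m. ennreal ((?s n y - ?s m y)\<^sup>2)) \<partial>?P)"
      proof (rule nn_integral_cong_AE)
        show "AE y in ?P. ennreal ((?s n y - J y)\<^sup>2) = liminf (\<lambda>m. ennreal ((?s n y - ?s m y)\<^sup>2))"
          using conv
        proof eventually_elim
          case (elim y)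
          then have "(\<lambda>m. ennreal ((?s n y - ?s m y)\<^sup>2)) \<longlonglongrightarrow> ennreal ((?s n y - J y)\<^sup>2)"
            by (intro tendsto_ennrealI tendsto_intros)
          then show ?case
            by (intro lim_imp_Liminf[symmetric]) auto
        qed
      qed
      also have "\<dots> \<le> liminf (\<lambda>m. \<integral>\<^sup>+y. ennreal ((?s n y - ?s m y)\<^sup>2) \<partial>?P)"
        by (intro nn_integral_liminf) measurable
      also have "\<dots> \<le> liminf (\<lambda>m. ennreal (4 * K * (1 / 4) ^ n))"
        by (intro Liminf_mono eventually_sequentiallyI[of n] msq)
      finally show ?thesis
        by (simp add: Liminf_const)
    qed
    have "(\<lambda>n. \<integral>\<^sup>+y. ennreal ((?s n y - J y)\<^sup>2) \<partial>?P) \<longlonglongrightarrow> 0"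
    proof (rule tendsto_sandwich[OF _ _ tendsto_const])
      have "(\<lambda>n. ennreal (4 * K * (1 / 4) ^ n)) \<longlonglongrightarrow> ennreal (4 * K * 0)"
        by (intro tendsto_ennrealI tendsto_intros LIMSEQ_power_zero) auto
      then show "(\<lambda>n. ennreal (4 * K * (1 / 4) ^ n)) \<longlonglongrightarrow> 0"
        by simp
    qed (use fatou in auto)
    then show ?thesis
      unfolding is_stoch_integral_def using J valid l2_lim by blast
  qed
  then show ?thesis
    by blast
qed

text \<open>The moment generating function is at hand for step integrals. If \<open>J\<close>
  exceeds the level, then either the step integral exceeds it up to \<eta>, or it is at least \<eta>
  away from \<open>J\<close>; the first case is bounded by an exponential Markov inequality, the
  second by a Chebyshev term that vanishes in the limit. The sign \<sigma> covers both
  tails.\<close>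

lemma stoch_integral_chernoff:
  assumes W: "wiener_process M w" and f: "L2_unit f" and g: "L2_unit g"
    and J: "is_stoch_integral (signal_law M w g \<epsilon>) f J" and a: "a \<ge> 0" and sg: "\<bar>\<sigma>\<bar> = 1"
  shows "measure (signal_law M w g \<epsilon>) {y \<in> space path_space. x \<le> \<sigma> * (J y - l2inner f g)}
       \<le> exp (a\<^sup>2 * \<epsilon>\<^sup>2 * (l2norm f)\<^sup>2 / 2 - a * x)"
proof -
  let ?P = "signal_law M w g \<epsilon>"
  let ?A = "{y \<in> space path_space. x \<le> \<sigma> * (J y - l2inner f g)}"
  interpret prob_space ?P
    by (rule prob_space_drift_law[OF W])
  have \<sigma>2: "\<sigma>\<^sup>2 = 1"
    using sg by (metis one_power2 power2_abs)
  obtain xs where valid: "\<And>n. step_valid (xs n)"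
    and l2: "(\<lambda>n. LINT s|lebesgue_on {0<..<1}. (step_fun (xs n) s - f s)\<^sup>2) \<longlonglongrightarrow> 0"
    and msq: "(\<lambda>n. \<integral>\<^sup>+y. ennreal ((step_integral (xs n) y - J y)\<^sup>2) \<partial>?P) \<longlonglongrightarrow> 0"
    and [measurable]: "J \<in> borel_measurable path_space"
    using J unfolding is_stoch_integral_def by auto
  note [measurable] = step_integral_measurable[OF valid]
  have l2': "(\<lambda>n. l2norm (\<lambda>s. step_fun (xs n) s - f s)) \<longlonglongrightarrow> 0"
    using tendsto_real_sqrt[OF l2] by (simp add: l2norm_def)
  define m where "m n = l2inner (step_fun (xs n)) g" for n
  have m: "m \<longlonglongrightarrow> l2inner f g"
  proof (rule LIM_zero_cancel, rule Lim_null_comparison)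
    show "\<forall>\<^sub>F n in sequentially. norm (m n - l2inner f g) \<le> l2norm (\<lambda>s. step_fun (xs n) s - f s) * l2norm g"
      using l2_Cauchy_Schwarz[OF L2_unit_diff[OF L2_unit_step_fun f] g]
      by (intro always_eventually) (simp add: m_def l2inner_diff[OF L2_unit_step_fun f g])
    show "(\<lambda>n. l2norm (\<lambda>s. step_fun (xs n) s - f s) * l2norm g) \<longlonglongrightarrow> 0"
      using l2' by (intro tendsto_eq_intros) auto
  qed
  have nrm: "(\<lambda>n. l2norm (step_fun (xs n))) \<longlonglongrightarrow> l2norm f"
  proof (rule LIM_zero_cancel, rule Lim_null_comparison[OF _ l2'])
    show "\<forall>\<^sub>F n in sequentially. norm (l2norm (step_fun (xs n)) - l2norm f) \<le> l2norm (\<lambda>s. step_fun (xs n) s - f s)"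
    proof (intro always_eventually allI)
      fix n
      show "norm (l2norm (step_fun (xs n)) - l2norm f) \<le> l2norm (\<lambda>s. step_fun (xs n) s - f s)"
        using l2norm_triangle_sub[OF L2_unit_step_fun[of "xs n"] f] l2norm_triangle_sub[OF f L2_unit_step_fun[of "xs n"]]
          l2norm_minus_commute[of f "step_fun (xs n)"] by (simp add: abs_le_iff)
    qed
  qed
  have A: "?A \<in> sets ?P"
    by simp
  have bound: "emeasure ?P ?A \<le> ennreal (exp (a\<^sup>2 * \<epsilon>\<^sup>2 * (l2norm f)\<^sup>2 / 2 - a * (x - \<eta>)))" if \<eta>: "\<eta> > 0" for \<eta>
  proof -
    define E where "E n = exp (a\<^sup>2 * \<epsilon>\<^sup>2 * (l2norm (step_fun (xs n)))\<^sup>2 / 2 + a * \<sigma> * (m n - l2inner f g) - a * (x - \<eta>))" for n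
    have step: "emeasure ?P ?A \<le> ennreal (E n) + ennreal (1 / \<eta>\<^sup>2) * (\<integral>\<^sup>+y. ennreal ((step_integral (xs n) y - J y)\<^sup>2) \<partial>?P)" for n
    proof -
      \<comment> \<open>\<open>B\<close> carries the level together with the difference between the
        mean \<open>m n\<close> of the step integral and its limit
        \<open>l2inner f g\<close>.\<close>
      define B where "B = exp (a * \<sigma> * (m n - l2inner f g) - a * (x - \<eta>))"
      let ?Z = "\<lambda>y. exp (a * \<sigma> * (step_integral (xs n) y - m n))"
      have "emeasure ?P ?A = (\<integral>\<^sup>+y. indicator ?A y \<partial>?P)"
        using A by simp
      also have "\<dots> \<le> (\<integral>\<^sup>+y. ennreal B * ennreal (?Z y) + ennreal (1 / \<eta>\<^sup>2) * ennreal ((step_integral (xs n) y - J y)\<^sup>2) \<partial>?P)"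
      proof (rule nn_integral_mono)
        fix y
        have "1 \<le> B * ?Z y + 1 / \<eta>\<^sup>2 * (step_integral (xs n) y - J y)\<^sup>2" if y: "y \<in> ?A"
        proof (cases "x - \<eta> \<le> \<sigma> * (step_integral (xs n) y - l2inner f g)")
          case True
          have "B * ?Z y = exp (a * (\<sigma> * (step_integral (xs n) y - l2inner f g) - (x - \<eta>)))"
            by (simp add: B_def exp_add[symmetric] algebra_simps)
          also have "\<dots> \<ge> 1"
            using True a by (simp add: mult_nonneg_nonneg)
          finally have "1 \<le> B * ?Z y" .
          then show ?thesis
            by (simp add: add_increasing2)
        next
          case False
          then have "\<eta> \<le> \<sigma> * (J y - step_integral (xs n) y)"
            using y by (simp add: algebra_simps)
          then have "\<eta>\<^sup>2 \<le> (\<sigma> * (J y - step_integral (xs n) y))\<^sup>2"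
            using \<eta> by (intro power_mono) auto
          then have "\<eta>\<^sup>2 \<le> (step_integral (xs n) y - J y)\<^sup>2"
            by (simp add: power_mult_distrib \<sigma>2 power2_commute)
          then have "1 \<le> 1 / \<eta>\<^sup>2 * (step_integral (xs n) y - J y)\<^sup>2"
            using \<eta> by (simp add: pos_le_divide_eq)
          moreover have "0 \<le> B * ?Z y"
            by (simp add: B_def)
          ultimately show ?thesis
            by linarith
        qed
        then show "indicator ?A y \<le> ennreal B * ennreal (?Z y) + ennreal (1 / \<eta>\<^sup>2) * ennreal ((step_integral (xs n) y - J y)\<^sup>2)"
          by (cases "y \<in> ?A") (simp_all add: B_def ennreal_mult'[symmetric] ennreal_plus[symmetric] del: ennreal_plus)
      qed
      also have "\<dots> = ennreal B * (\<integral>\<^sup>+y. ennreal (?Z y) \<partial>?P)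
          + ennreal (1 / \<eta>\<^sup>2) * (\<integral>\<^sup>+y. ennreal ((step_integral (xs n) y - J y)\<^sup>2) \<partial>?P)"
        by (simp add: nn_integral_add nn_integral_cmult)
      also have "(\<integral>\<^sup>+y. ennreal (?Z y) \<partial>?P) = ennreal (exp (a\<^sup>2 * \<epsilon>\<^sup>2 * (l2norm (step_fun (xs n)))\<^sup>2 / 2))"
        unfolding m_def by (subst signal_mgf[OF W g valid]) (simp add: power_mult_distrib \<sigma>2)
      also have "ennreal B * \<dots> = ennreal (E n)"
        by (simp add: B_def E_def ennreal_mult'[symmetric] exp_add[symmetric] algebra_simps)
      finally show ?thesis .
    qed
    have "E \<longlonglongrightarrow> exp (a\<^sup>2 * \<epsilon>\<^sup>2 * (l2norm f)\<^sup>2 / 2 + a * \<sigma> * (l2inner f g - l2inner f g) - a * (x - \<eta>))"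
      unfolding E_def[abs_def] by (intro tendsto_intros nrm m) auto
    then have "(\<lambda>n. ennreal (E n)) \<longlonglongrightarrow> ennreal (exp (a\<^sup>2 * \<epsilon>\<^sup>2 * (l2norm f)\<^sup>2 / 2 - a * (x - \<eta>)))"
      by (intro tendsto_ennrealI) simp
    then have "(\<lambda>n. ennreal (E n) + ennreal (1 / \<eta>\<^sup>2) * (\<integral>\<^sup>+y. ennreal ((step_integral (xs n) y - J y)\<^sup>2) \<partial>?P))
        \<longlonglongrightarrow> ennreal (exp (a\<^sup>2 * \<epsilon>\<^sup>2 * (l2norm f)\<^sup>2 / 2 - a * (x - \<eta>))) + ennreal (1 / \<eta>\<^sup>2) * 0"
      by (intro tendsto_add ennreal_tendsto_cmult msq) auto
    then show ?thesis
      using step by (intro LIMSEQ_le_const) auto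
  qed
  \<comment> \<open>With the limit over step functions taken at fixed \<eta>, the margin \<eta> is
    now sent to 0 along \<open>1 / (n + 1)\<close>.\<close>
  have "measure ?P ?A \<le> exp (a\<^sup>2 * \<epsilon>\<^sup>2 * (l2norm f)\<^sup>2 / 2 - a * (x - inverse (real (Suc n))))" for n
    using bound[of "inverse (real (Suc n))"] by (simp add: emeasure_eq_measure)
  moreover have "(\<lambda>n. exp (a\<^sup>2 * \<epsilon>\<^sup>2 * (l2norm f)\<^sup>2 / 2 - a * (x - inverse (real (Suc n)))))
      \<longlonglongrightarrow> exp (a\<^sup>2 * \<epsilon>\<^sup>2 * (l2norm f)\<^sup>2 / 2 - a * (x - 0))"
    by (intro tendsto_intros LIMSEQ_inverse_real_of_nat)
  ultimately show ?thesis
    by (intro LIMSEQ_le_const[where X = "\<lambda>n. exp (a\<^sup>2 * \<epsilon>\<^sup>2 * (l2norm f)\<^sup>2 / 2 - a * (x - inverse (real (Suc n))))"]) auto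
qed

text \<open>\<open>a = x / (\<epsilon> * l2norm f)\<close> minimises the exponent. The scale
  \<open>l2norm f * \<epsilon>\<close> is the standard deviation of \<open>J\<close>, so
  \<open>x\<close> counts standard deviations.\<close>

lemma stoch_integral_tail:
  assumes "wiener_process M w" "L2_unit f" "L2_unit g" "is_stoch_integral (signal_law M w g \<epsilon>) f J"
    and "\<bar>\<sigma>\<bar> = 1" "x \<ge> 0" "\<epsilon> > 0" "l2norm f > 0"
  shows "measure (signal_law M w g \<epsilon>) {y \<in> space path_space. x * l2norm f * \<epsilon> \<le> \<sigma> * (J y - l2inner f g)}
       \<le> exp (- x\<^sup>2 / 2)"
proof -
  have "(x / (\<epsilon> * l2norm f))\<^sup>2 * \<epsilon>\<^sup>2 * (l2norm f)\<^sup>2 / 2 - x / (\<epsilon> * l2norm f) * (x * l2norm f * \<epsilon>) = - x\<^sup>2 / 2"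
    using assms(7,8) by (simp add: power_divide power_mult_distrib power2_eq_square)
  then show ?thesis
    using stoch_integral_chernoff[OF assms(1-4) _ assms(5), of "x / (\<epsilon> * l2norm f)" "x * l2norm f * \<epsilon>"] assms(6-8)
    by simp
qed

section \<open>Error probabilities of tests\<close>

lemma is_test_complement: "is_test K \<Longrightarrow> is_test (\<lambda>y. 1 - K y)"
  by (auto simp: is_test_def)

lemma type2_error_eq_type1: "type2_error P K = type1_error P (\<lambda>y. 1 - K y)"
  by (simp add: type1_error_def type2_error_def)

lemma test_integrable:
  assumes "prob_space P" "sets P = sets path_space" "is_test K"
  shows "integrable P K"
proof -
  interpret prob_space P by fact
  show ?thesis
    using assms(2,3) sets_eq_imp_space_eq[OF assms(2)]
    by (intro integrable_const_bound[where B = 1]) (auto simp: is_test_def cong: measurable_cong_sets)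
qed

lemma type_errors_sum:
  assumes "prob_space P" "sets P = sets path_space" "is_test K"
  shows "type1_error P K + type2_error P K = 1"
proof -
  interpret prob_space P by fact
  show ?thesis
    using test_integrable[OF assms] by (simp add: type1_error_def type2_error_def prob_space)
qed

lemma type1_error_bounds:
  assumes "prob_space P" "sets P = sets path_space" "is_test K"
  shows "0 \<le> type1_error P K" "type1_error P K \<le> 1"
proof -
  interpret prob_space P by fact
  have K: "0 \<le> K y" "K y \<le> 1" if "y \<in> space P" for y
    using that assms(3) sets_eq_imp_space_eq[OF assms(2)] by (auto simp: is_test_def)
  show "0 \<le> type1_error P K"
    unfolding type1_error_def using K by (intro integral_nonneg_AE AE_I2)
  have "type1_error P K \<le> (LINT y|P. 1)"
    unfolding type1_error_def using K test_integrable[OF assms] by (intro integral_mono) auto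
  then show "type1_error P K \<le> 1"
    by (simp add: prob_space)
qed

text \<open>With \<open>type1_error_le\<close> this replaces a randomised test by the event
  \<open>d \<le> K y\<close>, for which the shift bound is available.\<close>

lemma type1_error_ge:
  assumes "prob_space P" "sets P = sets path_space" "is_test K" "d \<ge> 0"
  shows "d * measure P {y \<in> space path_space. d \<le> K y} \<le> type1_error P K"
proof -
  interpret prob_space P by fact
  have sp: "space P = space path_space"
    by (rule sets_eq_imp_space_eq[OF assms(2)])
  have [measurable]: "K \<in> borel_measurable P"
    using test_integrable[OF assms(1-3)] by auto
  have A: "{y \<in> space P. d \<le> K y} \<in> sets P"
    by measurable
  have "d * measure P {y \<in> space P. d \<le> K y} = (LINT y|P. d * indicator {y \<in> space P. d \<le> K y} y)"
    using A by simp
  also have "\<dots> \<le> type1_error P K"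
    unfolding type1_error_def
  proof (rule integral_mono)
    show "integrable P (\<lambda>y. d * indicator {y \<in> space P. d \<le> K y} y)"
      using A by (intro integrable_mult_right integrable_real_indicator) (auto simp: less_top[symmetric])
    show "d * indicator {y \<in> space P. d \<le> K y} y \<le> K y" if "y \<in> space P" for y
      using that assms(3) sp by (auto simp: is_test_def indicator_def)
  qed (rule test_integrable[OF assms(1-3)])
  finally show ?thesis
    by (simp add: sp)
qed

lemma type1_error_le:
  assumes "prob_space P" "sets P = sets path_space" "is_test K" "d \<ge> 0"
  shows "type1_error P K \<le> measure P {y \<in> space path_space. d \<le> K y} + d"
proof -
  interpret prob_space P by fact
  have sp: "space P = space path_space"
    by (rule sets_eq_imp_space_eq[OF assms(2)])
  have [measurable]: "K \<in> borel_measurable P"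
    using test_integrable[OF assms(1-3)] by auto
  have A: "{y \<in> space P. d \<le> K y} \<in> sets P"
    by measurable
  have int: "integrable P (\<lambda>y. indicator {y \<in> space P. d \<le> K y} y :: real)"
    using A by (intro integrable_real_indicator) (auto simp: less_top[symmetric])
  have "type1_error P K \<le> (LINT y|P. indicator {y \<in> space P. d \<le> K y} y + d)"
    unfolding type1_error_def
  proof (rule integral_mono[OF test_integrable[OF assms(1-3)]])
    show "K y \<le> indicator {y \<in> space P. d \<le> K y} y + d" if "y \<in> space P" for y
      using that assms(3,4) sp by (auto simp: is_test_def indicator_def add_increasing2)
  qed (use int in auto)
  also have "\<dots> = measure P {y \<in> space P. d \<le> K y} + d"
    using int A by (simp add: prob_space)
  finally show ?thesis
    by (simp add: sp)
qed

section \<open>Logarithms of error probabilities under a change of signal\<close>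

lemma drift_law_cong:
  assumes "\<And>t. 0 < t \<Longrightarrow> t < 1 \<Longrightarrow> d t = e t"
  shows "drift_law M w d \<epsilon> = drift_law M w e \<epsilon>"
proof -
  have "(\<lambda>\<omega>. \<lambda>t\<in>{0<..<1}. d t + \<epsilon> * w t \<omega>) = (\<lambda>\<omega>. \<lambda>t\<in>{0<..<1}. e t + \<epsilon> * w t \<omega>)"
    using assms by (auto simp: fun_eq_iff)
  then show ?thesis
    by (simp add: drift_law_def)
qed

lemma signal_shift_bound:
  assumes W: "wiener_process M w" and f: "L2_unit f" and h: "L2_unit h" and \<epsilon>: "\<epsilon> > 0"
    and v: "l2norm (\<lambda>s. f s - h s) / \<epsilon> \<le> v" "v > 0" and r: "r \<ge> 0" and A: "A \<in> sets path_space"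
  shows "measure (signal_law M w f \<epsilon>) A \<le> exp (v\<^sup>2 / 2 + r * v) * measure (signal_law M w h \<epsilon>) A + exp (- r\<^sup>2 / 2)"
proof -
  have "signal_law M w f \<epsilon> = drift_law M w (\<lambda>t. (LINT s|lebesgue_on {0<..<t}. h s)
      + (LINT s|lebesgue_on {0<..<t}. f s - h s)) \<epsilon>"
  proof (rule drift_law_cong)
    fix t :: real assume t: "0 < t" "t < 1"
    have "l2inner (\<lambda>s. indicator {0<..t} s) (\<lambda>s. f s - h s)
        = l2inner (\<lambda>s. indicator {0<..t} s) f - l2inner (\<lambda>s. indicator {0<..t} s) h"
      using l2inner_diff[OF f h L2_unit_indicator] by (simp add: l2inner_commute)
    then show "(LINT s|lebesgue_on {0<..<t}. f s)
        = (LINT s|lebesgue_on {0<..<t}. h s) + (LINT s|lebesgue_on {0<..<t}. f s - h s)"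
      using t f h by (simp add: l2inner_indicator_primitive L2_unit_diff)
  qed
  then show ?thesis
    using drift_shift_bound[OF W L2_unit_diff[OF f h] \<epsilon> v r A] by simp
qed

text \<open>With \<delta> a lower bound on the power at another signal, the first summand is the
  \<open>r\<close> with \<open>exp (- r\<^sup>2 / 2) = \<delta> / 4\<close>; the second is the price
  of a factor \<open>\<delta>\<^sup>2 / 8\<close> in front of the exponential.\<close>

definition log_slack :: "real \<Rightarrow> real" where
  "log_slack \<delta> = sqrt (2 * ln (4 / \<delta>)) + sqrt (2 * ln (8 / \<delta>\<^sup>2))"

text \<open>\<open>v\<^sup>2 + 2 * r * v + 2 * ln (1 / \<kappa>)\<close> is at most the square of
  \<open>v + r + sqrt (2 * ln (1 / \<kappa>))\<close>, so after the square root \<open>r\<close> and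
  \<kappa> cost only additive constants.\<close>

lemma log_error_le:
  assumes "0 < \<kappa>" "\<kappa> \<le> 1" "v \<ge> 0" "r \<ge> 0" "\<kappa> * exp (- (v\<^sup>2 / 2 + r * v)) \<le> \<alpha>" "\<alpha> \<le> 1"
  shows "log_error \<alpha> \<le> ereal (v + (r + sqrt (2 * ln (1 / \<kappa>))))"
proof -
  have "0 < \<kappa> * exp (- (v\<^sup>2 / 2 + r * v))"
    using assms(1) by simp
  then have \<alpha>: "0 < \<alpha>"
    using assms(5) by linarith
  have "ln (\<kappa> * exp (- (v\<^sup>2 / 2 + r * v))) \<le> ln \<alpha>"
    using \<alpha> assms(1,5) by (subst ln_le_cancel_iff) auto
  then have "- ln \<alpha> \<le> v\<^sup>2 / 2 + r * v + ln (1 / \<kappa>)"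
    using assms(1) by (simp add: ln_mult ln_div)
  moreover have "ln \<alpha> \<le> 0"
    using \<alpha> assms(6) by simp
  moreover have k: "0 \<le> ln (1 / \<kappa>)"
    using assms(1,2) by simp
  ultimately have "\<bar>2 * ln \<alpha>\<bar> \<le> v\<^sup>2 + 2 * r * v + (sqrt (2 * ln (1 / \<kappa>)))\<^sup>2"
    by (simp add: abs_if)
  also have "\<dots> \<le> (v + (r + sqrt (2 * ln (1 / \<kappa>))))\<^sup>2"
    using assms(3,4) k by (simp add: power2_sum algebra_simps add_nonneg_nonneg mult_nonneg_nonneg)
  finally have "sqrt \<bar>2 * ln \<alpha>\<bar> \<le> v + (r + sqrt (2 * ln (1 / \<kappa>)))"
    using assms(3,4) k by (intro real_le_lsqrt) auto
  then show ?thesis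
    using \<alpha> by (simp add: log_error_def)
qed

lemma log_error_ge:
  assumes "0 \<le> \<alpha>" "\<alpha> \<le> exp (- x\<^sup>2 / 2)" "x \<ge> 0"
  shows "ereal x \<le> log_error \<alpha>"
proof (cases "\<alpha> = 0")
  case False
  then have "ln \<alpha> \<le> ln (exp (- x\<^sup>2 / 2))"
    using assms by (subst ln_le_cancel_iff) auto
  then have "x\<^sup>2 \<le> \<bar>2 * ln \<alpha>\<bar>"
    by (simp add: abs_if)
  then have "x \<le> sqrt \<bar>2 * ln \<alpha>\<bar>"
    using assms(3) by (intro real_le_rsqrt)
  then show ?thesis
    using False by (simp add: log_error_def)
qed (simp add: log_error_def)

text \<open>Power at least \<delta> at \<open>f\<close> gives the event
  \<open>\<delta> / 2 \<le> K y\<close> probability at least \<open>\<delta> / 2\<close>. Half of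
  this pays for the additive error of the shift bound, the other half is carried over to
  \<open>h\<close>; on the event the test rejects with probability at least
  \<open>\<delta> / 2\<close>. The product is the factor
  \<open>\<delta>\<^sup>2 / 8\<close>.\<close>

lemma log_error_signal_shift:
  assumes W: "wiener_process M w" and f: "L2_unit f" and h: "L2_unit h" and \<epsilon>: "\<epsilon> > 0"
    and v: "l2norm (\<lambda>s. f s - h s) / \<epsilon> \<le> v" "v > 0"
    and K: "is_test K" and \<delta>: "0 < \<delta>" "\<delta> \<le> 1" "\<delta> \<le> type1_error (signal_law M w f \<epsilon>) K"
  shows "log_error (type1_error (signal_law M w h \<epsilon>) K) \<le> ereal (v + log_slack \<delta>)"
proof -
  let ?P = "signal_law M w f \<epsilon>" and ?Q = "signal_law M w h \<epsilon>"
  let ?A = "{y \<in> space path_space. \<delta> / 2 \<le> K y}"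
  define r where "r = sqrt (2 * ln (4 / \<delta>))"
  have ln4: "0 \<le> ln (4 / \<delta>)"
    using \<delta>(1,2) by (simp add: pos_le_divide_eq)
  then have "- r\<^sup>2 / 2 = - ln (4 / \<delta>)"
    by (simp add: r_def)
  then have r: "r \<ge> 0" "exp (- r\<^sup>2 / 2) = \<delta> / 4"
    using \<delta>(1) ln4 by (simp_all only: exp_minus exp_ln) (simp_all add: r_def)
  note PQ = prob_space_drift_law[OF W] sets_drift_law
  have "\<delta> / 2 \<le> measure ?P ?A"
    using type1_error_le[OF PQ K, where d = "\<delta> / 2", of "\<lambda>t. LINT s|lebesgue_on {0<..<t}. f s" \<epsilon>] \<delta>
    by linarith
  moreover have "?A \<in> sets path_space"
  proof -
    have [measurable]: "K \<in> borel_measurable path_space"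
      using K by (simp add: is_test_def)
    show ?thesis
      by measurable
  qed
  then have "measure ?P ?A \<le> exp (v\<^sup>2 / 2 + r * v) * measure ?Q ?A + exp (- r\<^sup>2 / 2)"
    by (rule signal_shift_bound[OF W f h \<epsilon> v r(1)])
  ultimately have "\<delta> / 4 \<le> exp (v\<^sup>2 / 2 + r * v) * measure ?Q ?A"
    unfolding r(2) by linarith
  then have "\<delta> / 4 * exp (- (v\<^sup>2 / 2 + r * v)) \<le> measure ?Q ?A"
    by (simp add: exp_minus field_simps)
  then have "\<delta> / 2 * (\<delta> / 4 * exp (- (v\<^sup>2 / 2 + r * v))) \<le> \<delta> / 2 * measure ?Q ?A"
    using \<delta>(1) by (intro mult_left_mono) auto
  also have "\<dots> \<le> type1_error ?Q K"
    using \<delta>(1) by (intro type1_error_ge[OF PQ K]) simp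
  finally have "\<delta>\<^sup>2 / 8 * exp (- (v\<^sup>2 / 2 + r * v)) \<le> type1_error ?Q K"
    by (simp add: power2_eq_square)
  moreover have "\<delta>\<^sup>2 \<le> 1"
    using \<delta>(1,2) by (intro power_le_one) auto
  ultimately have "log_error (type1_error ?Q K) \<le> ereal (v + (r + sqrt (2 * ln (1 / (\<delta>\<^sup>2 / 8)))))"
    using \<delta>(1) v(2) r(1) type1_error_bounds[OF PQ K] by (intro log_error_le) auto
  then show ?thesis
    by (simp add: log_slack_def r_def)
qed

text \<open>Along the signals \<open>f0 + (k/N) (f1 - f0)\<close> the power of a test passes from below \<open>c\<close> to above
  \<open>1 - c\<close>. The first \<open>k\<close> with power at least \<open>\<delta>\<close> bounds \<open>\<alpha>\<close> by a shift of relative length \<open>k/N\<close>,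
  and its predecessor bounds \<open>\<beta>\<close> by a shift of relative length \<open>1 - (k-1)/N\<close>.\<close>

lemma log_errors_sum_le:
  assumes W: "wiener_process M w" and f0: "L2_unit f0" and f1: "L2_unit f1" and \<epsilon>: "\<epsilon> > 0"
    and K: "is_test K" and c: "0 < c" "c < 1"
    and \<alpha>: "type1_error (signal_law M w f0 \<epsilon>) K < c" and \<beta>: "type2_error (signal_law M w f1 \<epsilon>) K < c"
  shows "log_error (type1_error (signal_law M w f0 \<epsilon>) K) + log_error (type2_error (signal_law M w f1 \<epsilon>) K)
       \<le> ereal (l2norm (\<lambda>s. f1 s - f0 s) / \<epsilon> + (2 + 2 * log_slack (min (1 / 2) (1 - c))))"
proof -
  \<comment> \<open>The bound 1/2 makes \<open>\<delta> \<le> 1 - e j\<close> follow from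
    \<open>e j < \<delta>\<close>; the bound \<open>1 - c\<close> makes the assumptions at the two
    endpoints usable.\<close>
  define \<delta> where "\<delta> = min (1 / 2) (1 - c)"
  define G where "G = l2norm (\<lambda>s. f1 s - f0 s) / \<epsilon>"
  have \<delta>: "0 < \<delta>" "\<delta> \<le> 1" "\<delta> \<le> 1 / 2" "\<delta> \<le> 1 - c"
    unfolding \<delta>_def using c by linarith+
  have G: "G \<ge> 0"
    using \<epsilon> by (simp add: G_def)
  let ?X = "log_error (type1_error (signal_law M w f0 \<epsilon>) K) + log_error (type2_error (signal_law M w f1 \<epsilon>) K)"
  have N: "?X \<le> ereal (G + G * inverse (real (Suc m)) + (2 + 2 * log_slack \<delta>))" for m
  proof -
    define N where "N = Suc m"
    define f where "f k s = f0 s + real k / real N * (f1 s - f0 s)" for k s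
    define e where "e k = type1_error (signal_law M w (f k) \<epsilon>) K" for k
    note PQ = prob_space_drift_law[OF W] sets_drift_law
    have f: "L2_unit (f k)" for k
      unfolding f_def by (intro L2_unit_add L2_unit_cmult L2_unit_diff f0 f1)
    have f0N: "f 0 = f0" "f N = f1"
      by (auto simp: f_def N_def fun_eq_iff)
    have compl: "type1_error (signal_law M w (f k) \<epsilon>) (\<lambda>y. 1 - K y) = 1 - e k" for k
      using type_errors_sum[OF PQ K, of "\<lambda>t. LINT s|lebesgue_on {0<..<t}. f k s" \<epsilon>]
      unfolding e_def type2_error_eq_type1 by simp
    have e0: "e 0 < c" and eN: "e N > 1 - c"
      using \<alpha> \<beta> compl[of N] by (simp_all add: e_def f0N type2_error_eq_type1)
    define k where "k = (LEAST k. \<delta> \<le> e k)"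
    have "\<delta> \<le> e N"
      using eN \<delta> by simp
    then have k: "\<delta> \<le> e k" "k \<le> N"
      unfolding k_def by (auto intro: LeastI Least_le)
    \<comment> \<open>Truncated subtraction is intended: for \<open>k = 0\<close> also
      \<open>j = 0\<close>, and then \<open>e 0 < c\<close> gives the required bound.\<close>
    define j where "j = k - 1"
    have j: "\<delta> \<le> 1 - e j" "k \<le> Suc j" "j \<le> N"
    proof -
      show "\<delta> \<le> 1 - e j"
      proof (cases "k = 0")
        case True
        then show ?thesis using e0 \<delta> by (simp add: j_def)
      next
        case False
        then have "\<not> \<delta> \<le> e j"
          unfolding j_def k_def by (intro not_less_Least) (simp add: k_def[symmetric])
        then show ?thesis using \<delta> by simp
      qed
    qed (use k in \<open>auto simp: j_def\<close>)
    \<comment> \<open>The summand 1 keeps the shift length positive even for \<open>k = 0\<close> or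
      \<open>G = 0\<close>; it occurs for both errors and gives the 2 in the final constant.\<close>
    have "log_error (type1_error (signal_law M w (f 0) \<epsilon>) K) \<le> ereal (k / N * G + 1 + log_slack \<delta>)"
    proof (rule log_error_signal_shift[OF W f f \<epsilon> _ _ K \<delta>(1,2)])
      have eq: "(\<lambda>s. f k s - f 0 s) = (\<lambda>s. k / N * (f1 s - f0 s))"
        by (simp add: f_def)
      show "l2norm (\<lambda>s. f k s - f 0 s) / \<epsilon> \<le> k / N * G + 1"
        unfolding eq l2norm_cmult by (simp add: G_def)
      show "0 < k / N * G + 1"
        using G by (intro add_nonneg_pos mult_nonneg_nonneg) auto
      show "\<delta> \<le> type1_error (signal_law M w (f k) \<epsilon>) K"
        using k(1) by (simp add: e_def)
    qed
    moreover have "log_error (type1_error (signal_law M w (f N) \<epsilon>) (\<lambda>y. 1 - K y)) \<le> ereal ((1 - j / N) * G + 1 + log_slack \<delta>)"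
    proof (rule log_error_signal_shift[OF W f f \<epsilon> _ _ is_test_complement[OF K] \<delta>(1,2)])
      have eq: "(\<lambda>s. f j s - f N s) = (\<lambda>s. (j / N - 1) * (f1 s - f0 s))"
        by (simp add: f_def N_def algebra_simps)
      have jN: "real j / real N \<le> 1"
        using j(3) by (simp add: N_def)
      then have "\<bar>real j / N - 1\<bar> = 1 - j / N"
        by simp
      then show "l2norm (\<lambda>s. f j s - f N s) / \<epsilon> \<le> (1 - j / N) * G + 1"
        unfolding eq l2norm_cmult by (simp add: G_def)
      show "0 < (1 - j / N) * G + 1"
        using G jN by (intro add_nonneg_pos mult_nonneg_nonneg) auto
      show "\<delta> \<le> type1_error (signal_law M w (f j) \<epsilon>) (\<lambda>y. 1 - K y)"
        using j(1) by (simp add: compl)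
    qed
    ultimately have "?X \<le> ereal ((k / N * G + 1 + log_slack \<delta>) + ((1 - j / N) * G + 1 + log_slack \<delta>))"
      unfolding f0N type2_error_eq_type1 plus_ereal.simps(1)[symmetric] by (rule add_mono)
    also have "\<dots> \<le> ereal (G + G * inverse (real (Suc m)) + (2 + 2 * log_slack \<delta>))"
    proof -
      \<comment> \<open>The two pieces overlap in at most one cell of the grid, which costs
        \<open>G / N\<close> and disappears as the grid is refined.\<close>
      have "real k / N \<le> real (Suc j) / N"
        using j(2) by (intro divide_right_mono) auto
      then have "(real k / N - j / N) * G \<le> inverse (real N) * G"
        using G by (intro mult_right_mono) (auto simp: add_divide_distrib inverse_eq_divide)
      then show ?thesis
        by (simp add: N_def algebra_simps)
    qed
    finally show ?thesis .
  qed
  have "(\<lambda>m. ereal (G + G * inverse (real (Suc m)) + (2 + 2 * log_slack \<delta>)))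
      \<longlonglongrightarrow> ereal (G + G * 0 + (2 + 2 * log_slack \<delta>))"
    by (intro tendsto_intros LIMSEQ_inverse_real_of_nat)
  then have "?X \<le> ereal (G + G * 0 + (2 + 2 * log_slack \<delta>))"
    by (rule LIMSEQ_le_const) (use N in blast)
  then show ?thesis
    by (simp add: G_def \<delta>_def)
qed

section \<open>Asymptotics along the alternatives\<close>

locale shift_experiment =
  fixes M :: "'a measure" and w :: "real \<Rightarrow> 'a \<Rightarrow> real" and \<Theta> :: "real set"
    and S :: "real \<Rightarrow> real \<Rightarrow> real" and \<theta>0 :: real and S' u :: "real \<Rightarrow> real"
  assumes wiener: "wiener_process M w"
    and open_\<Theta>: "open \<Theta>" and \<theta>0: "\<theta>0 \<in> \<Theta>"
    and S_L2: "\<And>\<theta>. \<theta> \<in> \<Theta> \<Longrightarrow> L2_unit (\<lambda>t. S t \<theta>)"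
    and A1: "cond_A1 S \<theta>0 S'"
    and u_pos: "\<And>\<epsilon>. \<epsilon> > 0 \<Longrightarrow> u \<epsilon> > 0"
    and u_lim: "(u \<longlongrightarrow> 0) (at_right 0)"
    and u_rate: "filterlim (\<lambda>\<epsilon>. inverse \<epsilon> * u \<epsilon>) at_top (at_right 0)"
begin

definition remainder :: "real \<Rightarrow> real" where
  "remainder \<epsilon> = l2norm (\<lambda>t. S t (\<theta>0 + u \<epsilon>) - S t \<theta>0 - u \<epsilon> * S' t)"

text \<open>Length of the linearised shift in units of the noise: the normalising factor of the
  theorem.\<close>

definition snr :: "real \<Rightarrow> real" where
  "snr \<epsilon> = inverse \<epsilon> * u \<epsilon> * l2norm S'"

lemma S'_L2: "L2_unit S'" and S'_pos: "l2norm S' > 0"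
  using A1 by (auto simp: cond_A1_def fisher_info_def l2norm_def)

lemma sqrt_fisher: "sqrt (fisher_info S') = l2norm S'"
  by (simp add: fisher_info_def l2norm_def)

lemma fisher_eq: "fisher_info S' = (l2norm S')\<^sup>2"
  by (simp add: fisher_info_def l2norm_sq)

lemma eventually_pos: "\<forall>\<^sub>F \<epsilon> in at_right 0. (0::real) < \<epsilon>"
  by (rule eventually_at_right_less)

lemma tendsto_alternative: "((\<lambda>\<epsilon>. \<theta>0 + u \<epsilon>) \<longlongrightarrow> \<theta>0) (at_right 0)"
  using tendsto_add[OF tendsto_const u_lim, of \<theta>0] by simp

lemma eventually_in_\<Theta>: "\<forall>\<^sub>F \<epsilon> in at_right 0. \<theta>0 + u \<epsilon> \<in> \<Theta>"
  by (rule topological_tendstoD[OF tendsto_alternative open_\<Theta> \<theta>0])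

lemma snr_lim: "filterlim snr at_top (at_right 0)"
  unfolding snr_def[abs_def]
  by (rule filterlim_at_top_mult_tendsto_pos[OF tendsto_const S'_pos u_rate])

lemma snr_pos: "\<epsilon> > 0 \<Longrightarrow> snr \<epsilon> > 0"
  using u_pos S'_pos by (simp add: snr_def)

text \<open>\<open>u \<epsilon> > 0\<close> makes the alternatives differ from \<theta>0, so A1 can
  be composed with them; the square root turns o(u^2) for squared norms into o(u).\<close>

lemma remainder_lim: "((\<lambda>\<epsilon>. remainder \<epsilon> / u \<epsilon>) \<longlongrightarrow> 0) (at_right 0)"
proof -
  have "filterlim (\<lambda>\<epsilon>. \<theta>0 + u \<epsilon>) (at \<theta>0) (at_right 0)"
    unfolding filterlim_at using tendsto_alternative eventually_pos
    by (auto elim!: eventually_mono dest: u_pos)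
  moreover have "(\<lambda>\<theta>. LINT s|lebesgue_on {0<..<1}. (S s \<theta> - S s \<theta>0 - (\<theta> - \<theta>0) * S' s)\<^sup>2)
      \<in> o[at \<theta>0](\<lambda>\<theta>. \<bar>\<theta> - \<theta>0\<bar>\<^sup>2)"
    using A1 by (simp add: cond_A1_def)
  ultimately have "(\<lambda>\<epsilon>. (remainder \<epsilon>)\<^sup>2) \<in> o[at_right 0](\<lambda>\<epsilon>. \<bar>u \<epsilon>\<bar>\<^sup>2)"
    using landau_o.small.compose[of _ "at \<theta>0" _ "\<lambda>\<epsilon>. \<theta>0 + u \<epsilon>" "at_right 0"]
    by (fastforce simp: remainder_def l2norm_sq)
  then have "((\<lambda>\<epsilon>. (remainder \<epsilon>)\<^sup>2 / \<bar>u \<epsilon>\<bar>\<^sup>2) \<longlongrightarrow> 0) (at_right 0)"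
    by (rule smalloD_tendsto)
  then have "((\<lambda>\<epsilon>. sqrt ((remainder \<epsilon>)\<^sup>2 / \<bar>u \<epsilon>\<bar>\<^sup>2)) \<longlongrightarrow> sqrt 0) (at_right 0)"
    by (rule tendsto_real_sqrt)
  moreover have "\<forall>\<^sub>F \<epsilon> in at_right 0. sqrt ((remainder \<epsilon>)\<^sup>2 / \<bar>u \<epsilon>\<bar>\<^sup>2) = remainder \<epsilon> / u \<epsilon>"
    using eventually_pos
    by eventually_elim (use u_pos in \<open>auto simp: real_sqrt_divide remainder_def less_imp_le\<close>)
  ultimately show ?thesis
    by (auto intro: Lim_transform_eventually)
qed

lemma relative_remainder_lim: "((\<lambda>\<epsilon>. remainder \<epsilon> / u \<epsilon> / l2norm S') \<longlongrightarrow> 0) (at_right 0)"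
  using tendsto_divide[OF remainder_lim tendsto_const[of "l2norm S'"]] S'_pos by simp

lemma S_increment_le:
  assumes "\<theta>0 + u \<epsilon> \<in> \<Theta>" "\<epsilon> > 0"
  shows "l2norm (\<lambda>t. S t (\<theta>0 + u \<epsilon>) - S t \<theta>0) \<le> u \<epsilon> * l2norm S' + remainder \<epsilon>"
  using l2norm_triangle_sub[OF L2_unit_diff[OF S_L2[OF assms(1)] S_L2[OF \<theta>0]] L2_unit_cmult[OF S'_L2, of "u \<epsilon>"]]
    u_pos[OF assms(2)]
  by (simp add: l2norm_cmult remainder_def)

text \<open>By A1 the distance between the signals, in units of the noise, is at most
  \<open>snr\<close> times 1 + o(1); the additive constant \<open>D\<close> is divided by
  \<open>snr\<close>, which tends to infinity.\<close>

lemma upper_bound: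
  assumes c: "0 < c" "c < 1" and K: "admissible_tests M w S \<theta>0 u c K"
  shows "Limsup (at_right 0) (normalized_log_error M w S \<theta>0 S' u K) \<le> 1"
proof -
  define D where "D = 2 + 2 * log_slack (min (1 / 2) (1 - c))"
  define B where "B \<epsilon> = 1 + remainder \<epsilon> / u \<epsilon> / l2norm S' + D * inverse (snr \<epsilon>)" for \<epsilon>
  have "\<forall>\<^sub>F \<epsilon> in at_right 0. type1_error (obs_law M w S \<epsilon> \<theta>0) (K \<epsilon>) < c"
    "\<forall>\<^sub>F \<epsilon> in at_right 0. type2_error (obs_law M w S \<epsilon> (\<theta>0 + u \<epsilon>)) (K \<epsilon>) < c"
    using K by (auto simp: admissible_tests_def)
  then have "\<forall>\<^sub>F \<epsilon> in at_right 0. normalized_log_error M w S \<theta>0 S' u K \<epsilon> \<le> ereal (B \<epsilon>)"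
    using eventually_pos eventually_in_\<Theta>
  proof eventually_elim
    case (elim \<epsilon>)
    let ?G = "l2norm (\<lambda>t. S t (\<theta>0 + u \<epsilon>) - S t \<theta>0) / \<epsilon>"
    have "is_test (K \<epsilon>)"
      using K elim(3) by (simp add: admissible_tests_def)
    then have "log_error (type1_error (obs_law M w S \<epsilon> \<theta>0) (K \<epsilon>))
        + log_error (type2_error (obs_law M w S \<epsilon> (\<theta>0 + u \<epsilon>)) (K \<epsilon>)) \<le> ereal (?G + D)"
      unfolding D_def obs_law_drift_law using elim
      by (intro log_errors_sum_le wiener S_L2 \<theta>0 c) (simp_all add: obs_law_drift_law)
    then have "normalized_log_error M w S \<theta>0 S' u K \<epsilon> \<le> ereal (inverse (snr \<epsilon>)) * ereal (?G + D)"
      unfolding normalized_log_error_def sqrt_fisher snr_def[symmetric]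
      using snr_pos[OF elim(3)] by (intro ereal_mult_left_mono) auto
    also have "\<dots> \<le> ereal (B \<epsilon>)"
    proof -
      have "?G \<le> (u \<epsilon> * l2norm S' + remainder \<epsilon>) / \<epsilon>"
        using S_increment_le[OF elim(4,3)] elim(3) by (intro divide_right_mono) auto
      then have "inverse (snr \<epsilon>) * (?G + D) \<le> inverse (snr \<epsilon>) * ((u \<epsilon> * l2norm S' + remainder \<epsilon>) / \<epsilon> + D)"
        using snr_pos[OF elim(3)] by (intro mult_left_mono) auto
      also have "\<dots> = B \<epsilon>"
        using elim(3) u_pos[OF elim(3)] S'_pos by (simp add: B_def snr_def field_simps)
      finally show ?thesis
        by simp
    qed
    finally show ?case .
  qed
  then have "Limsup (at_right 0) (normalized_log_error M w S \<theta>0 S' u K) \<le> Limsup (at_right 0) (\<lambda>\<epsilon>. ereal (B \<epsilon>))"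
    by (rule Limsup_mono)
  also have "(B \<longlongrightarrow> 1 + 0 + D * 0) (at_right 0)"
    unfolding B_def[abs_def]
    by (intro tendsto_intros relative_remainder_lim tendsto_inverse_0_at_top snr_lim)
  then have "((\<lambda>\<epsilon>. ereal (B \<epsilon>)) \<longlongrightarrow> 1) (at_right 0)"
    by (simp add: one_ereal_def)
  then have "Limsup (at_right 0) (\<lambda>\<epsilon>. ereal (B \<epsilon>)) = 1"
    by (intro lim_imp_Limsup) auto
  finally show ?thesis .
qed

text \<open>Midway between the mean of the test statistic at \<theta>0 and its mean at the
  alternative to first order; these differ by \<open>u \<epsilon> * l2norm S'\<close>.\<close>

definition midpoint_threshold :: "real \<Rightarrow> real" where
  "midpoint_threshold \<epsilon> = (l2inner S' (\<lambda>t. S t \<theta>0) + u \<epsilon> * fisher_info S' / 2) / sqrt (fisher_info S')"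

section \<open>Errors of the midpoint test\<close>

context
  fixes J :: "(real \<Rightarrow> real) \<Rightarrow> real"
  assumes J: "\<And>\<epsilon> \<theta>. \<epsilon> > 0 \<Longrightarrow> \<theta> \<in> \<Theta> \<Longrightarrow> is_stoch_integral (obs_law M w S \<epsilon> \<theta>) S' J"
begin

abbreviation "midpoint_test \<equiv> threshold_test (\<lambda>y. J y / sqrt (fisher_info S')) midpoint_threshold"

lemma midpoint_test_reject:
  "J y / sqrt (fisher_info S') > midpoint_threshold \<epsilon>
     \<longleftrightarrow> J y > l2inner S' (\<lambda>t. S t \<theta>0) + u \<epsilon> * (l2norm S')\<^sup>2 / 2"
  using S'_pos by (simp add: midpoint_threshold_def sqrt_fisher divide_less_cancel) (simp add: fisher_eq)

lemma J_measurable: "J \<in> borel_measurable path_space"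
  using J[of 1, OF _ \<theta>0] by (simp add: is_stoch_integral_def)

lemma midpoint_is_test: "is_test (midpoint_test \<epsilon>)"
proof -
  note [measurable] = J_measurable
  show ?thesis
    unfolding is_test_def threshold_test_def[abs_def] by (auto intro!: measurable_If)
qed

text \<open>The standard deviation of \<open>J\<close> is \<open>\<epsilon> * l2norm S'\<close>, so
  rejection at \<theta>0 takes an excess of \<open>snr \<epsilon> / 2\<close> standard
  deviations.\<close>

lemma midpoint_type1:
  assumes "\<epsilon> > 0"
  shows "type1_error (obs_law M w S \<epsilon> \<theta>0) (midpoint_test \<epsilon>) \<le> exp (- (snr \<epsilon> / 2)\<^sup>2 / 2)"
proof -
  note PQ = prob_space_drift_law[OF wiener] sets_drift_law
  let ?P = "signal_law M w (\<lambda>t. S t \<theta>0) \<epsilon>"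
  let ?A = "{y \<in> space path_space. snr \<epsilon> / 2 * l2norm S' * \<epsilon> \<le> 1 * (J y - l2inner S' (\<lambda>t. S t \<theta>0))}"
  interpret prob_space ?P
    by (rule PQ)
  note [measurable] = J_measurable
  have "type1_error ?P (midpoint_test \<epsilon>) \<le> (LINT y|?P. indicator ?A y)"
    unfolding type1_error_def
  proof (rule integral_mono)
    show "integrable ?P (midpoint_test \<epsilon>)"
      by (rule test_integrable[OF PQ midpoint_is_test])
    show "integrable ?P (indicator ?A :: _ \<Rightarrow> real)"
      by (intro integrable_real_indicator) (auto simp: less_top[symmetric])
    have "snr \<epsilon> / 2 * l2norm S' * \<epsilon> = u \<epsilon> * (l2norm S')\<^sup>2 / 2"
      using assms by (simp add: snr_def power2_eq_square)
    then show "midpoint_test \<epsilon> y \<le> indicator ?A y" if "y \<in> space ?P" for y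
      using that midpoint_test_reject[of \<epsilon> y] by (auto simp: threshold_test_def indicator_def)
  qed
  also have "\<dots> = measure ?P ?A"
    by simp
  also have "\<dots> \<le> exp (- (snr \<epsilon> / 2)\<^sup>2 / 2)"
    using J[OF assms \<theta>0] assms snr_pos[OF assms] unfolding obs_law_drift_law
    by (intro stoch_integral_tail wiener S'_L2 S_L2 \<theta>0 S'_pos) auto
  finally show ?thesis
    by (simp add: obs_law_drift_law)
qed

text \<open>The linearisation error moves the mean of \<open>J\<close> at the alternative by at most
  \<open>l2norm S' * remainder \<epsilon>\<close>, that is, by
  \<open>remainder \<epsilon> / \<epsilon>\<close> standard deviations. The last hypothesis keeps
  the remaining distance to the threshold nonnegative, as the tail bound requires.\<close>

lemma midpoint_type2:
  assumes "\<epsilon> > 0" "\<theta>0 + u \<epsilon> \<in> \<Theta>" "remainder \<epsilon> / \<epsilon> \<le> snr \<epsilon> / 2"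
  shows "type2_error (obs_law M w S \<epsilon> (\<theta>0 + u \<epsilon>)) (midpoint_test \<epsilon>) \<le> exp (- (snr \<epsilon> / 2 - remainder \<epsilon> / \<epsilon>)\<^sup>2 / 2)"
proof -
  note PQ = prob_space_drift_law[OF wiener] sets_drift_law
  let ?f = "\<lambda>t. S t (\<theta>0 + u \<epsilon>)"
  let ?P = "signal_law M w ?f \<epsilon>"
  define x where "x = snr \<epsilon> / 2 - remainder \<epsilon> / \<epsilon>"
  let ?A = "{y \<in> space path_space. x * l2norm S' * \<epsilon> \<le> - 1 * (J y - l2inner S' ?f)}"
  interpret prob_space ?P
    by (rule PQ)
  note [measurable] = J_measurable
  have shift: "l2inner S' ?f \<ge> l2inner S' (\<lambda>t. S t \<theta>0) + u \<epsilon> * (l2norm S')\<^sup>2 - l2norm S' * remainder \<epsilon>"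
  proof -
    let ?r = "\<lambda>t. ?f t - S t \<theta>0 - u \<epsilon> * S' t"
    note L2 = S_L2[OF assms(2)] S_L2[OF \<theta>0] S'_L2
    have "l2inner ?r S' = l2inner ?f S' - l2inner (\<lambda>t. S t \<theta>0) S' - u \<epsilon> * (l2norm S')\<^sup>2"
      by (simp add: l2inner_diff L2 L2_unit_diff L2_unit_cmult l2inner_cmult l2inner_self)
    moreover have "\<bar>l2inner ?r S'\<bar> \<le> remainder \<epsilon> * l2norm S'"
      unfolding remainder_def by (intro l2_Cauchy_Schwarz L2_unit_diff L2_unit_cmult L2)
    ultimately show ?thesis
      using abs_ge_minus_self[of "l2inner ?r S'"]
      by (simp add: l2inner_commute[of S'] mult.commute[of "l2norm S'"])
  qed
  have "type2_error ?P (midpoint_test \<epsilon>) \<le> (LINT y|?P. indicator ?A y)"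
    unfolding type2_error_def
  proof (rule integral_mono)
    show "integrable ?P (\<lambda>y. 1 - midpoint_test \<epsilon> y)"
      by (rule test_integrable[OF PQ is_test_complement[OF midpoint_is_test]])
    show "integrable ?P (indicator ?A :: _ \<Rightarrow> real)"
      by (intro integrable_real_indicator) (auto simp: less_top[symmetric])
    have "x * l2norm S' * \<epsilon> = u \<epsilon> * (l2norm S')\<^sup>2 / 2 - l2norm S' * remainder \<epsilon>"
      using assms(1) by (simp add: x_def snr_def power2_eq_square field_simps)
    then show "1 - midpoint_test \<epsilon> y \<le> indicator ?A y" if "y \<in> space ?P" for y
      using that shift midpoint_test_reject[of \<epsilon> y] by (auto simp: threshold_test_def indicator_def)
  qed
  also have "\<dots> = measure ?P ?A"
    by simp
  also have "\<dots> \<le> exp (- x\<^sup>2 / 2)"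
    using J[OF assms(1,2)] assms unfolding obs_law_drift_law
    by (intro stoch_integral_tail wiener S'_L2 S_L2 S'_pos) (auto simp: x_def)
  finally show ?thesis
    by (simp add: obs_law_drift_law x_def)
qed

lemma relative_gap_lim: "((\<lambda>\<epsilon>. 1 / 2 - remainder \<epsilon> / u \<epsilon> / l2norm S') \<longlongrightarrow> 1 / 2) (at_right 0)"
  using tendsto_diff[OF tendsto_const relative_remainder_lim, of "1 / 2"] by simp

text \<open>\<open>remainder \<epsilon> / \<epsilon>\<close> need not tend to 0; A1 makes it
  negligible relative to \<open>snr\<close>, which is why \<open>snr\<close> is factored
  out.\<close>

lemma gap_eq: "\<epsilon> > 0 \<Longrightarrow> snr \<epsilon> / 2 - remainder \<epsilon> / \<epsilon> = (1 / 2 - remainder \<epsilon> / u \<epsilon> / l2norm S') * snr \<epsilon>"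
  using u_pos[of \<epsilon>] S'_pos by (simp add: snr_def field_simps)

lemma gap_lim: "filterlim (\<lambda>\<epsilon>. snr \<epsilon> / 2 - remainder \<epsilon> / \<epsilon>) at_top (at_right 0)"
proof -
  have "filterlim (\<lambda>\<epsilon>. (1 / 2 - remainder \<epsilon> / u \<epsilon> / l2norm S') * snr \<epsilon>) at_top (at_right 0)"
    by (rule filterlim_tendsto_pos_mult_at_top[OF relative_gap_lim _ snr_lim]) simp
  then show ?thesis
    by (rule filterlim_mono_eventually[OF _ order_refl order_refl])
       (use eventually_pos in \<open>eventually_elim, simp add: gap_eq\<close>)
qed

lemma eventually_gap: "\<forall>\<^sub>F \<epsilon> in at_right 0. remainder \<epsilon> / \<epsilon> \<le> snr \<epsilon> / 2"
proof -
  have "\<forall>\<^sub>F \<epsilon> in at_right 0. 0 \<le> snr \<epsilon> / 2 - remainder \<epsilon> / \<epsilon>"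
    using gap_lim unfolding filterlim_at_top by blast
  then show ?thesis
    by eventually_elim simp
qed

lemma exp_neg_square_lim:
  assumes "filterlim g at_top F"
  shows "((\<lambda>x. exp (- (g x :: real)\<^sup>2 / 2)) \<longlongrightarrow> 0) F"
proof -
  have "filterlim (\<lambda>x. 1 / 2 * (g x)\<^sup>2) at_top F"
    by (rule filterlim_tendsto_pos_mult_at_top[OF tendsto_const])
       (use assms in \<open>auto intro!: filterlim_pow_at_top\<close>)
  then have "((\<lambda>x. exp (- (1 / 2 * (g x)\<^sup>2))) \<longlongrightarrow> 0) F"
    by (intro filterlim_compose[OF exp_at_bot] filterlim_compose[OF filterlim_uminus_at_bot_at_top])
  then show ?thesis
    by simp
qed

lemma midpoint_admissible:
  assumes "0 < c"
  shows "admissible_tests M w S \<theta>0 u c midpoint_test"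
  unfolding admissible_tests_def
proof (intro conjI allI impI)
  show "is_test (midpoint_test \<epsilon>)" for \<epsilon>
    by (rule midpoint_is_test)
  have "filterlim (\<lambda>\<epsilon>. 1 / 2 * snr \<epsilon>) at_top (at_right 0)"
    by (rule filterlim_tendsto_pos_mult_at_top[OF tendsto_const _ snr_lim]) simp
  then have "\<forall>\<^sub>F \<epsilon> in at_right 0. exp (- (snr \<epsilon> / 2)\<^sup>2 / 2) < c"
    using exp_neg_square_lim[of "\<lambda>\<epsilon>. snr \<epsilon> / 2"] assms by (intro order_tendstoD) auto
  then show "\<forall>\<^sub>F \<epsilon> in at_right 0. type1_error (obs_law M w S \<epsilon> \<theta>0) (midpoint_test \<epsilon>) < c"
    using eventually_pos by eventually_elim (use midpoint_type1 in \<open>blast intro: le_less_trans\<close>)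
  have "\<forall>\<^sub>F \<epsilon> in at_right 0. exp (- (snr \<epsilon> / 2 - remainder \<epsilon> / \<epsilon>)\<^sup>2 / 2) < c"
    using exp_neg_square_lim[OF gap_lim] assms by (rule order_tendstoD)
  then show "\<forall>\<^sub>F \<epsilon> in at_right 0. type2_error (obs_law M w S \<epsilon> (\<theta>0 + u \<epsilon>)) (midpoint_test \<epsilon>) < c"
    using eventually_pos eventually_in_\<Theta> eventually_gap
    by eventually_elim (use midpoint_type2 in \<open>blast intro: le_less_trans\<close>)
qed

text \<open>Each error contributes at least \<open>snr \<epsilon> / 2\<close>, one of them up to the
  linearisation error, and division by \<open>snr\<close> leaves 1 - o(1). An error probability
  equal to 0 is covered, its \<open>log_error\<close> being infinite.\<close>

lemma midpoint_lower_bound: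
  "1 \<le> Limsup (at_right 0) (normalized_log_error M w S \<theta>0 S' u midpoint_test)"
proof -
  note PQ = prob_space_drift_law[OF wiener] sets_drift_law
  have "\<forall>\<^sub>F \<epsilon> in at_right 0. ereal (1 - remainder \<epsilon> / u \<epsilon> / l2norm S')
      \<le> normalized_log_error M w S \<theta>0 S' u midpoint_test \<epsilon>"
    using eventually_pos eventually_in_\<Theta> eventually_gap
  proof eventually_elim
    case (elim \<epsilon>)
    have "ereal (snr \<epsilon> / 2) \<le> log_error (type1_error (obs_law M w S \<epsilon> \<theta>0) (midpoint_test \<epsilon>))"
      using snr_pos[OF elim(1)] midpoint_type1[OF elim(1)] type1_error_bounds(1)[OF PQ midpoint_is_test]
      by (intro log_error_ge) (auto simp: obs_law_drift_law)
    moreover have "ereal (snr \<epsilon> / 2 - remainder \<epsilon> / \<epsilon>)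
        \<le> log_error (type2_error (obs_law M w S \<epsilon> (\<theta>0 + u \<epsilon>)) (midpoint_test \<epsilon>))"
      using elim midpoint_type2[OF elim] type1_error_bounds(1)[OF PQ is_test_complement[OF midpoint_is_test]]
      by (intro log_error_ge) (auto simp: obs_law_drift_law type2_error_eq_type1)
    ultimately have "ereal (snr \<epsilon> / 2 + (snr \<epsilon> / 2 - remainder \<epsilon> / \<epsilon>))
        \<le> log_error (type1_error (obs_law M w S \<epsilon> \<theta>0) (midpoint_test \<epsilon>))
          + log_error (type2_error (obs_law M w S \<epsilon> (\<theta>0 + u \<epsilon>)) (midpoint_test \<epsilon>))"
      unfolding plus_ereal.simps(1)[symmetric] by (rule add_mono)
    then have "ereal (inverse (snr \<epsilon>)) * ereal (snr \<epsilon> / 2 + (snr \<epsilon> / 2 - remainder \<epsilon> / \<epsilon>))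
        \<le> normalized_log_error M w S \<theta>0 S' u midpoint_test \<epsilon>"
      unfolding normalized_log_error_def sqrt_fisher snr_def[symmetric]
      using snr_pos[OF elim(1)] by (intro ereal_mult_left_mono) auto
    moreover have "inverse (snr \<epsilon>) * (snr \<epsilon> / 2 + (snr \<epsilon> / 2 - remainder \<epsilon> / \<epsilon>)) = 1 - remainder \<epsilon> / u \<epsilon> / l2norm S'"
      unfolding gap_eq[OF elim(1)] using snr_pos[OF elim(1)] by (simp add: field_simps)
    ultimately show ?case
      by simp
  qed
  then have "Limsup (at_right 0) (\<lambda>\<epsilon>. ereal (1 - remainder \<epsilon> / u \<epsilon> / l2norm S'))
      \<le> Limsup (at_right 0) (normalized_log_error M w S \<theta>0 S' u midpoint_test)"
    by (rule Limsup_mono)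
  moreover have "((\<lambda>\<epsilon>. ereal (1 - remainder \<epsilon> / u \<epsilon> / l2norm S')) \<longlongrightarrow> ereal (1 - 0)) (at_right 0)"
    by (intro tendsto_intros relative_remainder_lim)
  then have "Limsup (at_right 0) (\<lambda>\<epsilon>. ereal (1 - remainder \<epsilon> / u \<epsilon> / l2norm S')) = 1"
    by (intro lim_imp_Limsup) (auto simp: one_ereal_def)
  ultimately show ?thesis
    by simp
qed

end

end

theorem theorem2p1:
  fixes M :: "'a measure"
    and w :: "real \<Rightarrow> 'a \<Rightarrow> real"
    and \<Theta> :: "real set"
    and S :: "real \<Rightarrow> real \<Rightarrow> real"
    and \<theta>0 :: real
    and S' :: "real \<Rightarrow> real"
    and u :: "real \<Rightarrow> real"
    and c :: real
  assumes "wiener_process M w"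
    and "open \<Theta>" and "\<theta>0 \<in> \<Theta>"
    and "\<forall>\<theta>\<in>\<Theta>. L2_unit (\<lambda>t. S t \<theta>)"
    and "cond_A1 S \<theta>0 S'"
    and "\<forall>\<epsilon>>0. u \<epsilon> > 0"
    and "(u \<longlongrightarrow> 0) (at_right 0)"
    and "filterlim (\<lambda>\<epsilon>. inverse \<epsilon> * u \<epsilon>) at_top (at_right 0)"
    and "0 < c" and "c < 1"
  shows "(\<forall>K. admissible_tests M w S \<theta>0 u c K \<longrightarrow>
            Limsup (at_right 0) (normalized_log_error M w S \<theta>0 S' u K) \<le> 1) \<and>
         (\<exists>J. \<forall>\<epsilon>>0. \<forall>\<theta>\<in>\<Theta>. is_stoch_integral (obs_law M w S \<epsilon> \<theta>) S' J) \<and>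
         (\<forall>J. (\<forall>\<epsilon>>0. \<forall>\<theta>\<in>\<Theta>. is_stoch_integral (obs_law M w S \<epsilon> \<theta>) S' J) \<longrightarrow>
            (\<exists>h. let K = threshold_test (\<lambda>y. J y / sqrt (fisher_info S')) h in
               admissible_tests M w S \<theta>0 u c K \<and>
               Limsup (at_right 0) (normalized_log_error M w S \<theta>0 S' u K) = 1))"
proof -
  interpret shift_experiment M w \<Theta> S \<theta>0 S' u
    using assms by unfold_locales auto
  show ?thesis
  proof (intro conjI allI impI)
    show "Limsup (at_right 0) (normalized_log_error M w S \<theta>0 S' u K) \<le> 1"
      if "admissible_tests M w S \<theta>0 u c K" for K
      by (rule upper_bound[OF assms(9,10) that])
    \<comment> \<open>Existence of a common version keeps the last claim, which is about all such
      versions, from being vacuous.\<close>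
    show "\<exists>J. \<forall>\<epsilon>>0. \<forall>\<theta>\<in>\<Theta>. is_stoch_integral (obs_law M w S \<epsilon> \<theta>) S' J"
      using stoch_integral_exists[OF wiener S'_L2] S_L2 unfolding obs_law_drift_law by blast
    fix J assume "\<forall>\<epsilon>>0. \<forall>\<theta>\<in>\<Theta>. is_stoch_integral (obs_law M w S \<epsilon> \<theta>) S' J"
    then have J: "\<And>\<epsilon> \<theta>. \<epsilon> > 0 \<Longrightarrow> \<theta> \<in> \<Theta> \<Longrightarrow> is_stoch_integral (obs_law M w S \<epsilon> \<theta>) S' J"
      by blast
    \<comment> \<open>Admissibility makes the general upper bound applicable to the midpoint tests,
      where it meets the lower bound.\<close>
    note adm = midpoint_admissible[OF J assms(9)]
    show "\<exists>h. let K = threshold_test (\<lambda>y. J y / sqrt (fisher_info S')) h in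
        admissible_tests M w S \<theta>0 u c K \<and>
        Limsup (at_right 0) (normalized_log_error M w S \<theta>0 S' u K) = 1"
      unfolding Let_def using adm upper_bound[OF assms(9,10) adm] midpoint_lower_bound[OF J]
      by (intro exI[of _ midpoint_threshold] conjI antisym)
  qed
qed

end
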